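(* Let $F$ be the nonlinear attractor of an IFS $\{S_i\}_{i\in\mathcal I}$ on $[0,1]^2$ (of the type described in the context) which satisfies the domination condition, and let $\gamma$ be the associated moment scaling function. Then: (1) $\overline{\dim_B}\,F\le\gamma(0)$. (2) If moreover $\{S_i\}_{i\in\mathcal I}$ satisfies the rectangular open set condition, then the box dimension of $F$ exists and $\dim_B F=\gamma(0)$.
   Context: **IFS.** $\mathcal I$ is a finite index set with $|\mathcal I|\ge 2$, and $\{S_i\}_{i\in\mathcal I}$ is an iterated function system of contractions $S_i:[0,1]^2\to[0,1]^2$ of the form $S_i(a_1,a_2)=(f_i(a_1),g_i(a_1,a_2))$, where $f_i$ and $g_i$ are $C^{1+\alpha}$ contractions on $[0,1]$ and $[0,1]^2$ respectively, for some $0<\alpha\le1$ (their first derivatives are $\alpha$-Hölder; one-sided derivatives are used on the boundary). We also write $f_i(\mathbf a)=f_i(a_1)$ for $\mathbf a=(a_1,a_2)$; $f_{i,x}$ is the derivative of $f_i$ and $g_{i,x},g_{i,y}$ are the partial derivatives of $g_i$. **Nonlinear attractor and measure.** The nonlinear attractor $F$ is the unique non-empty compact set with $F=\bigcup_{i\in\mathcal I}S_i(F)$. For a probability vector $\{p_i\}_{i\in\mathcal I}$ with each $p_i\in(0,1)$, the nonlinear measure $\mu$ is the unique Borel probability measure supported on $F$ with $\mu=\sum_{i\in\mathcal I}p_i\,\mu\circ S_i^{-1}$. **Domination condition.** There is $d>0$ such that for every $i\in\mathcal I$, $$\inf_{\mathbf a\in[0,1]^2}f_{i,x}(\mathbf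 a)>\sup_{\mathbf a\in[0,1]^2}g_{i,y}(\mathbf a)\ge\inf_{\mathbf a\in[0,1]^2}g_{i,y}(\mathbf a)\ge d.$$ **Rectangular open set condition (ROSC).** The sets $S_i((0,1)^2)$, $i\in\mathcal I$, are pairwise disjoint subsets of $(0,1)^2$. **Box dimension.** For bounded non-empty $X\subset\mathbb R^n$, $N_\delta(X)$ is the minimal number of sets of diameter at most $\delta$ needed to cover $X$; $\overline{\dim_B}X=\limsup_{\delta\to0}\frac{\log N_\delta(X)}{-\log\delta}$, $\underline{\dim_B}X=\liminf_{\delta\to0}\frac{\log N_\delta(X)}{-\log\delta}$, and $\dim_BX$ is the common value if they coincide. **$L^q$-spectrum.** For a compactly supported Borel probability measure $\nu$ on $\mathbb R^n$ and $q\ge0$, let $\mathcal D_\delta^q(\nu)=\sum_{Q}\nu(Q)^q$, the sum over closed cubes $Q$ of the $\delta$-mesh on $\mathbb R^n$ with $\nu(Q)>0$; $\tau_\nu(q)=\lim_{\delta\to0}\frac{\log\mathcal D^q_\delta(\nu)}{-\log\delta}$ when the limit exists. **Projection.** $\pi:\mathbb R^2\to\mathbb R$, $\pi(x,y)=x$, and $\pi(\mu)$ denotes the push-forward of $\mu$ under $\pi$. By a known result of Peres and Solomyak $\beta(q):=\tau_{\pi(\mu)}(q)$ exists for all $q\ge0$; in particular $\beta(0)=\dim_B\pi(F)$. **Words.** $\mathcal I^*=\bigcup_{k\ge1}\mathcal I^k$; for $\mathfrak i=(i_1,\dots,i_k)$, $S_{\mathfrak i}=S_{i_1}\circ\cdots\circ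 S_{i_k}$ and $p(\mathfrak i)=p_{i_1}\cdots p_{i_k}$. $D_{\mathbf a}S_{\mathfrak i}$ is the Jacobian matrix of $S_{\mathfrak i}$ at $\mathbf a$, and $\alpha_1(D_{\mathbf a}S_{\mathfrak i})\ge\alpha_2(D_{\mathbf a}S_{\mathfrak i})$ are its singular values (positive square roots of the eigenvalues of $A^TA$ for $A=D_{\mathbf a}S_{\mathfrak i}$). **Pressure and moment scaling function.** Under the domination condition, for $s\in\mathbb R$, $q\ge0$, $\mathbf a\in[0,1]^2$ set $$\psi^{s,q}_{\mathbf a}(\mathfrak i)=p(\mathfrak i)^q\,\alpha_1(D_{\mathbf a}S_{\mathfrak i})^{\beta(q)}\,\alpha_2(D_{\mathbf a}S_{\mathfrak i})^{s-\beta(q)},\qquad P(s,q)=\lim_{k\to\infty}\Big(\sum_{\mathfrak i\in\mathcal I^k}\psi^{s,q}_{\mathbf a}(\mathfrak i)\Big)^{1/k}.$$ This limit exists and does not depend on $\mathbf a$. For each $q\ge0$ there is a unique $s\in\mathbb R$ with $P(s,q)=1$, and $\gamma(q)$ is defined to be this $s$. For $q=0$ we have $p(\mathfrak i)^0=1$ and $\beta(0)=\dim_B\pi(F)$, so $\gamma(0)$ does not depend on the probability vector $\{p_i\}$. *)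

theory Defs
  imports "HOL-Analysis.Analysis" "HOL-Probability.Probability_Measure"
begin

section \<open>Box dimension\<close>

text \<open>Boundedness is required because \<^const>\<open>diameter\<close> is unspecified on unbounded sets.\<close>

definition covering_number :: "real \<Rightarrow> 'a::metric_space set \<Rightarrow> nat" where
  "covering_number \<delta> X =
     (LEAST n. \<exists>\<U>. finite \<U> \<and> card \<U> = n \<and> X \<subseteq> \<Union>\<U> \<and> (\<forall>U\<in>\<U>. bounded U \<and> diameter U \<le> \<delta>))"

definition upper_box_dim :: "'a::metric_space set \<Rightarrow> ereal" where
  "upper_box_dim X =
     Limsup (at_right 0) (\<lambda>\<delta>. ereal (ln (real (covering_number \<delta> X)) / (- ln \<delta>)))"

definition lower_box_dim :: "'a::metric_space set \<Rightarrow> ereal" where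
  "lower_box_dim X =
     Liminf (at_right 0) (\<lambda>\<delta>. ereal (ln (real (covering_number \<delta> X)) / (- ln \<delta>)))"

definition has_box_dim :: "'a::metric_space set \<Rightarrow> ereal \<Rightarrow> bool" where
  "has_box_dim X s \<longleftrightarrow> lower_box_dim X = s \<and> upper_box_dim X = s"


section \<open>The \<open>L\<^sup>q\<close>-spectrum\<close>

definition mesh_cubes :: "real \<Rightarrow> 'a::euclidean_space set set" where
  "mesh_cubes \<delta> = {cbox a (a + \<delta> *\<^sub>R One) | a. \<forall>b\<in>Basis. \<exists>m::int. a \<bullet> b = \<delta> * of_int m}"

text \<open>Cubes of measure zero are excluded, so for \<open>q = 0\<close> every summand is \<open>1\<close>. The sum is
  finite when \<open>\<nu>\<close> has compact support and \<open>\<delta> > 0\<close>.\<close>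

definition moment_sum :: "'a::euclidean_space measure \<Rightarrow> real \<Rightarrow> real \<Rightarrow> real" where
  "moment_sum \<nu> q \<delta> = (\<Sum>Q \<in> {Q \<in> mesh_cubes \<delta>. measure \<nu> Q > 0}. measure \<nu> Q powr q)"

definition Lq_spectrum :: "'a::euclidean_space measure \<Rightarrow> real \<Rightarrow> real" where
  "Lq_spectrum \<nu> q = Lim (at_right 0) (\<lambda>\<delta>. ln (moment_sum \<nu> q \<delta>) / (- ln \<delta>))"


section \<open>The iterated function system\<close>

abbreviation unit_square :: "(real^2) set" where
  "unit_square \<equiv> cbox 0 1"

text \<open>Partial derivatives relative to \<open>K\<close>. On \<open>[0,1]\<close> and \<open>[0,1]\<^sup>2\<close> the derivative within
  the set is unique, and at boundary points it gives the one-sided partial derivatives.\<close>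

definition partial_deriv_on ::
  "'a::euclidean_space set \<Rightarrow> ('a \<Rightarrow> real) \<Rightarrow> 'a \<Rightarrow> 'a \<Rightarrow> real" where
  "partial_deriv_on K h b x = frechet_derivative h (at x within K) b"

definition C1_holder_on :: "real \<Rightarrow> 'a::euclidean_space set \<Rightarrow> ('a \<Rightarrow> real) \<Rightarrow> bool" where
  "C1_holder_on \<alpha> K h \<longleftrightarrow> h differentiable_on K \<and>
     (\<forall>b\<in>Basis. \<exists>C. \<forall>x\<in>K. \<forall>y\<in>K.
        \<bar>partial_deriv_on K h b x - partial_deriv_on K h b y\<bar> \<le> C * dist x y powr \<alpha>)"

definition contraction_on :: "'a::metric_space set \<Rightarrow> ('a \<Rightarrow> 'b::metric_space) \<Rightarrow> bool" where
  "contraction_on K h \<longleftrightarrow> (\<exists>c<1. c-lipschitz_on K h)"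

definition ifs_map ::
  "('i \<Rightarrow> real \<Rightarrow> real) \<Rightarrow> ('i \<Rightarrow> real^2 \<Rightarrow> real) \<Rightarrow> 'i \<Rightarrow> real^2 \<Rightarrow> real^2" where
  "ifs_map f g i a = vector [f i (a $ 1), g i a]"

text \<open>The maps are total functions; only their restrictions to \<open>[0,1]\<close> and \<open>[0,1]\<^sup>2\<close> matter.\<close>

definition nonlinear_ifs ::
  "('i::finite \<Rightarrow> real \<Rightarrow> real) \<Rightarrow> ('i \<Rightarrow> real^2 \<Rightarrow> real) \<Rightarrow> bool" where
  "nonlinear_ifs f g \<longleftrightarrow>
     CARD('i) \<ge> 2 \<and>
     (\<forall>i. ifs_map f g i ` unit_square \<subseteq> unit_square \<and>
          contraction_on unit_square (ifs_map f g i) \<and>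
          contraction_on {0..1} (f i) \<and>
          contraction_on unit_square (g i)) \<and>
     (\<exists>\<alpha>. 0 < \<alpha> \<and> \<alpha> \<le> 1 \<and>
          (\<forall>i. C1_holder_on \<alpha> {0..1} (f i) \<and> C1_holder_on \<alpha> unit_square (g i)))"

definition dominated ::
  "('i \<Rightarrow> real \<Rightarrow> real) \<Rightarrow> ('i \<Rightarrow> real^2 \<Rightarrow> real) \<Rightarrow> bool" where
  "dominated f g \<longleftrightarrow> (\<exists>d>0. \<forall>i.
     (let fx = (\<lambda>a::real^2. partial_deriv_on {0..1} (f i) 1 (a $ 1));
          gy = partial_deriv_on unit_square (g i) (axis 2 1)
      in (INF a\<in>unit_square. fx a) > (SUP a\<in>unit_square. gy a) \<and>
         (SUP a\<in>unit_square. gy a) \<ge> (INF a\<in>unit_square. gy a) \<and>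
         (INF a\<in>unit_square. gy a) \<ge> d))"

definition rosc :: "('i \<Rightarrow> real^2 \<Rightarrow> real^2) \<Rightarrow> bool" where
  "rosc S \<longleftrightarrow> (\<forall>i. S i ` box 0 1 \<subseteq> box 0 1) \<and>
              (\<forall>i j. i \<noteq> j \<longrightarrow> S i ` box 0 1 \<inter> S j ` box 0 1 = {})"

definition attractor :: "('i \<Rightarrow> real^2 \<Rightarrow> real^2) \<Rightarrow> (real^2) set \<Rightarrow> bool" where
  "attractor S F \<longleftrightarrow> compact F \<and> F \<noteq> {} \<and> F \<subseteq> unit_square \<and> F = (\<Union>i. S i ` F)"

definition probability_vector :: "('i::finite \<Rightarrow> real) \<Rightarrow> bool" where
  "probability_vector p \<longleftrightarrow> (\<forall>i. 0 < p i \<and> p i < 1) \<and> (\<Sum>i\<in>UNIV. p i) = 1"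

text \<open>The preimage under \<open>S i\<close> is taken in \<open>[0,1]\<^sup>2\<close>, where \<open>S i\<close> lives.\<close>

definition nonlinear_measure ::
  "('i::finite \<Rightarrow> real^2 \<Rightarrow> real^2) \<Rightarrow> ('i \<Rightarrow> real) \<Rightarrow> (real^2) set \<Rightarrow> (real^2) measure \<Rightarrow> bool"
  where
  "nonlinear_measure S p F \<mu> \<longleftrightarrow>
     prob_space \<mu> \<and> sets \<mu> = sets borel \<and> measure \<mu> (- F) = 0 \<and>
     (\<forall>A\<in>sets borel. measure \<mu> A = (\<Sum>i\<in>UNIV. p i * measure \<mu> (S i -` A \<inter> unit_square)))"


section \<open>Pressure and the moment scaling function\<close>

definition word_map :: "('i \<Rightarrow> real^2 \<Rightarrow> real^2) \<Rightarrow> 'i list \<Rightarrow> real^2 \<Rightarrow> real^2" where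
  "word_map S w = foldr (\<circ>) (map S w) id"

definition word_weight :: "('i \<Rightarrow> real) \<Rightarrow> 'i list \<Rightarrow> real" where
  "word_weight p w = prod_list (map p w)"

definition word_jacobian :: "('i \<Rightarrow> real^2 \<Rightarrow> real^2) \<Rightarrow> 'i list \<Rightarrow> real^2 \<Rightarrow> real^2^2" where
  "word_jacobian S w a = jacobian (word_map S w) (at a within unit_square)"

definition singular_values :: "real^'n^'n \<Rightarrow> real set" where
  "singular_values A =
     sqrt ` {t. \<exists>v. v \<noteq> 0 \<and> (transpose A ** A) *v v = t *s v}"

text \<open>A \<open>2 \<times> 2\<close> matrix has two singular values counted with multiplicity, so these are the
  larger and the smaller one; they agree when the set is a singleton.\<close>

definition sv1 :: "real^2^2 \<Rightarrow> real" where
  "sv1 A = Max (singular_values A)"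

definition sv2 :: "real^2^2 \<Rightarrow> real" where
  "sv2 A = Min (singular_values A)"

definition proj_spectrum :: "(real^2) measure \<Rightarrow> real \<Rightarrow> real" where
  "proj_spectrum \<mu> q = Lq_spectrum (distr \<mu> borel (\<lambda>x. x $ 1)) q"

definition psi ::
  "('i \<Rightarrow> real^2 \<Rightarrow> real^2) \<Rightarrow> ('i \<Rightarrow> real) \<Rightarrow> (real^2) measure \<Rightarrow> real^2 \<Rightarrow>
   real \<Rightarrow> real \<Rightarrow> 'i list \<Rightarrow> real" where
  "psi S p \<mu> a s q w =
     word_weight p w powr q *
     sv1 (word_jacobian S w a) powr proj_spectrum \<mu> q *
     sv2 (word_jacobian S w a) powr (s - proj_spectrum \<mu> q)"

definition pressure ::
  "('i::finite \<Rightarrow> real^2 \<Rightarrow> real^2) \<Rightarrow> ('i \<Rightarrow> real) \<Rightarrow> (real^2) measure \<Rightarrow> real^2 \<Rightarrow>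
   real \<Rightarrow> real \<Rightarrow> real" where
  "pressure S p \<mu> a s q =
     lim (\<lambda>k. (\<Sum>w | length w = k. psi S p \<mu> a s q w) powr (1 / real k))"

definition moment_scaling ::
  "('i::finite \<Rightarrow> real^2 \<Rightarrow> real^2) \<Rightarrow> ('i \<Rightarrow> real) \<Rightarrow> (real^2) measure \<Rightarrow> real^2 \<Rightarrow>
   real \<Rightarrow> real" where
  "moment_scaling S p \<mu> a q = (THE s. pressure S p \<mu> a s q = 1)"

end

theory Submission
  imports Defs "HOL-Real_Asymp.Real_Asymp" "HOL-Library.Sublist"
begin

text \<open>Write \<open>A\<^sub>w\<close>, \<open>B\<^sub>w\<close> for the diagonal entries of the (triangular) Jacobian of \<open>S\<^sub>w\<close>.
  Bounded distortion makes them multiplicative in \<open>w\<close> up to constants, and domination bounds the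
  off-diagonal entry by a multiple of \<open>A\<^sub>w\<close>, so they are comparable to the singular values. Let
  \<open>P(r)\<close> be the packing number of the projection \<open>E = \<pi>(F)\<close>. It is supermultiplicative because
  \<open>E\<close> is quasi self-similar, hence \<open>P(r) = r\<^bsup>-\<beta>+o(1)\<^esup>\<close> with \<open>\<beta> = \<beta>(0)\<close>. At \<open>s = \<gamma>(0)\<close>
  the sums of \<open>A\<^sub>w\<^bsup>\<beta>\<^esup> B\<^sub>w\<^bsup>s-\<beta>\<^esup>\<close> over words of fixed length are bounded away from \<open>0\<close> and
  \<open>\<infinity>\<close>, and therefore so are the sums over the words at which \<open>B\<^sub>w\<close> first drops below
  \<open>\<delta>\<close>. For such \<open>w\<close>, the piece \<open>S\<^sub>w(F)\<close> lies in a strip of height about \<open>\<delta>\<close> and is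
  covered by about \<open>P(\<delta>/A\<^sub>w)\<close> sets of diameter \<open>\<delta>\<close>, which gives the upper bound. Under the
  rectangular open set condition each of these strips that meets a set of diameter \<open>\<delta>\<close> has a
  point of a fixed lattice of mesh about \<open>\<delta>\<close> nearby in its interior, by the intermediate value
  theorem; as the interiors are disjoint, boundedly many strips meet such a set, and the covering
  is optimal up to a constant.\<close>

section \<open>Growth rates and packing numbers\<close>


text \<open>The projection \<open>E\<close> may have overlaps, so its packing numbers are controlled
  only up to an arbitrarily small loss \<epsilon> in the exponent. The loss is harmless: at a
  stopping word \<open>A w\<close> lies between a multiple of \<delta> and a constant, so an error
  \<open>(\<delta> / A w) powr (- \<epsilon>)\<close> costs at most a multiple of
  \<open>\<delta> powr (- \<epsilon>)\<close>, uniformly in \<open>w\<close>, and \<epsilon> is sent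
  to zero after \<delta>. For the weighted sums more is available: their logarithms are additive up
  to a bounded error, which gives two-sided constants instead of mere asymptotics. The measure
  enters through the mesh cells that it charges. Every cylinder has positive mass, so at
  \<open>q = 0\<close> the spectrum of the projected measure counts cells near \<open>E\<close>. The
  lattice is forced by the shape of the strips: they can be much longer than \<delta> and sheared,
  so their total area says nothing about the part near a given small set. A lattice point close to a
  prescribed point of the strip localises the count, and strips with disjoint interiors cannot share
  it.\<close>

lemma fekete:
  fixes a :: "nat \<Rightarrow> real"
  assumes sub: "\<And>m n. m \<ge> 1 \<Longrightarrow> n \<ge> 1 \<Longrightarrow> a (m + n) \<le> a m + a n"
    and lb: "\<And>n. n \<ge> 1 \<Longrightarrow> - M * real n \<le> a n"
  shows "\<exists>L. (\<lambda>n. a n / real n) \<longlonglongrightarrow> L \<and> (\<forall>n\<ge>1. L * real n \<le> a n)"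
proof -
  define T where "T = (\<lambda>n. a n / real n) ` {1..}"
  define L where "L = Inf T"
  have bdd: "bdd_below T"
    unfolding T_def using lb by (intro bdd_belowI2[of _ "-M"]) (auto simp: field_simps)
  have L_le: "L \<le> a n / real n" if "n \<ge> 1" for n
    unfolding L_def using bdd that by (intro cInf_lower) (auto simp: T_def)
  have mult: "a (q * m + r) \<le> real q * a m + a r" if "m \<ge> 1" "r \<ge> 1" for q m r
  proof (induction q)
    case (Suc q)
    have "a (Suc q * m + r) = a (m + (q * m + r))" by (simp add: algebra_simps)
    also have "\<dots> \<le> a m + a (q * m + r)" using that by (intro sub) auto
    finally show ?case using Suc by (simp add: algebra_simps)
  qed simp
  have "(\<lambda>n. a n / real n) \<longlonglongrightarrow> L"
  proof (rule order_tendstoI)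
    fix y assume "y < L"
    then show "\<forall>\<^sub>F n in sequentially. y < a n / real n"
      using L_le by (intro eventually_sequentiallyI[of 1]) (meson less_le_trans)
  next
    fix y assume "L < y"
    then obtain m where m: "m \<ge> 1" "a m / real m < y"
      unfolding L_def using cInf_lessD[of T y] by (auto simp: T_def)
    define K where "K = (\<Sum>r\<le>m. \<bar>a r\<bar>) + \<bar>a m\<bar>"
    have bound: "a n / real n \<le> a m / real m + K / real n" if "n > 0" for n
    proof -
      \<comment> \<open>The remainder is taken in \<open>{1..m}\<close> instead of
        \<open>{0..m - 1}\<close>, because subadditivity is assumed for positive indices and says
        nothing about \<open>a 0\<close>.\<close>
      define q where "q = (n - 1) div m"
      define r where "r = (n - 1) mod m + 1"
      have n: "n = q * m + r" using that by (simp add: q_def r_def)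
      have r: "1 \<le> r" "r \<le> m" using m by (auto simp: r_def Suc_le_eq)
      have "\<bar>a r\<bar> \<le> (\<Sum>r\<le>m. \<bar>a r\<bar>)" using r by (intro member_le_sum) auto
      moreover have "real q * a m = (real n - real r) * (a m / real m)"
        using m by (simp add: n)
      moreover have "- (real r * (a m / real m)) \<le> \<bar>a m\<bar>"
      proof -
        have "real r * (\<bar>a m\<bar> / real m) \<le> real m * (\<bar>a m\<bar> / real m)"
          using r by (intro mult_right_mono) auto
        moreover have "- (real r * (a m / real m)) \<le> real r * (\<bar>a m\<bar> / real m)"
          by (metis abs_ge_minus_self abs_divide abs_mult abs_of_nat)
        ultimately show ?thesis using m by simp
      qed
      ultimately have "a n \<le> real n * (a m / real m) + K"
        using mult[OF m(1) r(1), of q] n by (simp add: K_def algebra_simps)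
      then show ?thesis using that by (simp add: field_simps)
    qed
    have "(\<lambda>n. a m / real m + K / real n) \<longlonglongrightarrow> a m / real m + 0"
      by (intro tendsto_intros lim_const_over_n)
    then have "\<forall>\<^sub>F n in sequentially. a m / real m + K / real n < y"
      using m(2) by (intro order_tendstoD) auto
    then show "\<forall>\<^sub>F n in sequentially. a n / real n < y"
      using eventually_gt_at_top[of 0] by eventually_elim (use bound in \<open>meson le_less_trans\<close>)
  qed
  moreover have "L * real n \<le> a n" if "n \<ge> 1" for n
    using L_le[OF that] that by (simp add: field_simps)
  ultimately show ?thesis by blast
qed

text \<open>Both \<open>a + K\<close> and \<open>K - a\<close> are subadditive, so
  \<open>fekete\<close> applies from above and from below. The two limits agree up to sign, and the
  two linear bounds together leave a deviation of at most \<open>K\<close> for every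
  \<open>n\<close>, which is stronger than convergence of the averages.\<close>

lemma almost_additive_limit:
  fixes a :: "nat \<Rightarrow> real"
  assumes add: "\<And>m n. m \<ge> 1 \<Longrightarrow> n \<ge> 1 \<Longrightarrow> \<bar>a (m + n) - a m - a n\<bar> \<le> K"
  shows "\<exists>L. (\<lambda>n. a n / real n) \<longlonglongrightarrow> L \<and> (\<forall>n\<ge>1. \<bar>a n - L * real n\<bar> \<le> K)"
proof -
  have lin: "\<bar>a n - real n * a 1\<bar> \<le> K * real n" if "n \<ge> 1" for n
    using that
  proof (induction n rule: nat_induct_at_least)
    case base
    have "0 \<le> K" using add[of 1 1] by linarith
    then show ?case by simp
  next
    case (Suc n)
    then show ?case using add[of n 1] by (simp add: algebra_simps abs_if split: if_splits)
  qed
  have K0: "0 \<le> K" using add[of 1 1] by linarith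
  have "\<exists>L. (\<lambda>n. (a n + K) / real n) \<longlonglongrightarrow> L \<and> (\<forall>n\<ge>1. L * real n \<le> a n + K)"
  proof (rule fekete[where M = "\<bar>a 1\<bar> + K"])
    fix m n :: nat assume "m \<ge> 1" "n \<ge> 1"
    then show "a (m + n) + K \<le> a m + K + (a n + K)" using add[of m n] by linarith
  next
    fix n :: nat assume "n \<ge> 1"
    moreover have "- (real n * \<bar>a 1\<bar>) \<le> real n * a 1"
      by (metis abs_ge_minus_self abs_mult abs_of_nat minus_le_iff)
    ultimately show "- (\<bar>a 1\<bar> + K) * real n \<le> a n + K"
      using lin[of n] K0 by (simp add: algebra_simps)
  qed
  then obtain L where L: "(\<lambda>n. (a n + K) / real n) \<longlonglongrightarrow> L" "\<And>n. n\<ge>1 \<Longrightarrow> L * real n \<le> a n + K"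
    by blast
  have "\<exists>L. (\<lambda>n. (K - a n) / real n) \<longlonglongrightarrow> L \<and> (\<forall>n\<ge>1. L * real n \<le> K - a n)"
  proof (rule fekete[where M = "\<bar>a 1\<bar> + K"])
    fix m n :: nat assume "m \<ge> 1" "n \<ge> 1"
    then show "K - a (m + n) \<le> K - a m + (K - a n)" using add[of m n] by linarith
  next
    fix n :: nat assume "n \<ge> 1"
    moreover have "real n * a 1 \<le> real n * \<bar>a 1\<bar>"
      by (simp add: mult_left_mono)
    ultimately have "a n \<le> real n * \<bar>a 1\<bar> + K * real n + K"
      using lin[of n] K0 by linarith
    then show "- (\<bar>a 1\<bar> + K) * real n \<le> K - a n"
      by (simp add: algebra_simps)
  qed
  then obtain L' where L': "(\<lambda>n. (K - a n) / real n) \<longlonglongrightarrow> L'" "\<And>n. n\<ge>1 \<Longrightarrow> L' * real n \<le> K - a n"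
    by blast
  have lim: "(\<lambda>n. a n / real n) \<longlonglongrightarrow> L"
    using tendsto_diff[OF L(1) lim_const_over_n[of K]] by (simp add: diff_divide_distrib[symmetric])
  have "(\<lambda>n. a n / real n) \<longlonglongrightarrow> - L'"
    using tendsto_diff[OF lim_const_over_n[of K] L'(1)] by (simp add: diff_divide_distrib[symmetric])
  then have "L = - L'" using lim LIMSEQ_unique by blast
  then have "\<bar>a n - L * real n\<bar> \<le> K" if "n \<ge> 1" for n
    using L(2)[OF that] L'(2)[OF that] by (simp add: abs_le_iff)
  with lim show ?thesis by blast
qed

text \<open>Multiplicative constants are invisible on the logarithmic scale: half of the gap
  \<open>y - s\<close> is spent on the exponent, the other half on beating \<open>ln C\<close>. The
  constant may therefore depend on \<epsilon>.\<close>

lemma eventually_log_ratio_less: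
  fixes N :: "real \<Rightarrow> real"
  assumes "\<And>\<epsilon>. \<epsilon> > 0 \<Longrightarrow> \<exists>C>0. \<forall>\<^sub>F r in at_right 0. 0 < N r \<and> N r \<le> C * r powr - (s + \<epsilon>)"
    and "s < y"
  shows "\<forall>\<^sub>F r in at_right 0. ln (N r) / (- ln r) < y"
proof -
  define \<epsilon> where "\<epsilon> = (y - s) / 2"
  have "\<epsilon> > 0" using assms(2) by (simp add: \<epsilon>_def)
  then obtain C where C: "C > 0" "\<forall>\<^sub>F r in at_right 0. 0 < N r \<and> N r \<le> C * r powr - (s + \<epsilon>)"
    using assms(1) by blast
  have "filterlim (\<lambda>r::real. \<epsilon> * (- ln r) - ln C) at_top (at_right 0)"
    using \<open>\<epsilon> > 0\<close> by real_asymp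
  then have big: "\<forall>\<^sub>F r in at_right 0. 0 < \<epsilon> * (- ln r) - ln C"
    unfolding filterlim_at_top_dense by blast
  have "\<forall>\<^sub>F r in at_right 0. 0 < r \<and> r < (1::real)"
    by (auto simp: eventually_at_right_field intro: exI[of _ 1])
  with C(2) big show ?thesis
  proof eventually_elim
    case (elim r)
    have "ln (N r) \<le> ln (C * r powr - (s + \<epsilon>))"
      using elim C(1) by (subst ln_le_cancel_iff) auto
    also have "\<dots> = ln C + (s + \<epsilon>) * (- ln r)"
      using elim C(1) by (simp add: ln_mult ln_powr algebra_simps)
    also have "\<dots> < y * (- ln r)"
    proof -
      have "y = s + \<epsilon> + \<epsilon>" by (simp add: \<epsilon>_def field_simps)
      then show ?thesis using elim by (simp add: algebra_simps)
    qed
    finally show ?case using elim by (subst pos_divide_less_eq) auto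
  qed
qed

lemma eventually_log_ratio_greater:
  fixes N :: "real \<Rightarrow> real"
  assumes "\<And>\<epsilon>. \<epsilon> > 0 \<Longrightarrow> \<exists>C>0. \<forall>\<^sub>F r in at_right 0. C * r powr - (s - \<epsilon>) \<le> N r"
    and "y < s"
  shows "\<forall>\<^sub>F r in at_right 0. y < ln (N r) / (- ln r)"
proof -
  define \<epsilon> where "\<epsilon> = (s - y) / 2"
  have "\<epsilon> > 0" using assms(2) by (simp add: \<epsilon>_def)
  then obtain C where C: "C > 0" "\<forall>\<^sub>F r in at_right 0. C * r powr - (s - \<epsilon>) \<le> N r"
    using assms(1) by blast
  have "filterlim (\<lambda>r::real. \<epsilon> * (- ln r) + ln C) at_top (at_right 0)"
    using \<open>\<epsilon> > 0\<close> by real_asymp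
  then have big: "\<forall>\<^sub>F r in at_right 0. 0 < \<epsilon> * (- ln r) + ln C"
    unfolding filterlim_at_top_dense by blast
  have "\<forall>\<^sub>F r in at_right 0. 0 < r \<and> r < (1::real)"
    by (auto simp: eventually_at_right_field intro: exI[of _ 1])
  with C(2) big show ?thesis
  proof eventually_elim
    case (elim r)
    have pos: "0 < C * r powr - (s - \<epsilon>)" using elim C(1) by auto
    have "y * (- ln r) < ln C + (s - \<epsilon>) * (- ln r)"
    proof -
      have "s - \<epsilon> = y + \<epsilon>" by (simp add: \<epsilon>_def field_simps)
      then show ?thesis using elim by (simp only:) (simp add: algebra_simps)
    qed
    also have "\<dots> = ln (C * r powr - (s - \<epsilon>))"
      using elim C(1) by (simp add: ln_mult ln_powr algebra_simps)
    also have "\<dots> \<le> ln (N r)"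
      using elim pos by (subst ln_le_cancel_iff) auto
    finally show ?case using elim by (subst pos_less_divide_eq) auto
  qed
qed

section \<open>Packing numbers of subsets of the unit interval\<close>

definition separated :: "real \<Rightarrow> 'a::metric_space set \<Rightarrow> bool" where
  "separated r X \<longleftrightarrow> (\<forall>x\<in>X. \<forall>y\<in>X. x \<noteq> y \<longrightarrow> r < dist x y)"

text \<open>\<open>GREATEST\<close> is meaningful only when the cardinalities are bounded;
  \<open>separated_card_bound\<close> supplies the bound for subsets of the unit interval and
  positive \<open>r\<close>.\<close>

definition packing_number :: "'a::metric_space set \<Rightarrow> real \<Rightarrow> nat" where
  "packing_number E r =
     (GREATEST n. \<exists>X. finite X \<and> card X = n \<and> X \<subseteq> E \<and> separated r X)"

lemma separated_card_bound:
  fixes X :: "real set"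
  assumes "r > 0" "X \<subseteq> {0..1}" "finite X" "separated r X"
  shows "real (card X) \<le> 1 / r + 1"
proof -
  have "inj_on (\<lambda>x. \<lfloor>x / r\<rfloor>) X"
  proof (rule inj_onI, rule ccontr)
    fix x y assume xy: "x \<in> X" "y \<in> X" "\<lfloor>x / r\<rfloor> = \<lfloor>y / r\<rfloor>" "x \<noteq> y"
    then have "\<bar>x / r - y / r\<bar> < 1" by linarith
    then have "\<bar>x - y\<bar> < r" using assms(1) by (simp add: diff_divide_distrib[symmetric])
    moreover have "r < \<bar>x - y\<bar>" using assms(4) xy by (auto simp: separated_def dist_real_def)
    ultimately show False by simp
  qed
  moreover have "(\<lambda>x. \<lfloor>x / r\<rfloor>) ` X \<subseteq> {0..\<lfloor>1 / r\<rfloor>}"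
    using assms(1,2) by (force intro!: floor_mono divide_right_mono)
  ultimately have "card X \<le> card {0..\<lfloor>1 / r\<rfloor>}"
    by (metis card_image card_mono finite_atLeastAtMost_int)
  moreover have "real (card {0..\<lfloor>1 / r\<rfloor>}) = of_int \<lfloor>1 / r\<rfloor> + 1"
    using assms(1) by (simp add: nat_add_distrib)
  ultimately have "real (card X) \<le> of_int \<lfloor>1 / r\<rfloor> + 1" by simp
  then show ?thesis by linarith
qed

context
  fixes E :: "real set" and r :: real
  assumes E: "E \<subseteq> {0..1}" and r: "r > 0"
begin

lemma packing_exists_max:
  "\<exists>X. finite X \<and> card X = packing_number E r \<and> X \<subseteq> E \<and> separated r X"
  unfolding packing_number_def
proof (rule GreatestI_nat[where b = "nat \<lceil>1 / r + 1\<rceil>"])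
  show "\<exists>X. finite X \<and> card X = 0 \<and> X \<subseteq> E \<and> separated r X"
    by (rule exI[of _ "{}"]) (simp add: separated_def)
  show "n \<le> nat \<lceil>1 / r + 1\<rceil>"
    if "\<exists>X. finite X \<and> card X = n \<and> X \<subseteq> E \<and> separated r X" for n
    using that separated_card_bound[OF r] E by (smt (verit) le_nat_iff of_nat_ceiling order_trans real_nat_ceiling_ge of_nat_le_iff)
qed

lemma card_le_packing:
  assumes "finite X" "X \<subseteq> E" "separated r X"
  shows "card X \<le> packing_number E r"
  unfolding packing_number_def
proof (rule Greatest_le_nat[where b = "nat \<lceil>1 / r + 1\<rceil>"])
  show "\<exists>Y. finite Y \<and> card Y = card X \<and> Y \<subseteq> E \<and> separated r Y" using assms by blast
  show "n \<le> nat \<lceil>1 / r + 1\<rceil>"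
    if "\<exists>X. finite X \<and> card X = n \<and> X \<subseteq> E \<and> separated r X" for n
    using that separated_card_bound[OF r] E by (smt (verit) le_nat_iff of_nat_ceiling order_trans real_nat_ceiling_ge of_nat_le_iff)
qed

text \<open>A point farther than \<open>r\<close> from all of \<open>X\<close> could be added to
  \<open>X\<close>, contradicting maximality. One set thus serves as packing and as net, so covers
  of \<open>E\<close> are counted by packing numbers too. The strict inequality in
  \<open>separated\<close> is matched by the closed radius of the net.\<close>

lemma packing_obtain:
  obtains X where "finite X" "card X = packing_number E r" "X \<subseteq> E" "separated r X"
    "\<And>e. e \<in> E \<Longrightarrow> \<exists>x\<in>X. \<bar>e - x\<bar> \<le> r"
proof -
  obtain X where X: "finite X" "card X = packing_number E r" "X \<subseteq> E" "separated r X"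
    using packing_exists_max by blast
  moreover have "\<exists>x\<in>X. \<bar>e - x\<bar> \<le> r" if "e \<in> E" for e
  proof (rule ccontr)
    assume "\<not> ?thesis"
    then have far: "\<forall>x\<in>X. r < \<bar>e - x\<bar>" by auto
    with r have "e \<notin> X" by force
    moreover have "separated r (insert e X)"
      using X(4) far by (auto simp: separated_def dist_real_def abs_minus_commute)
    then have "card (insert e X) \<le> packing_number E r"
      using X that by (intro card_le_packing) auto
    ultimately show False using X by simp
  qed
  ultimately show thesis using that by blast
qed

lemma packing_number_le: "real (packing_number E r) \<le> 1 / r + 1"
  using packing_exists_max separated_card_bound[OF r] E by (metis order_trans)

lemma packing_number_ge_1: "E \<noteq> {} \<Longrightarrow> 1 \<le> packing_number E r"
  using card_le_packing[of "{SOME x. x \<in> E}"] by (auto simp: separated_def some_in_eq)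

end

lemma packing_antimono:
  fixes E :: "real set"
  assumes "E \<subseteq> {0..1}" "0 < r" "r \<le> t"
  shows "packing_number E t \<le> packing_number E r"
proof -
  obtain X where X: "finite X" "card X = packing_number E t" "X \<subseteq> E" "separated t X"
    using packing_exists_max[OF assms(1), of t] assms by auto
  then have "separated r X" using assms(3) by (force simp: separated_def)
  then show ?thesis using card_le_packing[OF assms(1,2)] X by metis
qed

text \<open>Along the scales \<open>c ^ (n - 1)\<close> the shift by one absorbs the factor
  \<open>c\<close> in the hypothesis, so \<open>- a\<close> is subadditive, and the trivial bound
  \<open>1 / r + 1\<close> keeps the limit finite. \<open>fekete\<close> gives no rate of
  convergence, hence the \<epsilon> in the lower bound. Radii above 1 are included because the
  ratios \<open>\<delta> / A w\<close> met later may exceed 1.\<close>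

lemma supermultiplicative_power_law:
  fixes P :: "real \<Rightarrow> real"
  assumes c: "0 < c" "c < 1"
    and anti: "\<And>r t. 0 < r \<Longrightarrow> r \<le> t \<Longrightarrow> P t \<le> P r"
    and ge1: "\<And>r. 0 < r \<Longrightarrow> 1 \<le> P r"
    and le: "\<And>r. 0 < r \<Longrightarrow> P r \<le> 1 / r + 1"
    and super: "\<And>r t. 0 < r \<Longrightarrow> r \<le> 1 \<Longrightarrow> 0 < t \<Longrightarrow> t \<le> 1 \<Longrightarrow> P r * P t \<le> P (c * r * t)"
  shows "\<exists>\<beta>. \<forall>\<epsilon>>0. \<forall>R\<ge>1. \<exists>C\<ge>1. \<forall>r. 0 < r \<and> r \<le> R \<longrightarrow>
           r powr - (\<beta> - \<epsilon>) / C \<le> P r \<and> P r \<le> C * r powr - (\<beta> + \<epsilon>)"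
proof -
  define a where "a n = ln (P (c ^ (n - 1)))" for n :: nat
  have pos: "0 < P r" if "0 < r" for r using ge1[OF that] by simp
  have "\<exists>L. (\<lambda>n. - a n / real n) \<longlonglongrightarrow> L \<and> (\<forall>n\<ge>1. L * real n \<le> - a n)"
  proof (rule fekete[where M = "ln 2 - ln c"])
    fix m n :: nat assume mn: "m \<ge> 1" "n \<ge> 1"
    have "c * c ^ (m - 1) * c ^ (n - 1) = c ^ (Suc (m - 1) + (n - 1))" by (simp add: power_add)
    also have "Suc (m - 1) + (n - 1) = m + n - 1" using mn by simp
    finally have "P (c ^ (m - 1)) * P (c ^ (n - 1)) \<le> P (c ^ (m + n - 1))"
      using super[of "c ^ (m - 1)" "c ^ (n - 1)"] c by (simp add: power_le_one)
    then have "ln (P (c ^ (m - 1)) * P (c ^ (n - 1))) \<le> ln (P (c ^ (m + n - 1)))"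
      using pos c by (subst ln_le_cancel_iff) auto
    then have "a m + a n \<le> a (m + n)"
      using pos[of "c ^ (m-1)"] pos[of "c ^ (n-1)"] c by (simp add: a_def ln_mult)
    then show "- a (m + n) \<le> - a m + - a n" by simp
  next
    fix n :: nat assume n: "n \<ge> 1"
    have "1 \<le> 1 / c ^ (n - 1)" using c by (simp add: power_le_one)
    moreover have "2 / c ^ (n - 1) = 1 / c ^ (n - 1) + 1 / c ^ (n - 1)" by simp
    ultimately have "P (c ^ (n - 1)) \<le> 2 / c ^ (n - 1)"
      using le[of "c ^ (n - 1)"] c by (smt (verit) zero_less_power)
    then have "a n \<le> ln (2 / c ^ (n - 1))"
      unfolding a_def using pos c by (subst ln_le_cancel_iff) auto
    also have "\<dots> = ln 2 - real (n - 1) * ln c" using c by (simp add: ln_div ln_realpow)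
    also have "\<dots> \<le> real n * ln 2 - real n * ln c"
    proof -
      have "ln 2 \<le> real n * ln 2" using n by simp
      moreover have "real n * ln c \<le> real (n - 1) * ln c"
        using c by (intro mult_right_mono_neg) auto
      ultimately show ?thesis by linarith
    qed
    finally show "- (ln 2 - ln c) * real n \<le> - a n" by (simp add: algebra_simps)
  qed
  then obtain L' where L': "(\<lambda>n. - a n / real n) \<longlonglongrightarrow> L'" "\<And>n. n \<ge> 1 \<Longrightarrow> L' * real n \<le> - a n" by blast
  define L where "L = - L'"
  have L: "(\<lambda>n. a n / real n) \<longlonglongrightarrow> L" using tendsto_minus[OF L'(1)] by (simp add: L_def)
  have aL: "a n \<le> L * real n" if "n \<ge> 1" for n using L'(2)[OF that] by (simp add: L_def)
  have a0: "0 \<le> a n" for n unfolding a_def using ge1 c by simp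
  have L0: "0 \<le> L" using aL[of 1] a0[of 1] by simp
  define \<beta> where "\<beta> = L / (- ln c)"
  have lnc: "ln c < 0" using c by simp
  have "\<exists>C\<ge>1. \<forall>r. 0 < r \<and> r \<le> R \<longrightarrow>
           r powr - (\<beta> - \<epsilon>) / C \<le> P r \<and> P r \<le> C * r powr - (\<beta> + \<epsilon>)"
    if "\<epsilon> > 0" "R \<ge> 1" for \<epsilon> R
  proof -
    define e where "e = \<epsilon> * (- ln c)"
    have e: "e > 0" using that lnc by (simp add: e_def mult_pos_neg)
    have "\<forall>\<^sub>F n in sequentially. L - e < a n / real n" using L e by (intro order_tendstoD) auto
    then obtain n0 where n0: "\<And>n. n \<ge> n0 \<Longrightarrow> L - e < a n / real n"
      by (auto simp: eventually_sequentially)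
    define K where "K = real n0 * L"
    have K0: "0 \<le> K" using L0 by (simp add: K_def)
    have low: "(L - e) * real n - K \<le> a n" if "n \<ge> 1" for n
    proof (cases "n \<ge> n0")
      case True
      then show ?thesis using n0[OF True] that K0 by (simp add: field_simps)
    next
      case False
      then have "(L - e) * real n \<le> K" unfolding K_def
        using e L0 by (smt (verit) mult.commute mult_mono of_nat_0_le_iff of_nat_le_iff nle_le)
      then show ?thesis using a0[of n] by simp
    qed
    \<comment> \<open>\<open>2 * L\<close> pays for the index \<open>n + 1 \<le> x + 2\<close> in
      the upper bound, \<open>\<bar>L - e\<bar>\<close> for rounding \<open>x\<close> to
      \<open>n\<close> in the lower bound, and \<open>K\<close> for the initial indices below
      \<open>n0\<close>.\<close>
    define C1 where "C1 = exp (2 * L + \<bar>L - e\<bar> + K)"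
    \<comment> \<open>The factors \<open>P 1\<close> and the power of \<open>R\<close> serve the
      radii \<open>1 < r \<le> R\<close>.\<close>
    define C where "C = C1 * P 1 * R powr (\<bar>\<beta> - \<epsilon>\<bar> + \<bar>\<beta> + \<epsilon>\<bar>)"
    have C1: "1 \<le> C1" using K0 L0 by (simp add: C1_def)
    have Rp: "1 \<le> R powr x" if "0 \<le> x" for x using that \<open>R \<ge> 1\<close> by (simp add: ge_one_powr_ge_zero)
    have P1: "1 \<le> P 1" using ge1 by simp
    have C: "C1 \<le> C" "P 1 \<le> C" "R powr (\<bar>\<beta> - \<epsilon>\<bar> + \<bar>\<beta> + \<epsilon>\<bar>) * P 1 \<le> C"
    proof -
      let ?x = "R powr (\<bar>\<beta> - \<epsilon>\<bar> + \<bar>\<beta> + \<epsilon>\<bar>)"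
      have x: "1 \<le> ?x" by (rule Rp) simp
      have "C1 * (1 * 1) \<le> C1 * (P 1 * ?x)" using C1 P1 x by (intro mult_mono) auto
      then show "C1 \<le> C" by (simp add: C_def mult.assoc)
      have "1 * P 1 * 1 \<le> C1 * P 1 * ?x" using C1 P1 x by (intro mult_mono) auto
      then show "P 1 \<le> C" by (simp add: C_def)
      have "1 * (P 1 * ?x) \<le> C1 * (P 1 * ?x)" using C1 P1 x by (intro mult_right_mono) auto
      then show "?x * P 1 \<le> C" by (simp add: C_def mult_ac)
    qed
    have main: "r powr - (\<beta> - \<epsilon>) / C \<le> P r \<and> P r \<le> C * r powr - (\<beta> + \<epsilon>)"
      if r: "0 < r" "r \<le> R" for r
    proof (cases "r \<le> 1")
      case True
      define x where "x = ln r / ln c"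
      have x0: "0 \<le> x" unfolding x_def using True r lnc by (simp add: divide_nonpos_neg)
      \<comment> \<open>Here \<open>x\<close> is the logarithm of \<open>r\<close> to the base
        \<open>c\<close>, so \<open>c ^ n \<le> r \<le> c ^ (n - 1)\<close>. Because of the shift in
        \<open>a\<close>, these two scales correspond to \<open>a (n + 1)\<close> and
        \<open>a n\<close>.\<close>
      define n where "n = nat \<lfloor>x\<rfloor> + 1"
      have n: "real n - 1 \<le> x" "x < real n" "n \<ge> 1" using x0 unfolding n_def by linarith+
      have rx: "r = c powr x" using r c unfolding x_def powr_def by simp
      \<comment> \<open>One identity for both bounds: it is used with \<open>t = 1\<close> above and
        with \<open>t = -1\<close> below.\<close>
      have pw: "r powr - (\<beta> + t * \<epsilon>) = exp ((L + t * e) * x)" for t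
      proof -
        have "ln r = x * ln c" using c(1) lnc by (simp add: x_def)
        moreover have "\<beta> * ln c = - L" "\<epsilon> * ln c = - e" using lnc by (auto simp: \<beta>_def e_def)
        then have "- (\<beta> + t * \<epsilon>) * (x * ln c) = (L + t * e) * x" by algebra
        ultimately show ?thesis using r by (simp add: powr_def)
      qed
      have "c powr x \<le> c powr real (n - 1)" using n c by (intro powr_mono') auto
      then have r1: "r \<le> c ^ (n - 1)" using c rx by (simp add: powr_realpow)
      have "c powr real n \<le> c powr x" using n c by (intro powr_mono') auto
      then have r2: "c ^ n \<le> r" using c rx by (simp add: powr_realpow)
      have "P r \<le> P (c ^ n)" using r2 c by (intro anti) auto
      also have "\<dots> = exp (a (n + 1))" unfolding a_def using pos c by simp
      also have "\<dots> \<le> exp (L * (x + 2))"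
      proof -
        have "L * real (n + 1) \<le> L * (x + 2)" using L0 n by (intro mult_left_mono) auto
        then show ?thesis using aL[of "n + 1"] by simp
      qed
      also have "\<dots> \<le> exp ((L + e) * x + (2 * L + \<bar>L - e\<bar> + K))"
        using e x0 K0 by (simp add: algebra_simps)
      also have "\<dots> = C1 * r powr - (\<beta> + \<epsilon>)" using pw[of 1] by (simp add: C1_def exp_add)
      also have "\<dots> \<le> C * r powr - (\<beta> + \<epsilon>)" using C by (intro mult_right_mono) auto
      finally have up: "P r \<le> C * r powr - (\<beta> + \<epsilon>)" .
      have "r powr - (\<beta> - \<epsilon>) / C \<le> r powr - (\<beta> - \<epsilon>) / C1"
        using C C1 by (intro divide_left_mono) auto
      also have "\<dots> = exp ((L - e) * x - (2 * L + \<bar>L - e\<bar> + K))"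
        using pw[of "-1"] by (simp add: C1_def exp_diff)
      also have "\<dots> \<le> exp (a n)"
      proof -
        have "(L - e) * x - (L - e) * real n \<le> \<bar>L - e\<bar>"
        proof -
          have "(L - e) * (x - real n) \<le> \<bar>L - e\<bar> * \<bar>x - real n\<bar>" by (metis abs_ge_self abs_mult)
          also have "\<dots> \<le> \<bar>L - e\<bar> * 1" using n by (intro mult_left_mono) auto
          finally show ?thesis by (simp add: algebra_simps)
        qed
        then show ?thesis using low[OF n(3)] L0 by simp
      qed
      also have "\<dots> = P (c ^ (n - 1))" unfolding a_def using pos c by simp
      also have "\<dots> \<le> P r" using r1 r by (intro anti) auto
      finally show ?thesis using up by blast
    next
      case False
      \<comment> \<open>On \<open>1 < r \<le> R\<close> all quantities stay between positive
        constants: \<open>P r\<close> lies between 1 and \<open>P 1\<close>, and any power of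
        \<open>r\<close> is at most the corresponding power of \<open>R\<close>.\<close>
      have bd: "r powr y \<le> R powr \<bar>y\<bar>" for y
      proof -
        have "r powr y \<le> r powr \<bar>y\<bar>" using False by (intro powr_mono) auto
        also have "\<dots> \<le> R powr \<bar>y\<bar>" using False r by (intro powr_mono2) auto
        finally show ?thesis .
      qed
      have Cpos: "0 < C" using C1 C(1) by linarith
      have "r powr - (\<beta> - \<epsilon>) \<le> R powr \<bar>\<beta> - \<epsilon>\<bar>" using bd[of "- (\<beta> - \<epsilon>)"] by (simp add: abs_minus_commute)
      also have "\<dots> \<le> R powr (\<bar>\<beta> - \<epsilon>\<bar> + \<bar>\<beta> + \<epsilon>\<bar>)"
        using \<open>R \<ge> 1\<close> by (intro powr_mono) auto
      also have "\<dots> \<le> R powr (\<bar>\<beta> - \<epsilon>\<bar> + \<bar>\<beta> + \<epsilon>\<bar>) * P 1" 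
        using mult_left_mono[OF P1, of "R powr (\<bar>\<beta> - \<epsilon>\<bar> + \<bar>\<beta> + \<epsilon>\<bar>)"] by simp
      also have "\<dots> \<le> C" by (rule C)
      finally have "r powr - (\<beta> - \<epsilon>) / C \<le> 1" using Cpos by simp
      then have 1: "r powr - (\<beta> - \<epsilon>) / C \<le> P r" using ge1[of r] r by linarith
      have "P r \<le> P 1 * 1" using False by (simp add: anti)
      also have "\<dots> \<le> P 1 * (R powr (\<bar>\<beta> - \<epsilon>\<bar> + \<bar>\<beta> + \<epsilon>\<bar>) * r powr - (\<beta> + \<epsilon>))"
      proof (intro mult_left_mono)
        have "1 = r powr (\<beta> + \<epsilon>) * r powr - (\<beta> + \<epsilon>)" using r by (simp add: powr_add[symmetric])
        also have "\<dots> \<le> R powr (\<bar>\<beta> - \<epsilon>\<bar> + \<bar>\<beta> + \<epsilon>\<bar>) * r powr - (\<beta> + \<epsilon>)"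
        proof (intro mult_right_mono)
          show "r powr (\<beta> + \<epsilon>) \<le> R powr (\<bar>\<beta> - \<epsilon>\<bar> + \<bar>\<beta> + \<epsilon>\<bar>)"
            using bd[of "\<beta> + \<epsilon>"] \<open>R \<ge> 1\<close> by (elim order_trans) (intro powr_mono, auto)
        qed simp
        finally show "1 \<le> R powr (\<bar>\<beta> - \<epsilon>\<bar> + \<bar>\<beta> + \<epsilon>\<bar>) * r powr - (\<beta> + \<epsilon>)" .
      qed (use P1 in simp)
      also have "\<dots> = (R powr (\<bar>\<beta> - \<epsilon>\<bar> + \<bar>\<beta> + \<epsilon>\<bar>) * P 1) * r powr - (\<beta> + \<epsilon>)"
        by (simp add: mult_ac)
      also have "\<dots> \<le> C * r powr - (\<beta> + \<epsilon>)" by (intro mult_right_mono C) auto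
      finally show ?thesis using 1 by blast
    qed
    show ?thesis using main C(1) C1 by (intro exI[of _ C]) auto
  qed
  then show ?thesis by blast
qed

section \<open>Words, stopping sets and singular values\<close>


lemma word_map_Nil [simp]: "word_map S [] z = z"
  and word_map_Cons [simp]: "word_map S (i # w) z = S i (word_map S w z)"
  by (simp_all add: word_map_def)

lemma word_map_append [simp]: "word_map S (u @ v) z = word_map S u (word_map S v z)"
  by (induction u) simp_all

text \<open>By the chain rule, the diagonal entries of the Jacobian of \<open>S\<^sub>w\<close> are of this form.\<close>

primrec cocycle ::
  "('i \<Rightarrow> real^2 \<Rightarrow> real^2) \<Rightarrow> ('i \<Rightarrow> real^2 \<Rightarrow> real) \<Rightarrow> 'i list \<Rightarrow> real^2 \<Rightarrow> real" where
  "cocycle S \<phi> [] z = 1"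
| "cocycle S \<phi> (i # w) z = \<phi> i (word_map S w z) * cocycle S \<phi> w z"

lemma cocycle_append: "cocycle S \<phi> (u @ v) z = cocycle S \<phi> u (word_map S v z) * cocycle S \<phi> v z"
  by (induction u) simp_all

lemma word_map_in:
  assumes "\<And>i. S i ` K \<subseteq> K" "z \<in> K"
  shows "word_map S w z \<in> K"
  using assms by (induction w) auto

lemma word_map_contraction:
  assumes "\<And>i. S i ` K \<subseteq> K" "0 \<le> \<rho>"
    and "\<And>i x y. x \<in> K \<Longrightarrow> y \<in> K \<Longrightarrow> dist (S i x) (S i y) \<le> \<rho> * dist x y"
    and "x \<in> K" "y \<in> K"
  shows "dist (word_map S w x) (word_map S w y) \<le> \<rho> ^ length w * dist x y"
proof (induction w)
  case (Cons i w)
  have "dist (word_map S (i # w) x) (word_map S (i # w) y)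
      \<le> \<rho> * dist (word_map S w x) (word_map S w y)"
    using assms word_map_in[of S K, OF assms(1)] by simp
  also have "\<dots> \<le> \<rho> * (\<rho> ^ length w * dist x y)"
    using Cons assms by (intro mult_left_mono) auto
  finally show ?case by (simp add: mult.assoc)
qed simp

lemma cocycle_pos:
  assumes "\<And>i. S i ` K \<subseteq> K" "\<And>i z. z \<in> K \<Longrightarrow> 0 < \<phi> i z" "z \<in> K"
  shows "0 < cocycle S \<phi> w z"
  using assms(2,3) word_map_in[of S K, OF assms(1)] by (induction w) auto

text \<open>The logarithm of the cocycle is a sum of values of \<open>ln (\<phi> i)\<close> along
  the orbit. After \<open>j\<close> letters the two orbits are within \<open>\<rho> ^ j * D\<close>,
  so the Hoelder differences form a geometric series of ratio \<open>\<rho> powr \<alpha>\<close>,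
  bounded independently of the length of the word.\<close>

lemma cocycle_distortion:
  assumes inv: "\<And>i. S i ` K \<subseteq> K" and \<rho>: "0 < \<rho>" "\<rho> < 1"
    and contr: "\<And>i x y. x \<in> K \<Longrightarrow> y \<in> K \<Longrightarrow> dist (S i x) (S i y) \<le> \<rho> * dist x y"
    and bounded: "\<And>x y. x \<in> K \<Longrightarrow> y \<in> K \<Longrightarrow> dist x y \<le> D"
    and pos: "\<And>i z. z \<in> K \<Longrightarrow> 0 < \<phi> i z"
    and holder: "\<And>i x y. x \<in> K \<Longrightarrow> y \<in> K \<Longrightarrow> \<bar>ln (\<phi> i x) - ln (\<phi> i y)\<bar> \<le> H * dist x y powr \<alpha>"
    and "0 < \<alpha>" "0 \<le> H"
  shows "\<exists>C\<ge>1. \<forall>w. \<forall>x\<in>K. \<forall>y\<in>K. cocycle S \<phi> w x \<le> C * cocycle S \<phi> w y"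
proof -
  define \<theta> where "\<theta> = \<rho> powr \<alpha>"
  have \<theta>: "0 < \<theta>" "\<theta> < 1" using \<rho> \<open>0 < \<alpha>\<close> by (auto simp: \<theta>_def powr_def mult_pos_neg)
  define c where "c = H * \<bar>D\<bar> powr \<alpha>"
  have c: "0 \<le> c" using \<open>0 \<le> H\<close> by (simp add: c_def)
  note win = word_map_in[of S K, OF inv]
  note cpos = cocycle_pos[of S K \<phi>, OF inv pos]
  have step: "\<bar>ln (cocycle S \<phi> w x) - ln (cocycle S \<phi> w y)\<bar> \<le> c * (\<Sum>j<length w. \<theta> ^ j)"
    if xy: "x \<in> K" "y \<in> K" for w x y
  proof (induction w)
    case (Cons i w)
    have "dist (word_map S w x) (word_map S w y) \<le> \<rho> ^ length w * \<bar>D\<bar>"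
      using word_map_contraction[of S K \<rho> x y w] inv contr xy \<rho> bounded[OF xy]
      by (smt (verit) mult_left_mono zero_le_power)
    then have "dist (word_map S w x) (word_map S w y) powr \<alpha> \<le> (\<rho> ^ length w * \<bar>D\<bar>) powr \<alpha>"
      using \<open>0 < \<alpha>\<close> by (intro powr_mono2) auto
    also have "\<dots> = \<theta> ^ length w * \<bar>D\<bar> powr \<alpha>"
      using \<rho> by (simp add: powr_mult \<theta>_def powr_realpow[symmetric] powr_powr mult.commute)
    finally have "\<bar>ln (\<phi> i (word_map S w x)) - ln (\<phi> i (word_map S w y))\<bar> \<le> c * \<theta> ^ length w"
      using holder[OF win[OF xy(1)] win[OF xy(2)], of i w w] \<open>0 \<le> H\<close>
      by (smt (verit) c_def mult.assoc mult.commute mult_left_mono)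
    moreover have "ln (cocycle S \<phi> (i # w) z) = ln (\<phi> i (word_map S w z)) + ln (cocycle S \<phi> w z)"
      if "z \<in> K" for z
      using pos[OF win[OF that], of i w] cpos[OF _ that, of w] by (simp add: ln_mult_pos)
    ultimately show ?case using Cons xy by (simp add: algebra_simps)
  qed simp
  have geo: "(\<Sum>j<n. \<theta> ^ j) \<le> 1 / (1 - \<theta>)" for n
    using \<theta> by (simp add: sum_gp_strict divide_right_mono)
  define C where "C = exp (c * (1 / (1 - \<theta>)))"
  have "cocycle S \<phi> w x \<le> C * cocycle S \<phi> w y" if xy: "x \<in> K" "y \<in> K" for w x y
  proof -
    have p: "0 < cocycle S \<phi> w x" "0 < cocycle S \<phi> w y" using cpos xy by auto
    have "ln (cocycle S \<phi> w x) \<le> c * (1 / (1 - \<theta>)) + ln (cocycle S \<phi> w y)"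
      using step[OF xy, of w] mult_left_mono[OF geo c, of "length w"] by linarith
    then have "exp (ln (cocycle S \<phi> w x)) \<le> exp (c * (1 / (1 - \<theta>)) + ln (cocycle S \<phi> w y))" by simp
    then show ?thesis using p by (simp add: exp_add C_def)
  qed
  moreover have "1 \<le> C" using c \<theta> by (simp add: C_def)
  ultimately show ?thesis by blast
qed

text \<open>The words at which \<open>B\<close> first drops to \<delta>. All proper prefixes are
  tested, not only the longest one, because the intended \<open>B\<close> need not decrease along
  prefixes: appending a letter moves the point at which the earlier factors are evaluated.\<close>

definition stopping :: "('i list \<Rightarrow> real) \<Rightarrow> real \<Rightarrow> 'i list set" where
  "stopping B \<delta> = {w. B w \<le> \<delta> \<and> (\<forall>u v. w = u @ v \<longrightarrow> v \<noteq> [] \<longrightarrow> \<delta> < B u)}"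

lemma stopping_prefix_exists:
  assumes "B w \<le> \<delta>"
  obtains u v where "w = u @ v" "u \<in> stopping B \<delta>"
proof -
  define P where "P n \<longleftrightarrow> n \<le> length w \<and> B (take n w) \<le> \<delta>" for n
  define n where "n = (LEAST n. P n)"
  have "P (length w)" using assms by (simp add: P_def)
  then have n: "P n" unfolding n_def by (rule LeastI)
  have min: "\<not> P m" if "m < n" for m using that unfolding n_def by (rule not_less_Least)
  have "take n w \<in> stopping B \<delta>"
    unfolding stopping_def
  proof safe
    show "B (take n w) \<le> \<delta>" using n by (simp add: P_def)
    fix u v assume uv: "take n w = u @ v" "v \<noteq> []"
    then have "length u < n" using n by (metis P_def append_Nil2 length_append length_greater_0_conv
          length_take less_add_same_cancel1 min.absorb2)
    moreover have "u = take (length u) w"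
      by (metis uv(1) append_eq_conv_conj calculation less_imp_le_nat min.absorb1 take_take)
    moreover have "length u \<le> length w" using n calculation by (simp add: P_def)
    ultimately show "\<delta> < B u" using min[of "length u"] by (metis P_def not_le)
  qed
  then show thesis using that[of "take n w" "drop n w"] by simp
qed

lemma stopping_prefix_eq:
  assumes "u \<in> stopping B \<delta>" "v \<in> stopping B \<delta>" "prefix u v"
  shows "u = v"
  using assms unfolding stopping_def prefix_def by force

lemma stopping_unique:
  assumes "u \<in> stopping B \<delta>" "v \<in> stopping B \<delta>" "u @ u' = v @ v'"
  shows "u = v"
  using assms stopping_prefix_eq prefix_same_cases[of u "u @ u'" v] by (metis prefixI)

text \<open>Distinct stopping words are incomparable in the prefix order, so they branch at a first
  differing letter. The open set condition is applied at this branch.\<close>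

lemma stopping_decomp:
  assumes "u \<in> stopping B \<delta>" "v \<in> stopping B \<delta>" "u \<noteq> v"
  obtains t i j u' v' where "i \<noteq> j" "u = t @ i # u'" "v = t @ j # v'"
  using parallel_decomp[of u v] assms stopping_prefix_eq by (metis parallelI)

lemma stopping_length:
  assumes "\<And>w. length w = n \<Longrightarrow> B w \<le> \<delta>" "w \<in> stopping B \<delta>"
  shows "length w \<le> n"
proof (rule ccontr)
  assume "\<not> ?thesis"
  then have "drop n w \<noteq> []" "length (take n w) = n" by auto
  then show False
    using assms unfolding stopping_def by (smt (verit) append_take_drop_id mem_Collect_eq)
qed

lemma finite_stopping:
  fixes B :: "'i::finite list \<Rightarrow> real"
  assumes "\<And>w. length w = n \<Longrightarrow> B w \<le> \<delta>"
  shows "finite (stopping B \<delta>)"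
proof (rule finite_subset)
  show "stopping B \<delta> \<subseteq> {w. set w \<subseteq> UNIV \<and> length w \<le> n}"
    using stopping_length[OF assms] by auto
qed (rule finite_lists_length_le, simp)

text \<open>Removing the last letter gives a prefix with value above \<delta>, and one letter costs
  at most the factor \<open>c\<close>. The empty word has no last letter and is covered by
  \<open>\<delta> \<le> B []\<close>.\<close>

lemma stopping_lower:
  assumes "w \<in> stopping B \<delta>" "\<delta> \<le> B []" "0 \<le> \<delta>" "0 \<le> c" "c \<le> 1"
    and "\<And>u i. c * B u \<le> B (u @ [i])"
  shows "c * \<delta> \<le> B w"
proof (cases w rule: rev_cases)
  case Nil
  have "c * \<delta> \<le> 1 * \<delta>" using assms by (intro mult_right_mono) auto
  then show ?thesis using assms Nil by simp
next
  case (snoc u i)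
  then have "\<delta> < B u" using assms(1) by (auto simp: stopping_def)
  then have "c * \<delta> \<le> c * B u" using assms by (intro mult_left_mono) auto
  then show ?thesis using assms(6)[of u i] snoc by simp
qed

text \<open>The stopping words cut the word tree: every word of length \<open>n\<close> has exactly
  one prefix among them, and none of them is longer than \<open>n\<close>. The sum is grouped by
  this prefix.\<close>

lemma sum_over_stopping:
  fixes B :: "'i::finite list \<Rightarrow> real" and \<phi> :: "'i list \<Rightarrow> real"
  assumes len: "\<And>w. length w = n \<Longrightarrow> B w \<le> \<delta>"
  shows "(\<Sum>w | length w = n. \<phi> w) =
    (\<Sum>u\<in>stopping B \<delta>. \<Sum>v | length v = n - length u. \<phi> (u @ v))"
proof -
  have fin: "finite {v::'i list. length v = k}" for k
    using finite_lists_length_eq[of "UNIV :: 'i set" k] by simp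
  have "bij_betw (\<lambda>(u, v). u @ v) (SIGMA u:stopping B \<delta>. {v::'i list. length v = n - length u}) {w. length w = n}"
  proof (rule bij_betwI')
    fix x y assume "x \<in> (SIGMA u:stopping B \<delta>. {v::'i list. length v = n - length u})"
      "y \<in> (SIGMA u:stopping B \<delta>. {v::'i list. length v = n - length u})"
    then show "((case x of (u, v) \<Rightarrow> u @ v) = (case y of (u, v) \<Rightarrow> u @ v)) = (x = y)"
      using stopping_unique by (auto split: prod.splits) blast+
  next
    fix x assume "x \<in> (SIGMA u:stopping B \<delta>. {v::'i list. length v = n - length u})"
    then show "(case x of (u, v) \<Rightarrow> u @ v) \<in> {w. length w = n}"
      using stopping_length[OF len] by fastforce
  next
    fix w :: "'i list" assume "w \<in> {w. length w = n}"
    then obtain u v where "w = u @ v" "u \<in> stopping B \<delta>" "length w = n"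
      using stopping_prefix_exists[of B w \<delta>] len by blast
    then show "\<exists>x\<in>(SIGMA u:stopping B \<delta>. {v::'i list. length v = n - length u}). w = (case x of (u, v) \<Rightarrow> u @ v)"
      by (intro bexI[of _ "(u, v)"]) auto
  qed
  from sum.reindex_bij_betw[OF this, of \<phi>]
  have "(\<Sum>w | length w = n. \<phi> w) =
      (\<Sum>x\<in>(SIGMA u:stopping B \<delta>. {v::'i list. length v = n - length u}). \<phi> (case x of (u, v) \<Rightarrow> u @ v))"
    by simp
  also have "\<dots> = (\<Sum>u\<in>stopping B \<delta>. \<Sum>v | length v = n - length u. \<phi> (u @ v))"
    using finite_stopping[OF len] fin by (subst sum.Sigma) (auto intro!: sum.cong)
  finally show ?thesis .
qed

section \<open>Points of the attractor addressed by words\<close>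

lemma attractor_word:
  assumes "F = (\<Union>i. S i ` F)" "z \<in> F"
  shows "\<exists>w. length w = n \<and> z \<in> word_map S w ` F"
proof (induction n)
  case 0
  then show ?case using assms by (intro exI[of _ "[]"]) (auto simp: image_iff)
next
  case (Suc n)
  then obtain w y where w: "length w = n" "z = word_map S w y" "y \<in> F" by blast
  then obtain i x where "y = S i x" "x \<in> F" using assms(1) by blast
  then show ?case using w by (intro exI[of _ "w @ [i]"]) auto
qed

lemma word_map_attractor:
  assumes "F = (\<Union>i. S i ` F)" "z \<in> F"
  shows "word_map S w z \<in> F"
proof (rule word_map_in)
  show "S i ` F \<subseteq> F" for i using assms(1) by blast
qed (fact assms(2))

lemma attractor_stopping:
  assumes "F = (\<Union>i. S i ` F)" "z \<in> F" "\<And>w. length w = n \<Longrightarrow> B w \<le> \<delta>"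
  obtains w y where "w \<in> stopping B \<delta>" "y \<in> F" "z = word_map S w y"
proof -
  obtain w y where w: "length w = n" "z = word_map S w y" "y \<in> F"
    using attractor_word[OF assms(1,2)] by blast
  then obtain u v where "w = u @ v" "u \<in> stopping B \<delta>"
    using stopping_prefix_exists assms(3) by metis
  then show thesis using that[of u "word_map S v y"] w word_map_attractor[OF assms(1)] by auto
qed

text \<open>\<open>T\<close> and \<open>A\<^sup>2 * B\<^sup>2\<close> are the trace and the
  determinant of \<open>transpose M ** M\<close>, so the quadratic is its characteristic
  polynomial.\<close>

lemma singular_values_triangular:
  fixes M :: "real^2^2"
  assumes M: "M $ 1 $ 1 = A" "M $ 1 $ 2 = 0" "M $ 2 $ 1 = G" "M $ 2 $ 2 = B"
  defines "T \<equiv> A\<^sup>2 + G\<^sup>2 + B\<^sup>2"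
  shows "singular_values M = sqrt ` {t. t\<^sup>2 - T * t + A\<^sup>2 * B\<^sup>2 = 0}"
proof -
  have eig: "(\<exists>v. v \<noteq> 0 \<and> (transpose M ** M) *v v = t *s v) \<longleftrightarrow> t\<^sup>2 - T * t + A\<^sup>2 * B\<^sup>2 = 0" for t
  proof -
    have "(\<exists>v. v \<noteq> 0 \<and> (transpose M ** M) *v v = t *s v) \<longleftrightarrow>
        (\<exists>x y. (x \<noteq> 0 \<or> y \<noteq> 0) \<and> (A\<^sup>2 + G\<^sup>2) * x + G * B * y = t * x \<and> G * B * x + B\<^sup>2 * y = t * y)"
      (is "?L \<longleftrightarrow> ?R")
    proof
      assume ?L
      then obtain v where v: "v \<noteq> 0" "(transpose M ** M) *v v = t *s v" by blast
      show ?R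
        using v by (intro exI[of _ "v $ 1"] exI[of _ "v $ 2"])
          (simp add: vec_eq_iff forall_2 matrix_matrix_mult_def matrix_vector_mult_def
            transpose_def sum_2 M power2_eq_square algebra_simps)
    next
      assume ?R
      then obtain x y where "(x \<noteq> 0 \<or> y \<noteq> 0)" "(A\<^sup>2 + G\<^sup>2) * x + G * B * y = t * x"
        "G * B * x + B\<^sup>2 * y = t * y" by blast
      then show ?L
        by (intro exI[of _ "vector [x, y]"])
          (simp add: vec_eq_iff forall_2 matrix_matrix_mult_def matrix_vector_mult_def
            transpose_def sum_2 M power2_eq_square algebra_simps)
    qed
    also have "\<dots> \<longleftrightarrow> t\<^sup>2 - T * t + A\<^sup>2 * B\<^sup>2 = 0"
    proof
      assume ?R
      then obtain x y where xy: "(x \<noteq> 0 \<or> y \<noteq> 0)" "(A\<^sup>2 + G\<^sup>2) * x + G * B * y = t * x"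
        "G * B * x + B\<^sup>2 * y = t * y" by blast
      have "(t\<^sup>2 - T * t + A\<^sup>2 * B\<^sup>2) * x = 0" "(t\<^sup>2 - T * t + A\<^sup>2 * B\<^sup>2) * y = 0"
        using xy(2,3) unfolding T_def by algebra+
      then show "t\<^sup>2 - T * t + A\<^sup>2 * B\<^sup>2 = 0" using xy(1) by auto
    next
      assume t: "t\<^sup>2 - T * t + A\<^sup>2 * B\<^sup>2 = 0"
      then have prod: "(A\<^sup>2 + G\<^sup>2 - t) * (B\<^sup>2 - t) = (G * B)\<^sup>2"
        unfolding T_def by algebra
      show ?R
      \<comment> \<open>If \<open>G * B\<close> is nonzero, the first row of the eigenvalue equation
        dictates the eigenvector; otherwise the matrix is diagonal and a unit vector works.\<close>
      proof (cases "G * B = 0")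
        case False
        have "G * B * (G * B) + B\<^sup>2 * (t - (A\<^sup>2 + G\<^sup>2)) = t * (t - (A\<^sup>2 + G\<^sup>2))" using prod by algebra
        then show ?thesis using False
          by (intro exI[of _ "G * B"] exI[of _ "t - (A\<^sup>2 + G\<^sup>2)"]) (auto simp: algebra_simps)
      next
        case True
        then have "(A\<^sup>2 + G\<^sup>2 - t) * (B\<^sup>2 - t) = 0" using prod by (simp only:) simp
        then have "A\<^sup>2 + G\<^sup>2 = t \<or> B\<^sup>2 = t" by auto
        then show ?thesis
        proof
          assume "A\<^sup>2 + G\<^sup>2 = t"
          then show ?thesis using True by (intro exI[of _ 1] exI[of _ 0]) auto
        next
          assume "B\<^sup>2 = t"
          then show ?thesis using True by (intro exI[of _ 0] exI[of _ 1]) auto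
        qed
      qed
    qed
    finally show ?thesis .
  qed
  then show ?thesis unfolding singular_values_def by simp
qed

text \<open>Only the larger singular value is estimated directly, through the larger root of the
  characteristic polynomial. The smaller one follows because the product of the two is the
  determinant \<open>A * B\<close>, so an upper bound for one is a lower bound for the
  other.\<close>

lemma sv_triangular_bounds:
  fixes M :: "real^2^2"
  assumes M: "M $ 1 $ 1 = A" "M $ 1 $ 2 = 0" "M $ 2 $ 1 = G" "M $ 2 $ 2 = B"
    and B: "0 < B" "B \<le> A" and G: "\<bar>G\<bar> \<le> C * A" and C: "0 \<le> C"
  shows "A / 2 \<le> sv1 M" "sv1 M \<le> (C + 2) * A" "B / (C + 2) \<le> sv2 M" "sv2 M \<le> 2 * B"
proof -
  define T where "T = A\<^sup>2 + G\<^sup>2 + B\<^sup>2"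
  define D where "D = T\<^sup>2 - 4 * (A\<^sup>2 * B\<^sup>2)"
  have AT: "A\<^sup>2 \<le> T" "0 \<le> T" by (simp_all add: T_def)
  have "2 * (A * B) \<le> T"
    using sum_squares_bound[of A B] zero_le_power2[of G] unfolding T_def by linarith
  then have "(2 * (A * B))\<^sup>2 \<le> T\<^sup>2" using B by (intro power_mono) auto
  then have D0: "0 \<le> D" by (simp add: D_def power_mult_distrib)
  define t1 where "t1 = (T + sqrt D) / 2"
  define t2 where "t2 = (T - sqrt D) / 2"
  have sq: "sqrt D * sqrt D = D" using D0 by simp
  have sum12: "t1 + t2 = T" by (simp add: t1_def t2_def field_simps)
  have prod12: "t1 * t2 = A\<^sup>2 * B\<^sup>2"
  proof -
    have "t1 * t2 = (T + sqrt D) * (T - sqrt D) / 4" by (simp add: t1_def t2_def)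
    also have "(T + sqrt D) * (T - sqrt D) = T\<^sup>2 - sqrt D * sqrt D"
      by (simp add: power2_eq_square algebra_simps)
    finally show ?thesis unfolding sq by (simp add: D_def)
  qed
  have roots: "{t. t\<^sup>2 - T * t + A\<^sup>2 * B\<^sup>2 = 0} = {t1, t2}"
  proof -
    have "t\<^sup>2 - T * t + A\<^sup>2 * B\<^sup>2 = (t - t1) * (t - t2)" for t
      unfolding sum12[symmetric] prod12[symmetric] by (simp add: power2_eq_square algebra_simps)
    then show ?thesis by auto
  qed
  have t21: "t2 \<le> t1" using D0 by (simp add: t1_def t2_def)
  have t1: "A\<^sup>2 / 2 \<le> t1" using add_increasing2[OF real_sqrt_ge_zero[OF D0] AT(1)] by (simp add: t1_def)
  then have t1pos: "0 < t1" using B zero_less_power[of A 2] by linarith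
  have t2pos: "0 < t2" using prod12 B t1pos
    by (smt (verit) mult_pos_pos zero_less_mult_pos zero_less_power)
  have sv: "singular_values M = {sqrt t1, sqrt t2}"
    using singular_values_triangular[OF M] roots by (simp add: T_def)
  have sv1: "sv1 M = sqrt t1" using t21 by (simp add: sv1_def sv)
  have sv2: "sv2 M = sqrt t2" using t21 by (simp add: sv2_def sv)
  have prod: "sqrt t1 * sqrt t2 = A * B"
    using prod12 B by (simp add: real_sqrt_mult[symmetric] power_mult_distrib[symmetric])
  have "(A / 2)\<^sup>2 \<le> t1" using t1 t1pos by (simp add: power_divide)
  then show lo: "A / 2 \<le> sv1 M" unfolding sv1 by (rule real_le_rsqrt)
  have "G\<^sup>2 \<le> (C * A)\<^sup>2" using G by (metis abs_ge_zero power2_abs power_mono)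
  moreover have "B\<^sup>2 \<le> A\<^sup>2" using B by (intro power_mono) auto
  ultimately have "T \<le> (C\<^sup>2 + 2) * A\<^sup>2" by (simp add: T_def power_mult_distrib algebra_simps)
  also have "\<dots> \<le> (C + 2)\<^sup>2 * A\<^sup>2"
    using C by (intro mult_right_mono) (auto simp: power2_eq_square algebra_simps)
  finally have "t1 \<le> ((C + 2) * A)\<^sup>2" using sum12 t2pos by (simp add: power_mult_distrib)
  then show hi: "sv1 M \<le> (C + 2) * A" unfolding sv1 using B C by (intro real_le_lsqrt) auto
  have s1: "0 < sv1 M" using t1pos by (simp add: sv1)
  have eq: "sv2 M = A * B / sv1 M" using prod s1 by (simp add: sv1 sv2 field_simps)
  have "B / (C + 2) = A * B / ((C + 2) * A)" using B by simp
  also have "\<dots> \<le> sv2 M" unfolding eq using hi s1 B C by (intro divide_left_mono) auto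
  finally show "B / (C + 2) \<le> sv2 M" .
  have "sv2 M \<le> A * B / (A / 2)" unfolding eq using lo s1 B by (intro divide_left_mono) auto
  then show "sv2 M \<le> 2 * B" using B by simp
qed

section \<open>Dominated systems and bounded distortion\<close>


text \<open>Restriction to the segment from \<open>x\<close> to \<open>y\<close> reduces this to one
  variable. The segment stays in \<open>K\<close>, so derivatives within \<open>K\<close> suffice
  and boundary points need no special care.\<close>

lemma mvt_convex:
  fixes h :: "'a::real_normed_vector \<Rightarrow> real"
  assumes "convex K" "x \<in> K" "y \<in> K"
    and "\<And>z. z \<in> K \<Longrightarrow> (h has_derivative h' z) (at z within K)"
  shows "\<exists>\<xi>\<in>K. h y - h x = h' \<xi> (y - x)"
proof -
  define l where "l t = x + t *\<^sub>R (y - x)" for t :: real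
  have l: "l t \<in> K" if "t \<in> {0..1}" for t
  proof -
    have "l t = (1 - t) *\<^sub>R x + t *\<^sub>R y" by (simp add: l_def algebra_simps)
    then show ?thesis using that assms convexD_alt[of K x y t] by simp
  qed
  have "\<exists>t\<in>{0..1}. (h \<circ> l) 1 - (h \<circ> l) 0 = (\<lambda>s. h' (l t) (s *\<^sub>R (y - x))) (1 - 0)"
  proof (rule mvt_very_simple)
    fix t :: real assume "0 \<le> t" "t \<le> 1"
    then have t: "t \<in> {0..1}" by simp
    have "(l has_derivative (\<lambda>s. s *\<^sub>R (y - x))) (at t within {0..1})"
      unfolding l_def by (auto intro!: derivative_eq_intros)
    moreover have "l ` {0..1} \<subseteq> K" using l by auto
    ultimately show "(h \<circ> l has_derivative (\<lambda>s. h' (l t) (s *\<^sub>R (y - x)))) (at t within {0..1})"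
      unfolding o_def using has_derivative_in_compose2[OF assms(4) _ t] by blast
  qed simp
  then obtain t where "t \<in> {0..1}" "h y - h x = h' (l t) (y - x)" by (auto simp: l_def)
  then show ?thesis using l by blast
qed

section \<open>Coordinates on the unit square\<close>

lemma mem_unit_square: "z \<in> unit_square \<longleftrightarrow> 0 \<le> z $ 1 \<and> z $ 1 \<le> 1 \<and> 0 \<le> z $ 2 \<and> z $ 2 \<le> 1"
  by (auto simp: mem_box_cart forall_2)

lemma mem_unit_box: "z \<in> box 0 (1::real^2) \<longleftrightarrow> 0 < z $ 1 \<and> z $ 1 < 1 \<and> 0 < z $ 2 \<and> z $ 2 < 1"
  by (auto simp: mem_box_cart forall_2)

lemma dist_le_components:
  fixes x y :: "real^2"
  shows "dist x y \<le> \<bar>x $ 1 - y $ 1\<bar> + \<bar>x $ 2 - y $ 2\<bar>"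
  using norm_le_l1_cart[of "x - y"] by (simp add: dist_norm sum_2)

lemma component_le_dist:
  fixes x y :: "real^'n"
  shows "\<bar>x $ i - y $ i\<bar> \<le> dist x y"
  using component_le_norm_cart[of "x - y" i] by (simp add: dist_norm)

lemma dist_unit_square: "x \<in> unit_square \<Longrightarrow> y \<in> unit_square \<Longrightarrow> dist x y \<le> 2"
  using dist_le_components[of x y] unfolding mem_unit_square by linarith

text \<open>The analytic content of the hypotheses: \<open>fx\<close>, \<open>gx\<close>,
  \<open>gy\<close> are the entries of the lower triangular Jacobians, and all constants are uniform
  in the letter and in the point. \<kappa> is the gap expressing domination. The base point
  \<open>a\<close> is the one at which pressure is computed.\<close>

locale dominated_system =
  fixes S :: "'i::finite \<Rightarrow> real^2 \<Rightarrow> real^2"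
    and fx gx gy :: "'i \<Rightarrow> real^2 \<Rightarrow> real"
    and \<rho> d \<kappa> M H \<alpha> :: real
    and F :: "(real^2) set" and a :: "real^2"
  assumes maps: "S i ` unit_square \<subseteq> unit_square"
    and \<rho>: "0 < \<rho>" "\<rho> < 1"
    and contr: "x \<in> unit_square \<Longrightarrow> y \<in> unit_square \<Longrightarrow> dist (S i x) (S i y) \<le> \<rho> * dist x y"
    and deriv: "z \<in> unit_square \<Longrightarrow>
      (S i has_derivative (\<lambda>v. vector [fx i z * v $ 1, gx i z * v $ 1 + gy i z * v $ 2]))
        (at z within unit_square)"
    and d: "0 < d" "z \<in> unit_square \<Longrightarrow> d \<le> gy i z"
    and \<kappa>: "0 < \<kappa>" "z \<in> unit_square \<Longrightarrow> gy i z + \<kappa> \<le> fx i z"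
    and gx: "z \<in> unit_square \<Longrightarrow> \<bar>gx i z\<bar> \<le> M"
    and \<alpha>: "0 < \<alpha>"
    and fx_holder: "x \<in> unit_square \<Longrightarrow> y \<in> unit_square \<Longrightarrow>
      \<bar>fx i x - fx i y\<bar> \<le> H * dist x y powr \<alpha>"
    and gy_holder: "x \<in> unit_square \<Longrightarrow> y \<in> unit_square \<Longrightarrow>
      \<bar>gy i x - gy i y\<bar> \<le> H * dist x y powr \<alpha>"
    and F: "attractor S F"
    and a: "a \<in> unit_square"
begin

lemma F_subset: "F \<subseteq> unit_square" and F_nonempty: "F \<noteq> {}" and F_compact: "compact F"
  and F_eq: "F = (\<Union>i. S i ` F)"
  using F unfolding attractor_def by auto

lemma word_in: "z \<in> unit_square \<Longrightarrow> word_map S w z \<in> unit_square"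
  by (rule word_map_in[of S unit_square, OF maps])

lemma fx_ge: "z \<in> unit_square \<Longrightarrow> d \<le> fx i z" and gy_le_fx: "z \<in> unit_square \<Longrightarrow> gy i z \<le> fx i z"
  using d(2)[of z i] \<kappa>(2)[of z i] \<kappa>(1) by auto

lemma word_contr:
  assumes "x \<in> unit_square" "y \<in> unit_square"
  shows "dist (word_map S w x) (word_map S w y) \<le> \<rho> ^ length w * 2"
proof -
  have "dist (word_map S w x) (word_map S w y) \<le> \<rho> ^ length w * dist x y"
    using \<rho> contr assms by (intro word_map_contraction[of S unit_square, OF maps]) auto
  also have "\<dots> \<le> \<rho> ^ length w * 2" using \<rho> dist_unit_square[OF assms] by (intro mult_left_mono) auto
  finally show ?thesis .
qed

lemma M_nonneg: "0 \<le> M" using gx[OF a] by (meson abs_ge_zero order_trans)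

lemma H_nonneg: "0 \<le> H"
proof -
  have "0 \<le> H * dist (0::real^2) 1 powr \<alpha>"
    using fx_holder[of 0 1] by (rule order_trans[rotated]) (auto simp: mem_unit_square)
  moreover have "dist (0::real^2) 1 powr \<alpha> > 0" by simp
  ultimately show ?thesis by (simp add: zero_le_mult_iff)
qed

text \<open>The strict gap \<open>\<kappa>\<close> makes the bound on the off-diagonal entry propagate along words:
  \<open>M + (M/\<kappa>) gy \<le> (M/\<kappa>) fx\<close>.\<close>

lemma word_derivative:
  assumes z: "z \<in> unit_square"
  shows "\<exists>G. \<bar>G\<bar> \<le> M / \<kappa> * cocycle S fx w z \<and>
    (word_map S w has_derivative
      (\<lambda>v. vector [cocycle S fx w z * v $ 1, G * v $ 1 + cocycle S gy w z * v $ 2]))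
      (at z within unit_square)"
proof (induction w)
  case Nil
  have "(\<lambda>v::real^2. vector [v $ 1, v $ 2]) = (\<lambda>v. v)"
    by (auto simp: fun_eq_iff vec_eq_iff forall_2)
  then have "(word_map S [] has_derivative (\<lambda>v. vector [v $ 1, v $ 2])) (at z within unit_square)"
    by (simp add: word_map_def id_def)
  then show ?case using M_nonneg \<kappa>(1) by (intro exI[of _ 0]) (simp del: word_map_Nil)
next
  case (Cons i w)
  then obtain G where G: "\<bar>G\<bar> \<le> M / \<kappa> * cocycle S fx w z"
    "(word_map S w has_derivative
      (\<lambda>v. vector [cocycle S fx w z * v $ 1, G * v $ 1 + cocycle S gy w z * v $ 2]))
      (at z within unit_square)" by blast
  define y where "y = word_map S w z"
  have y: "y \<in> unit_square" unfolding y_def by (rule word_in[OF z])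
  define G' where "G' = gx i y * cocycle S fx w z + gy i y * G"
  have "((\<lambda>x. S i (word_map S w x)) has_derivative
     (\<lambda>v. (\<lambda>v. vector [fx i y * v $ 1, gx i y * v $ 1 + gy i y * v $ 2])
        (vector [cocycle S fx w z * v $ 1, G * v $ 1 + cocycle S gy w z * v $ 2] :: real^2)))
      (at z within unit_square)"
    unfolding y_def
    by (rule has_derivative_in_compose2[OF deriv _ z G(2)]) (use word_in in auto)
  moreover have "(\<lambda>v::real^2. (\<lambda>v. vector [fx i y * v $ 1, gx i y * v $ 1 + gy i y * v $ 2])
        (vector [cocycle S fx w z * v $ 1, G * v $ 1 + cocycle S gy w z * v $ 2] :: real^2)) =
      (\<lambda>v. vector [cocycle S fx (i # w) z * v $ 1, G' * v $ 1 + cocycle S gy (i # w) z * v $ 2] :: real^2)"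
    by (simp add: fun_eq_iff vec_eq_iff forall_2 G'_def y_def[symmetric] algebra_simps)
  moreover have "word_map S (i # w) = (\<lambda>x. S i (word_map S w x))" by (simp add: fun_eq_iff)
  moreover have "\<bar>G'\<bar> \<le> M / \<kappa> * cocycle S fx (i # w) z"
  proof -
    have A: "0 < cocycle S fx w z"
      using maps fx_ge d(1) z by (intro cocycle_pos[of S unit_square]) (auto intro: less_le_trans)
    have gp: "0 \<le> gy i y" using d y by (meson less_imp_le order_trans)
    have "\<bar>G'\<bar> \<le> \<bar>gx i y\<bar> * cocycle S fx w z + gy i y * \<bar>G\<bar>"
      unfolding G'_def using A gp
      by (metis abs_mult abs_of_nonneg abs_of_pos abs_triangle_ineq)
    also have "\<dots> \<le> M * cocycle S fx w z + gy i y * (M / \<kappa> * cocycle S fx w z)"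
      using A gp G(1) gx[OF y] by (intro add_mono mult_left_mono mult_right_mono) auto
    also have "\<dots> = M / \<kappa> * (gy i y + \<kappa>) * cocycle S fx w z"
      using \<kappa>(1) by (simp add: field_simps)
    also have "\<dots> \<le> M / \<kappa> * fx i y * cocycle S fx w z"
      using \<kappa> y A M_nonneg by (intro mult_left_mono mult_right_mono) auto
    finally show ?thesis by (simp add: y_def mult.assoc)
  qed
  ultimately show ?case by (intro exI[of _ G']) simp
qed

text \<open>On \<open>[d, \<infinity>)\<close> the logarithm is Lipschitz with constant
  \<open>1 / d\<close>, so Hoelder bounds for the derivatives turn into the logarithmic ones that
  \<open>cocycle_distortion\<close> asks for.\<close>

lemma ln_holder:
  assumes "d \<le> u" "d \<le> v" "\<bar>u - v\<bar> \<le> H * e"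
  shows "\<bar>ln u - ln v\<bar> \<le> H / d * e"
proof -
  have *: "ln s - ln t \<le> \<bar>s - t\<bar> / d" if "d \<le> s" "d \<le> t" for s t
  proof -
    have "ln s - ln t = ln (s / t)" using that d(1) by (simp add: ln_div)
    also have "\<dots> \<le> s / t - 1" using that d(1) by (intro ln_le_minus_one) auto
    also have "\<dots> = (s - t) / t" using that d(1) by (simp add: field_simps)
    also have "\<dots> \<le> \<bar>s - t\<bar> / t" using that d(1) by (intro divide_right_mono) auto
    also have "\<dots> \<le> \<bar>s - t\<bar> / d" using that d(1) by (intro divide_left_mono) auto
    finally show ?thesis .
  qed
  have "\<bar>ln u - ln v\<bar> \<le> \<bar>u - v\<bar> / d"
    using *[OF assms(1,2)] *[OF assms(2,1)] by (simp add: abs_le_iff abs_minus_commute)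
  also have "\<dots> \<le> H * e / d" using assms d(1) by (intro divide_right_mono) auto
  finally show ?thesis by simp
qed

lemma distortion_exists:
  "\<exists>K\<ge>1. M / \<kappa> \<le> K \<and> (\<forall>w. \<forall>x\<in>unit_square. \<forall>y\<in>unit_square.
      cocycle S fx w x \<le> K * cocycle S fx w y \<and> cocycle S gy w x \<le> K * cocycle S gy w y \<and>
      M / \<kappa> * cocycle S fx w x \<le> K * cocycle S fx w y)"
proof -
  have "\<exists>C\<ge>1. \<forall>w. \<forall>x\<in>unit_square. \<forall>y\<in>unit_square. cocycle S fx w x \<le> C * cocycle S fx w y"
    by (rule cocycle_distortion[where \<rho> = \<rho> and D = 2 and H = "H / d" and \<alpha> = \<alpha>])
      (use maps \<rho> contr dist_unit_square fx_ge d(1) \<alpha> H_nonneg fx_holder in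
        \<open>auto intro!: ln_holder[simplified] intro: less_le_trans\<close>)
  then obtain C1 where C1: "C1 \<ge> 1"
    "\<And>w x y. x \<in> unit_square \<Longrightarrow> y \<in> unit_square \<Longrightarrow> cocycle S fx w x \<le> C1 * cocycle S fx w y" by blast
  have "\<exists>C\<ge>1. \<forall>w. \<forall>x\<in>unit_square. \<forall>y\<in>unit_square. cocycle S gy w x \<le> C * cocycle S gy w y"
    by (rule cocycle_distortion[where \<rho> = \<rho> and D = 2 and H = "H / d" and \<alpha> = \<alpha>])
      (use maps \<rho> contr dist_unit_square d \<alpha> H_nonneg gy_holder in
        \<open>auto intro!: ln_holder[simplified] intro: less_le_trans\<close>)
  then obtain C2 where C2: "C2 \<ge> 1"
    "\<And>w x y. x \<in> unit_square \<Longrightarrow> y \<in> unit_square \<Longrightarrow> cocycle S gy w x \<le> C2 * cocycle S gy w y" by blast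
  have pos: "0 < cocycle S fx w x" "0 < cocycle S gy w x" if "x \<in> unit_square" for w x
    using maps fx_ge d that by (auto intro!: cocycle_pos[of S unit_square] intro: less_le_trans)
  have m: "0 \<le> M / \<kappa>" using M_nonneg \<kappa> by simp
  \<comment> \<open>The sum dominates each constant required: the two distortion constants, the
    distortion of the off-diagonal bound \<open>M / \<kappa> * C1\<close>, and
    \<open>M / \<kappa>\<close> itself.\<close>
  define K where "K = C1 + C2 + M / \<kappa> * C1 + M / \<kappa>"
  have K: "C1 \<le> K" "C2 \<le> K" "M / \<kappa> * C1 \<le> K" "M / \<kappa> \<le> K" "1 \<le> K"
    using C1 C2 m mult_nonneg_nonneg[OF m, of C1] unfolding K_def by auto
  show ?thesis
  proof (intro exI[of _ K] conjI allI ballI)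
    fix w and x y :: "real^2" assume xy: "x \<in> unit_square" "y \<in> unit_square"
    show "cocycle S fx w x \<le> K * cocycle S fx w y"
      using C1(2)[OF xy, of w] K(1) pos[OF xy(2), of w] by (smt (verit) mult_right_mono)
    show "cocycle S gy w x \<le> K * cocycle S gy w y"
      using C2(2)[OF xy, of w] K(2) pos[OF xy(2), of w] by (smt (verit) mult_right_mono)
    have "M / \<kappa> * cocycle S fx w x \<le> M / \<kappa> * (C1 * cocycle S fx w y)"
      using C1(2)[OF xy] m by (intro mult_left_mono) auto
    also have "\<dots> \<le> K * cocycle S fx w y"
      using K(3) pos[OF xy(2), of w] by (simp only: mult.assoc[symmetric]) (intro mult_right_mono, auto)
    finally show "M / \<kappa> * cocycle S fx w x \<le> K * cocycle S fx w y" .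
  qed (use K in auto)
qed

text \<open>Chosen once, so that all estimates of the locale share one constant; it is accessed
  through the facts stated with \<open>K_ge_1\<close>.\<close>

definition K where
  "K = (SOME K. K \<ge> 1 \<and> M / \<kappa> \<le> K \<and> (\<forall>w. \<forall>x\<in>unit_square. \<forall>y\<in>unit_square.
      cocycle S fx w x \<le> K * cocycle S fx w y \<and> cocycle S gy w x \<le> K * cocycle S gy w y \<and>
      M / \<kappa> * cocycle S fx w x \<le> K * cocycle S fx w y))"

abbreviation A where "A w \<equiv> cocycle S fx w a"
abbreviation B where "B w \<equiv> cocycle S gy w a"

lemma K_ge_1: "1 \<le> K" and M_div_kappa_le_K: "M / \<kappa> \<le> K"
  and fx_distortion: "x \<in> unit_square \<Longrightarrow> y \<in> unit_square \<Longrightarrow> cocycle S fx w x \<le> K * cocycle S fx w y"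
  and gy_distortion: "x \<in> unit_square \<Longrightarrow> y \<in> unit_square \<Longrightarrow> cocycle S gy w x \<le> K * cocycle S gy w y"
  and G_distortion: "x \<in> unit_square \<Longrightarrow> y \<in> unit_square \<Longrightarrow> M / \<kappa> * cocycle S fx w x \<le> K * cocycle S fx w y"
  using someI_ex[OF distortion_exists] unfolding K_def[symmetric] by blast+

lemma fx_cocycle_pos: "z \<in> unit_square \<Longrightarrow> 0 < cocycle S fx w z"
  and gy_cocycle_pos: "z \<in> unit_square \<Longrightarrow> 0 < cocycle S gy w z"
  using maps fx_ge d by (auto intro!: cocycle_pos[of S unit_square] intro: less_le_trans)

lemma A_pos: "0 < A w" and B_pos: "0 < B w"
  using fx_cocycle_pos gy_cocycle_pos a by auto

lemma B_le_A: "B w \<le> A w"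
proof (induction w)
  case (Cons i w)
  then show ?case using gy_le_fx word_in[OF a] gy_cocycle_pos[OF a, of w] fx_ge d(1)
    by (auto intro!: mult_mono intro: order_trans[OF less_imp_le])
qed simp

text \<open>The chain rule evaluates the factor of \<open>u\<close> at
  \<open>word_map S v a\<close>. Moving it back to the base point \<open>a\<close> costs
  \<open>K\<close> in either direction.\<close>

lemma A_append_le: "A (u @ v) \<le> K * (A u * A v)" and A_append_ge: "A u * A v \<le> K * A (u @ v)"
  and B_append_le: "B (u @ v) \<le> K * (B u * B v)" and B_append_ge: "B u * B v \<le> K * B (u @ v)"
  unfolding cocycle_append
  using mult_right_mono[OF fx_distortion[OF word_in[OF a] a] less_imp_le[OF A_pos[of v]], of u v]
    mult_right_mono[OF fx_distortion[OF a word_in[OF a]] less_imp_le[OF A_pos[of v]], of u v]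
    mult_right_mono[OF gy_distortion[OF word_in[OF a] a] less_imp_le[OF B_pos[of v]], of u v]
    mult_right_mono[OF gy_distortion[OF a word_in[OF a]] less_imp_le[OF B_pos[of v]], of u v]
  by (simp_all add: mult.assoc)

lemma B_ge: "d ^ length w \<le> B w"
proof (induction w)
  case (Cons i w)
  then show ?case using d word_in[OF a] by (auto intro!: mult_mono intro: order_trans[OF less_imp_le])
qed simp

text \<open>A new letter contributes a factor of at least \<open>d\<close>, and the change of base
  point costs \<open>K\<close>. This is the constant handed to
  \<open>stopping_lower\<close>.\<close>

lemma A_snoc: "d / K * A u \<le> A (u @ [i])" and B_snoc: "d / K * B u \<le> B (u @ [i])"
proof -
  have "d * A u \<le> A u * A [i]" "d * B u \<le> B u * B [i]"
    using fx_ge[OF a, of i] d(2)[OF a, of i] A_pos[of u] B_pos[of u] by (simp_all add: mult.commute)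
  then have "d * A u \<le> K * A (u @ [i])" "d * B u \<le> K * B (u @ [i])"
    using A_append_ge[of u "[i]"] B_append_ge[of u "[i]"] by linarith+
  then show "d / K * A u \<le> A (u @ [i])" "d / K * B u \<le> B (u @ [i])"
    using K_ge_1 by (simp_all add: field_simps)
qed

section \<open>Mean value estimates for word maps\<close>

context
  fixes x y :: "real^2" and w :: "'i list"
  assumes x: "x \<in> unit_square" and y: "y \<in> unit_square"
begin

text \<open>The mean value theorem is scalar, so the two coordinates come with different
  intermediate points \<xi> and \<zeta>. Bounded distortion later replaces both by the base
  point.\<close>

lemma word_mvt:
  obtains \<xi> \<zeta> G where "\<xi> \<in> unit_square" "\<zeta> \<in> unit_square" "\<bar>G\<bar> \<le> M / \<kappa> * cocycle S fx w \<zeta>"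
    "word_map S w y $ 1 - word_map S w x $ 1 = cocycle S fx w \<xi> * (y $ 1 - x $ 1)"
    "word_map S w y $ 2 - word_map S w x $ 2 = G * (y $ 1 - x $ 1) + cocycle S gy w \<zeta> * (y $ 2 - x $ 2)"
proof -
  have "\<forall>z\<in>unit_square. \<exists>G. \<bar>G\<bar> \<le> M / \<kappa> * cocycle S fx w z \<and>
    (word_map S w has_derivative
      (\<lambda>v. vector [cocycle S fx w z * v $ 1, G * v $ 1 + cocycle S gy w z * v $ 2]))
      (at z within unit_square)"
    by (intro ballI word_derivative)
  from bchoice[OF this] obtain G where G: "\<And>z. z \<in> unit_square \<Longrightarrow> \<bar>G z\<bar> \<le> M / \<kappa> * cocycle S fx w z"
    "\<And>z. z \<in> unit_square \<Longrightarrow> (word_map S w has_derivative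
      (\<lambda>v. vector [cocycle S fx w z * v $ 1, G z * v $ 1 + cocycle S gy w z * v $ 2]))
      (at z within unit_square)" by blast
  have 1: "((\<lambda>u. word_map S w u $ 1) has_derivative (\<lambda>v. cocycle S fx w z * v $ 1)) (at z within unit_square)"
    if "z \<in> unit_square" for z using bounded_linear.has_derivative[OF bounded_linear_vec_nth G(2)[OF that], of 1] by simp
  have 2: "((\<lambda>u. word_map S w u $ 2) has_derivative (\<lambda>v. G z * v $ 1 + cocycle S gy w z * v $ 2)) (at z within unit_square)"
    if "z \<in> unit_square" for z using bounded_linear.has_derivative[OF bounded_linear_vec_nth G(2)[OF that], of 2] by simp
  obtain \<xi> where \<xi>: "\<xi> \<in> unit_square"
    "word_map S w y $ 1 - word_map S w x $ 1 = cocycle S fx w \<xi> * (y - x) $ 1"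
    using mvt_convex[OF convex_box(1) x y 1] by blast
  obtain \<zeta> where \<zeta>: "\<zeta> \<in> unit_square"
    "word_map S w y $ 2 - word_map S w x $ 2 = G \<zeta> * (y - x) $ 1 + cocycle S gy w \<zeta> * (y - x) $ 2"
    using mvt_convex[OF convex_box(1) x y 2] by blast
  show thesis
    by (rule that[OF \<xi>(1) \<zeta>(1) G(1)[OF \<zeta>(1)]]) (use \<xi>(2) \<zeta>(2) in simp_all)
qed

lemma word_fst_le: "\<bar>word_map S w y $ 1 - word_map S w x $ 1\<bar> \<le> K * A w * \<bar>y $ 1 - x $ 1\<bar>"
proof (rule word_mvt)
  fix \<xi> assume "\<xi> \<in> unit_square" "word_map S w y $ 1 - word_map S w x $ 1 = cocycle S fx w \<xi> * (y $ 1 - x $ 1)"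
  then show ?thesis using fx_distortion[OF _ a, of \<xi> w] fx_cocycle_pos[of \<xi> w]
    by (simp add: abs_mult mult_right_mono)
qed

lemma word_fst_ge: "A w / K * \<bar>y $ 1 - x $ 1\<bar> \<le> \<bar>word_map S w y $ 1 - word_map S w x $ 1\<bar>"
proof (rule word_mvt)
  fix \<xi> assume \<xi>: "\<xi> \<in> unit_square" "word_map S w y $ 1 - word_map S w x $ 1 = cocycle S fx w \<xi> * (y $ 1 - x $ 1)"
  have "A w / K \<le> cocycle S fx w \<xi>" using fx_distortion[OF a \<xi>(1), of w] K_ge_1 by (simp add: field_simps)
  then show ?thesis using \<xi> fx_cocycle_pos[of \<xi> w] mult_right_mono[of "A w / K" "cocycle S fx w \<xi>" "\<bar>y $ 1 - x $ 1\<bar>"]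
    by (simp add: abs_mult)
qed

lemma word_snd_le:
  "\<bar>word_map S w y $ 2 - word_map S w x $ 2\<bar> \<le> K * (A w * \<bar>y $ 1 - x $ 1\<bar> + B w * \<bar>y $ 2 - x $ 2\<bar>)"
proof (rule word_mvt)
  fix \<zeta> G assume G: "\<zeta> \<in> unit_square" "\<bar>G\<bar> \<le> M / \<kappa> * cocycle S fx w \<zeta>"
    "word_map S w y $ 2 - word_map S w x $ 2 = G * (y $ 1 - x $ 1) + cocycle S gy w \<zeta> * (y $ 2 - x $ 2)"
  have "\<bar>G\<bar> \<le> K * A w" using G_distortion[OF G(1) a, of w] G(2) by linarith
  moreover have "\<bar>cocycle S gy w \<zeta>\<bar> \<le> K * B w"
    using gy_distortion[OF G(1) a, of w] gy_cocycle_pos[OF G(1), of w] by linarith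
  ultimately have "\<bar>G * (y $ 1 - x $ 1)\<bar> \<le> K * A w * \<bar>y $ 1 - x $ 1\<bar>"
    "\<bar>cocycle S gy w \<zeta> * (y $ 2 - x $ 2)\<bar> \<le> K * B w * \<bar>y $ 2 - x $ 2\<bar>"
    unfolding abs_mult by (intro mult_right_mono; simp)+
  then show ?thesis unfolding G(3) by (simp add: algebra_simps)
qed

text \<open>Equal first coordinates make the shear term \<open>G\<close> vanish; without this it
  could cancel the vertical displacement.\<close>

lemma word_snd_ge:
  assumes "x $ 1 = y $ 1"
  shows "B w / K * \<bar>y $ 2 - x $ 2\<bar> \<le> \<bar>word_map S w y $ 2 - word_map S w x $ 2\<bar>"
proof (rule word_mvt)
  fix \<zeta> G assume G: "\<zeta> \<in> unit_square"
    "word_map S w y $ 2 - word_map S w x $ 2 = G * (y $ 1 - x $ 1) + cocycle S gy w \<zeta> * (y $ 2 - x $ 2)"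
  have "B w / K \<le> cocycle S gy w \<zeta>" using gy_distortion[OF a G(1), of w] K_ge_1 by (simp add: field_simps)
  then show ?thesis using G gy_cocycle_pos[of \<zeta> w] assms mult_right_mono[of "B w / K" "cocycle S gy w \<zeta>" "\<bar>y $ 2 - x $ 2\<bar>"]
    by (simp add: abs_mult)
qed

end

text \<open>The left edge of the square has length 1 and its end points are mapped to points at
  distance at most \<rho>, whereas the vertical mean value is at least \<open>d\<close>. The letter
  \<open>undefined\<close> is an arbitrary one.\<close>

lemma d_less_1: "d < 1"
proof -
  define y :: "real^2" where "y = vector [0, 1]"
  have y: "y \<in> unit_square" "0 \<in> unit_square" by (simp_all add: y_def mem_unit_square)
  show ?thesis
  proof (rule word_mvt[OF y(2,1), of "[undefined]"])
    fix \<zeta> G assume \<zeta>: "\<zeta> \<in> unit_square"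
      "word_map S [undefined] y $ 2 - word_map S [undefined] 0 $ 2 =
        G * (y $ 1 - 0 $ 1) + cocycle S gy [undefined] \<zeta> * (y $ 2 - 0 $ 2)"
    then have "gy undefined \<zeta> = S undefined y $ 2 - S undefined 0 $ 2" by (simp add: y_def)
    also have "\<dots> \<le> dist (S undefined y) (S undefined 0)"
      using component_le_dist[of "S undefined y" 2 "S undefined 0"] by linarith
    also have "\<dots> \<le> \<rho> * dist y 0" using y by (intro contr)
    also have "\<dots> \<le> \<rho> * 1"
      using dist_le_components[of y 0] \<rho> by (intro mult_left_mono) (auto simp: y_def)
    finally show ?thesis using d(2)[OF \<zeta>(1), of undefined] \<rho> by linarith
  qed
qed

text \<open>The triangular form is used in order: equality of images first forces equal first
  coordinates, and then \<open>word_snd_ge\<close> applies to the second.\<close>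

lemma word_inj: "inj_on (word_map S w) unit_square"
proof (rule inj_onI)
  fix x y assume xy: "x \<in> unit_square" "y \<in> unit_square" "word_map S w x = word_map S w y"
  have pos: "s = t" if "c * \<bar>s - t\<bar> \<le> 0" "0 < c" for c s t :: real
    using that by (simp add: mult_le_0_iff)
  have 1: "x $ 1 = y $ 1"
    using word_fst_ge[OF xy(1,2), of w] xy(3) A_pos[of w] K_ge_1
      pos[of "A w / K" "y $ 1" "x $ 1"] by simp
  have "x $ 2 = y $ 2"
    using word_snd_ge[OF xy(1,2) 1, of w] xy(3) B_pos[of w] K_ge_1
      pos[of "B w / K" "y $ 2" "x $ 2"] by simp
  with 1 show "x = y" by (simp add: vec_eq_iff forall_2)
qed

lemma word_fst_cong:
  assumes "x \<in> unit_square" "y \<in> unit_square" "x $ 1 = y $ 1"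
  shows "word_map S w x $ 1 = word_map S w y $ 1"
  using word_fst_le[OF assms(1,2), of w] assms(3) by simp

lemma word_continuous: "continuous_on unit_square (word_map S w)"
  using word_derivative[of _ w]
  by (intro continuous_on_eq_continuous_within[THEN iffD2] ballI) (blast intro: has_derivative_continuous)

text \<open>The corners 0 and 1 differ by 1 in the first coordinate, which gives at least
  \<open>A w / K\<close> in the image, while contraction allows at most
  \<open>\<rho> ^ length w * 2\<close>.\<close>

lemma A_le: "A w \<le> 2 * K * \<rho> ^ length w"
proof -
  have u: "0 \<in> unit_square" "1 \<in> unit_square" by (simp_all add: mem_unit_square)
  have "A w / K \<le> \<bar>word_map S w 1 $ 1 - word_map S w 0 $ 1\<bar>" using word_fst_ge[OF u, of w] by simp
  also have "\<dots> \<le> \<rho> ^ length w * 2" using component_le_dist word_contr[OF u(2,1)] by (rule order_trans)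
  finally show ?thesis using K_ge_1 by (simp add: field_simps)
qed

lemma B_le: "B w \<le> 2 * K * \<rho> ^ length w"
  using A_le B_le_A by (rule order_trans[rotated])

lemma A_small:
  assumes "0 < \<delta>"
  obtains n where "\<And>w. n \<le> length w \<Longrightarrow> A w \<le> \<delta>"
proof -
  have "(\<lambda>n. 2 * K * \<rho> ^ n) \<longlonglongrightarrow> 2 * K * 0"
    using \<rho> by (intro tendsto_intros LIMSEQ_realpow_zero) auto
  then have "\<forall>\<^sub>F n in sequentially. 2 * K * \<rho> ^ n < \<delta>" using assms by (intro order_tendstoD) auto
  then obtain n where "\<And>m. m \<ge> n \<Longrightarrow> 2 * K * \<rho> ^ m < \<delta>" by (auto simp: eventually_sequentially)
  then show thesis by (intro that[of n] order_trans[OF A_le] less_imp_le)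
qed

lemma sv_word:
  "A w / 2 \<le> sv1 (word_jacobian S w a)" "sv1 (word_jacobian S w a) \<le> (K + 2) * A w"
  "B w / (K + 2) \<le> sv2 (word_jacobian S w a)" "sv2 (word_jacobian S w a) \<le> 2 * B w"
proof -
  obtain G where G: "\<bar>G\<bar> \<le> M / \<kappa> * A w"
    "(word_map S w has_derivative (\<lambda>v. vector [A w * v $ 1, G * v $ 1 + B w * v $ 2]))
      (at a within unit_square)" by (rule exE[OF word_derivative[OF a, of w]]) auto
  \<comment> \<open>The Jacobian is defined through a chosen derivative. Derivatives within a
    nondegenerate closed box are unique, also on the boundary, so the choice is the triangular
    map.\<close>
  have "(word_map S w has_derivative frechet_derivative (word_map S w) (at a within unit_square)) (at a within unit_square)"
    using G(2) differentiableI frechet_derivative_works by blast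
  then have "frechet_derivative (word_map S w) (at a within unit_square) =
      (\<lambda>v. vector [A w * v $ 1, G * v $ 1 + B w * v $ 2])"
    using G(2) a
    by (intro frechet_derivative_unique_within_closed_interval[of 0 1 a "word_map S w"])
      (auto simp: Basis_vec_def inner_axis)
  then have J: "word_jacobian S w a = matrix (\<lambda>v. vector [A w * v $ 1, G * v $ 1 + B w * v $ 2])"
    by (simp add: word_jacobian_def jacobian_def)
  have M: "word_jacobian S w a $ 1 $ 1 = A w" "word_jacobian S w a $ 1 $ 2 = 0"
    "word_jacobian S w a $ 2 $ 1 = G" "word_jacobian S w a $ 2 $ 2 = B w"
    by (simp_all add: J matrix_def axis_def)
  have "\<bar>G\<bar> \<le> K * A w" using G(1) mult_right_mono[OF M_div_kappa_le_K less_imp_le[OF A_pos]] by (rule order_trans)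
  from sv_triangular_bounds[OF M B_pos B_le_A this]
  show "A w / 2 \<le> sv1 (word_jacobian S w a)" "sv1 (word_jacobian S w a) \<le> (K + 2) * A w"
    "B w / (K + 2) \<le> sv2 (word_jacobian S w a)" "sv2 (word_jacobian S w a) \<le> 2 * B w"
    using K_ge_1 by auto
qed

end

section \<open>The spectrum of the projected measure\<close>


lemma mesh_cubes_real: "mesh_cubes \<delta> = (\<lambda>m::int. {\<delta> * of_int m..\<delta> * of_int m + \<delta>}) ` UNIV"
  by (auto simp: mesh_cubes_def image_iff)

lemma moment_sum_0:
  fixes \<nu> :: "real measure"
  assumes "\<delta> > 0"
  shows "moment_sum \<nu> 0 \<delta> =
    real (card {m::int. 0 < measure \<nu> {\<delta> * of_int m..\<delta> * of_int m + \<delta>}})"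
proof -
  have inj: "inj (\<lambda>m::int. {\<delta> * of_int m..\<delta> * of_int m + \<delta>})"
    using assms by (auto simp: inj_def Icc_eq_Icc)
  have "moment_sum \<nu> 0 \<delta> = real (card {Q \<in> mesh_cubes \<delta>. measure \<nu> Q > 0})"
    by (simp add: moment_sum_def)
  also have "{Q \<in> mesh_cubes \<delta>. measure \<nu> Q > 0} =
      (\<lambda>m::int. {\<delta> * of_int m..\<delta> * of_int m + \<delta>}) ` {m. 0 < measure \<nu> {\<delta> * of_int m..\<delta> * of_int m + \<delta>}}"
    unfolding mesh_cubes_real by auto
  finally show ?thesis using inj by (simp add: card_image inj_on_subset)
qed

definition positive_cells :: "real measure \<Rightarrow> real \<Rightarrow> int set" where
  "positive_cells \<nu> \<delta> = {m. 0 < measure \<nu> {\<delta> * of_int m..\<delta> * of_int m + \<delta>}}"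

text \<open>A charged cell meets \<open>E\<close>, hence contains a point within \<delta> of some
  \<open>x\<close> of the net. Then \<open>x / \<delta>\<close> lies between \<open>m - 1\<close>
  and \<open>m + 2\<close>, which leaves four values of \<open>m\<close> for each
  \<open>x\<close>.\<close>

lemma positive_cells_le_packing:
  assumes E: "E \<subseteq> {0..1}" and \<delta>: "\<delta> > 0"
    and null: "\<And>Q. closed Q \<Longrightarrow> Q \<inter> E = {} \<Longrightarrow> measure \<nu> Q = 0"
  shows "finite (positive_cells \<nu> \<delta>) \<and> card (positive_cells \<nu> \<delta>) \<le> 4 * packing_number E \<delta>"
proof -
  obtain X where X: "finite X" "card X = packing_number E \<delta>"
    "\<And>e. e \<in> E \<Longrightarrow> \<exists>x\<in>X. \<bar>e - x\<bar> \<le> \<delta>"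
    using packing_obtain[OF E \<delta>] by metis
  have sub: "positive_cells \<nu> \<delta> \<subseteq> (\<Union>x\<in>X. {\<lfloor>x / \<delta>\<rfloor> - 2..\<lfloor>x / \<delta>\<rfloor> + 1})"
  proof
    fix m assume "m \<in> positive_cells \<nu> \<delta>"
    then obtain e where e: "e \<in> E" "\<delta> * of_int m \<le> e" "e \<le> \<delta> * of_int m + \<delta>"
      using null[of "{\<delta> * of_int m..\<delta> * of_int m + \<delta>}"] unfolding positive_cells_def by fastforce
    then obtain x where x: "x \<in> X" "\<bar>e - x\<bar> \<le> \<delta>" using X(3) by blast
    have "\<delta> * (of_int m - 1) \<le> x" "x \<le> \<delta> * (of_int m + 2)" using e x by (auto simp: algebra_simps)
    then have "of_int m - 1 \<le> x / \<delta>" "x / \<delta> \<le> of_int m + 2"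
      using \<delta> by (auto simp: field_simps)
    then have "m \<in> {\<lfloor>x / \<delta>\<rfloor> - 2..\<lfloor>x / \<delta>\<rfloor> + 1}" unfolding atLeastAtMost_iff by linarith
    then show "m \<in> (\<Union>x\<in>X. {\<lfloor>x / \<delta>\<rfloor> - 2..\<lfloor>x / \<delta>\<rfloor> + 1})" using x by blast
  qed
  have "card (\<Union>x\<in>X. {\<lfloor>x / \<delta>\<rfloor> - 2..\<lfloor>x / \<delta>\<rfloor> + 1}) \<le> (\<Sum>x\<in>X. card {\<lfloor>x / \<delta>\<rfloor> - 2..\<lfloor>x / \<delta>\<rfloor> + 1})"
    using X(1) by (rule card_UN_le)
  also have "\<dots> = 4 * card X" by simp
  finally have "card (\<Union>x\<in>X. {\<lfloor>x / \<delta>\<rfloor> - 2..\<lfloor>x / \<delta>\<rfloor> + 1}) \<le> 4 * packing_number E \<delta>"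
    using X(2) by simp
  moreover have "finite (\<Union>x\<in>X. {\<lfloor>x / \<delta>\<rfloor> - 2..\<lfloor>x / \<delta>\<rfloor> + 1})" using X(1) by simp
  ultimately show ?thesis using sub by (meson card_mono finite_subset le_trans)
qed

text \<open>When a point of \<open>E\<close> lies at the end of its cell, the mass nearby may sit
  entirely in the adjacent cell; hence the tolerance of one index. Two points assigned the same cell
  are at most \<open>3 * \<delta>\<close> apart, which explains the packing radius.\<close>

lemma packing_le_positive_cells:
  assumes E: "E \<subseteq> {0..1}" and \<delta>: "\<delta> > 0" and fin: "finite (positive_cells \<nu> \<delta>)"
    and pos: "\<And>x. x \<in> E \<Longrightarrow> \<exists>m. 0 < measure \<nu> {\<delta> * of_int m..\<delta> * of_int m + \<delta>} \<and> \<bar>m - \<lfloor>x / \<delta>\<rfloor>\<bar> \<le> 1"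
  shows "packing_number E (3 * \<delta>) \<le> card (positive_cells \<nu> \<delta>)"
proof -
  obtain X where X: "finite X" "card X = packing_number E (3 * \<delta>)" "X \<subseteq> E" "separated (3 * \<delta>) X"
    using packing_exists_max[OF E, of "3 * \<delta>"] \<delta> by auto
  have "\<forall>x\<in>X. \<exists>m. m \<in> positive_cells \<nu> \<delta> \<and> \<bar>m - \<lfloor>x / \<delta>\<rfloor>\<bar> \<le> 1"
    using pos X(3) unfolding positive_cells_def by blast
  from bchoice[OF this] obtain c where c: "\<And>x. x \<in> X \<Longrightarrow> c x \<in> positive_cells \<nu> \<delta>"
    "\<And>x. x \<in> X \<Longrightarrow> \<bar>c x - \<lfloor>x / \<delta>\<rfloor>\<bar> \<le> 1" by blast
  have "inj_on c X"
  proof (rule inj_onI, rule ccontr)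
    fix x y assume xy: "x \<in> X" "y \<in> X" "c x = c y" "x \<noteq> y"
    have "\<bar>x / \<delta> - y / \<delta>\<bar> \<le> 3" using c(2)[OF xy(1)] c(2)[OF xy(2)] xy(3) by linarith
    then have "\<bar>x - y\<bar> \<le> 3 * \<delta>" using \<delta> by (simp add: diff_divide_distrib[symmetric] field_simps)
    moreover have "3 * \<delta> < \<bar>x - y\<bar>" using X(4) xy by (auto simp: separated_def dist_real_def)
    ultimately show False by simp
  qed
  then have "card X \<le> card (positive_cells \<nu> \<delta>)"
    using c(1) fin by (intro card_inj_on_le[of c]) auto
  then show ?thesis using X(2) by simp
qed

text \<open>Invariance gives \<open>measure \<mu> A\<close> at least \<open>p i\<close> times the
  measure of the preimage under \<open>S i\<close>. Peeling off letters ends with a closed set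
  containing the whole square, hence the support, which has measure 1.\<close>

lemma nonlinear_measure_pos:
  assumes \<mu>: "nonlinear_measure S p F \<mu>" and p: "\<And>i. 0 < p i"
    and cont: "\<And>i. continuous_on unit_square (S i)" and inv: "\<And>i. S i ` unit_square \<subseteq> unit_square"
    and F: "closed F" "F \<subseteq> unit_square"
  shows "closed A \<Longrightarrow> word_map S w ` unit_square \<subseteq> A \<Longrightarrow> 0 < measure \<mu> A"
proof (induction w arbitrary: A)
  case Nil
  interpret prob_space \<mu> using \<mu> by (simp add: nonlinear_measure_def)
  have sets: "sets \<mu> = sets borel" and sp: "space \<mu> = UNIV" and null: "measure \<mu> (- F) = 0"
    using \<mu> sets_eq_imp_space_eq[of \<mu> borel] by (auto simp: nonlinear_measure_def)
  have A: "A \<in> sets \<mu>" using Nil sets by simp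
  have "measure \<mu> (- A) \<le> measure \<mu> (- F)"
    using Nil F sets by (intro finite_measure_mono) auto
  then have "measure \<mu> (- A) = 0" using null measure_nonneg[of \<mu> "- A"] by linarith
  then show ?case using prob_compl[OF A] sp by (simp add: Compl_eq_Diff_UNIV)
next
  case (Cons i w)
  have pre: "closed (S i -` A \<inter> unit_square)"
    using continuous_closed_preimage[OF cont closed_cbox Cons.prems(1)] by (simp add: Int_commute)
  have "word_map S w ` unit_square \<subseteq> S i -` A \<inter> unit_square"
    using Cons.prems(2) word_map_in[of S unit_square, OF inv] by (auto simp: image_subset_iff)
  then have "0 < measure \<mu> (S i -` A \<inter> unit_square)" using Cons.IH pre by blast
  then have "0 < p i * measure \<mu> (S i -` A \<inter> unit_square)" using p by simp
  also have "\<dots> \<le> (\<Sum>i\<in>UNIV. p i * measure \<mu> (S i -` A \<inter> unit_square))"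
    using p by (intro member_le_sum mult_nonneg_nonneg) (auto intro: less_imp_le)
  also have "\<dots> = measure \<mu> A" using \<mu> Cons.prems by (simp add: nonlinear_measure_def)
  finally show ?case .
qed

section \<open>The projection of the attractor to the first axis\<close>

context dominated_system
begin

definition E where "E = (\<lambda>z. z $ 1) ` F"

lemma E_subset: "E \<subseteq> {0..1}" and E_nonempty: "E \<noteq> {}"
  using F_subset F_nonempty unfolding E_def by (auto simp: mem_unit_square subset_iff)

lemma packing_E_ge_1: "0 < r \<Longrightarrow> 1 \<le> real (packing_number E r)"
  using packing_number_ge_1[OF E_subset _ E_nonempty] by (metis of_nat_1 of_nat_le_iff)

text \<open>Around each point of an \<open>r\<close>-separated set, a copy of \<open>E\<close> contracted by about \<open>r\<close> fits.\<close>

lemma packing_supermultiplicative: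
  "\<exists>c. 0 < c \<and> c < 1 \<and> (\<forall>r t. 0 < r \<and> r \<le> 1 \<and> 0 < t \<and> t \<le> 1 \<longrightarrow>
      packing_number E r * packing_number E t \<le> packing_number E (c * r * t))"
proof -
  \<comment> \<open>Two points in one copy of \<open>E\<close> are separated by
    \<open>(d / K * \<delta>) / K * t\<close> with \<open>\<delta> = r / (4 * K)\<close>, which is
    the first entry times \<open>r * t\<close>. The second entry serves points in different
    copies.\<close>
  define c where "c = min (d / (4 * K ^ 3)) (1 / 4)"
  have K: "0 < K" using K_ge_1 by simp
  have c: "0 < c" "c < 1" "c \<le> 1 / 4" "c \<le> d / (4 * K ^ 3)" using d(1) K by (auto simp: c_def)
  have "packing_number E r * packing_number E t \<le> packing_number E (c * r * t)"
    if r: "0 < r" "r \<le> 1" and t: "0 < t" "t \<le> 1" for r t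
  proof -
    obtain X where X: "finite X" "card X = packing_number E r" "X \<subseteq> E" "separated r X"
      using packing_exists_max[OF E_subset r(1)] by auto
    obtain Y where Y: "finite Y" "card Y = packing_number E t" "Y \<subseteq> E" "separated t Y"
      using packing_exists_max[OF E_subset t(1)] by auto
    \<comment> \<open>With this choice a copy placed at \<open>x\<close> stays within
      \<open>K * \<delta> = r / 4\<close> of \<open>x\<close>, so copies at points more than
      \<open>r\<close> apart remain more than \<open>r / 2\<close> apart.\<close>
    define \<delta> where "\<delta> = r / (4 * K)"
    have \<delta>: "0 < \<delta>" "\<delta> \<le> 1" using r K_ge_1 by (auto simp: \<delta>_def field_simps)
    obtain n where n: "\<And>w. n \<le> length w \<Longrightarrow> A w \<le> \<delta>" using A_small[OF \<delta>(1)] by blast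
    have "\<forall>x\<in>X. \<exists>w. w \<in> stopping A \<delta> \<and> (\<exists>y\<in>F. x = word_map S w y $ 1)"
    proof
      fix x assume "x \<in> X"
      then obtain z where z: "z \<in> F" "x = z $ 1" using X(3) by (auto simp: E_def)
      obtain w y where "w \<in> stopping A \<delta>" "y \<in> F" "z = word_map S w y"
        by (rule attractor_stopping[OF F_eq z(1), of n A \<delta>]) (use n in auto)
      then show "\<exists>w. w \<in> stopping A \<delta> \<and> (\<exists>y\<in>F. x = word_map S w y $ 1)" using z by blast
    qed
    from bchoice[OF this] obtain W where W: "\<And>x. x \<in> X \<Longrightarrow> W x \<in> stopping A \<delta>"
      "\<And>x. x \<in> X \<Longrightarrow> \<exists>y\<in>F. x = word_map S (W x) y $ 1" by blast
    have "\<forall>y\<in>Y. \<exists>z. z \<in> F \<and> z $ 1 = y" using Y(3) by (auto simp: E_def)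
    from bchoice[OF this] obtain Z where Z: "\<And>y. y \<in> Y \<Longrightarrow> Z y \<in> F" "\<And>y. y \<in> Y \<Longrightarrow> Z y $ 1 = y"
      by blast
    define \<Phi> where "\<Phi> = (\<lambda>(x, y). word_map S (W x) (Z y) $ 1)"
    have AW: "d / K * \<delta> \<le> A (W x)" "A (W x) \<le> \<delta>" if "x \<in> X" for x
    proof -
      show "d / K * \<delta> \<le> A (W x)"
        by (rule stopping_lower[OF W(1)[OF that] _ _ _ _ A_snoc])
          (use \<delta> d(1) d_less_1 K_ge_1 in auto)
      show "A (W x) \<le> \<delta>" using W(1)[OF that] by (simp add: stopping_def)
    qed
    have near: "\<bar>\<Phi> (x, y) - x\<bar> \<le> r / 4" if xy: "x \<in> X" "y \<in> Y" for x y
    proof -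
      obtain y' where y': "y' \<in> F" "x = word_map S (W x) y' $ 1" using W(2)[OF xy(1)] by blast
      have in_sq: "y' \<in> unit_square" "Z y \<in> unit_square" using y' Z(1)[OF xy(2)] F_subset by auto
      have "\<bar>\<Phi> (x, y) - x\<bar> \<le> K * A (W x) * \<bar>Z y $ 1 - y' $ 1\<bar>"
        using word_fst_le[OF in_sq, of "W x"] y' by (simp add: \<Phi>_def)
      also have "\<dots> \<le> K * A (W x) * 1"
        using in_sq K A_pos[of "W x"] by (intro mult_left_mono) (auto simp: mem_unit_square)
      also have "\<dots> \<le> K * \<delta>" using AW[OF xy(1)] K by simp
      also have "\<dots> = r / 4" using K by (simp add: \<delta>_def)
      finally show ?thesis .
    qed
    have far: "c * r * t < \<bar>\<Phi> q - \<Phi> q'\<bar>" if q: "q \<in> X \<times> Y" "q' \<in> X \<times> Y" "q \<noteq> q'" for q q'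
    proof -
      obtain x y x' y' where xy: "q = (x, y)" "q' = (x', y')" "x \<in> X" "y \<in> Y" "x' \<in> X" "y' \<in> Y"
        using q by auto
      show ?thesis
      proof (cases "x = x'")
        case True
        then have "y \<noteq> y'" using q(3) xy by auto
        then have ty: "t < \<bar>y - y'\<bar>" using Y(4) xy by (auto simp: separated_def dist_real_def)
        have "c * r * t \<le> d / (4 * K ^ 3) * r * t" using c r t by (intro mult_right_mono) auto
        also have "\<dots> = (d / K * \<delta>) / K * t" by (simp add: \<delta>_def power3_eq_cube)
        also have "\<dots> \<le> A (W x) / K * t"
          using AW[OF xy(3)] K t by (intro mult_right_mono divide_right_mono) auto
        also have "\<dots> < A (W x) / K * \<bar>y - y'\<bar>" using ty K A_pos[of "W x"] by (intro mult_strict_left_mono) auto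
        also have "\<dots> \<le> \<bar>\<Phi> q - \<Phi> q'\<bar>"
          using word_fst_ge[of "Z y'" "Z y" "W x"] Z xy F_subset True by (auto simp: \<Phi>_def subset_iff)
        finally show ?thesis .
      next
        case False
        then have "r < \<bar>x - x'\<bar>" using X(4) xy by (auto simp: separated_def dist_real_def)
        then have "r / 2 < \<bar>\<Phi> q - \<Phi> q'\<bar>" unfolding xy(1,2) using near[OF xy(3,4)] near[OF xy(5,6)] by linarith
        moreover have "c * r * t \<le> 1 / 4 * r * 1" using c r t by (intro mult_mono) auto
        ultimately show ?thesis using r by linarith
      qed
    qed
    have crt: "0 < c * r * t" using c r t by simp
    have "inj_on \<Phi> (X \<times> Y)" using far crt by (force intro!: inj_onI)
    then have "packing_number E r * packing_number E t = card (\<Phi> ` (X \<times> Y))"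
      using X Y by (simp add: card_image card_cartesian_product)
    also have "\<dots> \<le> packing_number E (c * r * t)"
    proof (rule card_le_packing[OF E_subset crt])
      show "\<Phi> ` (X \<times> Y) \<subseteq> E" unfolding E_def \<Phi>_def using word_map_attractor[OF F_eq] Z(1) by auto
      show "separated (c * r * t) (\<Phi> ` (X \<times> Y))"
        using far by (fastforce simp: separated_def dist_real_def)
    qed (use X Y in auto)
    finally show ?thesis .
  qed
  then show ?thesis using c by blast
qed

lemma S_continuous: "continuous_on unit_square (S i)"
  using word_continuous[of "[i]"] by simp

text \<open>The packing numbers of \<open>E\<close> have an exponent \<beta>. At
  \<open>q = 0\<close> the moment sum is trapped between the packing number at
  \<open>3 * \<delta>\<close> and four times that at \<delta>, so the limit in
  \<open>Lq_spectrum\<close> exists and equals \<beta>.\<close>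

lemma proj_measure_power_law:
  assumes \<mu>: "nonlinear_measure S p F \<mu>" and p: "\<And>i. 0 < p i" and "0 < \<epsilon>" "1 \<le> R"
  obtains C where "C \<ge> 1"
    "\<And>r. 0 < r \<Longrightarrow> r \<le> R \<Longrightarrow> r powr - (proj_spectrum \<mu> 0 - \<epsilon>) / C \<le> packing_number E r"
    "\<And>r. 0 < r \<Longrightarrow> r \<le> R \<Longrightarrow> packing_number E r \<le> C * r powr - (proj_spectrum \<mu> 0 + \<epsilon>)"
proof -
  interpret prob_space \<mu> using \<mu> by (simp add: nonlinear_measure_def)
  have sets: "sets \<mu> = sets borel" and sp: "space \<mu> = UNIV" and null: "measure \<mu> (- F) = 0"
    using \<mu> sets_eq_imp_space_eq[of \<mu> borel] by (auto simp: nonlinear_measure_def)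
  obtain c where c: "0 < c" "c < 1" "\<And>r t. 0 < r \<Longrightarrow> r \<le> 1 \<Longrightarrow> 0 < t \<Longrightarrow> t \<le> 1 \<Longrightarrow>
      packing_number E r * packing_number E t \<le> packing_number E (c * r * t)"
    using packing_supermultiplicative by blast
  have "\<exists>\<beta>. \<forall>\<epsilon>>0. \<forall>R\<ge>1. \<exists>C\<ge>1. \<forall>r. 0 < r \<and> r \<le> R \<longrightarrow>
      r powr - (\<beta> - \<epsilon>) / C \<le> real (packing_number E r) \<and> real (packing_number E r) \<le> C * r powr - (\<beta> + \<epsilon>)"
  proof (rule supermultiplicative_power_law[OF c(1,2)])
    show "real (packing_number E r) * real (packing_number E t) \<le> real (packing_number E (c * r * t))"
      if "0 < r" "r \<le> 1" "0 < t" "t \<le> 1" for r t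
      using c(3)[OF that] by (metis of_nat_le_iff of_nat_mult)
  qed (use packing_antimono[OF E_subset] packing_E_ge_1 packing_number_le[OF E_subset] in auto)
  then obtain \<beta> where \<beta>: "\<And>\<epsilon> R. 0 < \<epsilon> \<Longrightarrow> 1 \<le> R \<Longrightarrow> \<exists>C\<ge>1. \<forall>r. 0 < r \<and> r \<le> R \<longrightarrow>
      r powr - (\<beta> - \<epsilon>) / C \<le> real (packing_number E r) \<and> real (packing_number E r) \<le> C * r powr - (\<beta> + \<epsilon>)"
    by blast
  define \<nu> where "\<nu> = distr \<mu> borel (\<lambda>x. x $ 1)"
  have meas: "(\<lambda>x::real^2. x $ 1) \<in> measurable \<mu> borel"
    unfolding measurable_cong_sets[OF sets refl] by (intro borel_measurable_continuous_onI continuous_intros)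
  have \<nu>: "measure \<nu> Q = measure \<mu> ((\<lambda>x. x $ 1) -` Q)" if "closed Q" for Q
    using that sp unfolding \<nu>_def by (subst measure_distr[OF meas]) auto
  have cl: "closed ((\<lambda>x::real^2. x $ 1) -` Q)" if "closed Q" for Q
    using that by (intro closed_vimage continuous_intros)
  have \<nu>_null: "measure \<nu> Q = 0" if "closed Q" "Q \<inter> E = {}" for Q
  proof -
    have "measure \<nu> Q \<le> measure \<mu> (- F)" unfolding \<nu>[OF that(1)]
      using that(2) F_compact sets by (intro finite_measure_mono) (auto simp: E_def compact_imp_closed)
    then show ?thesis using null measure_nonneg[of \<nu> Q] by linarith
  qed
  have \<nu>_pos: "\<exists>m. 0 < measure \<nu> {\<delta> * of_int m..\<delta> * of_int m + \<delta>} \<and> \<bar>m - \<lfloor>x / \<delta>\<rfloor>\<bar> \<le> 1"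
    if x: "x \<in> E" and \<delta>: "\<delta> > 0" for x \<delta>
  proof (rule ccontr)
    assume neg: "\<not> ?thesis"
    define m where "m = \<lfloor>x / \<delta>\<rfloor>"
    define Q where "Q j = {\<delta> * of_int j..\<delta> * of_int j + \<delta>}" for j :: int
    have zero: "measure \<mu> ((\<lambda>x. x $ 1) -` Q j) = 0" if "\<bar>j - m\<bar> \<le> 1" for j
      using neg that \<nu>[of "Q j"] measure_nonneg[of \<nu> "Q j"] unfolding Q_def m_def
      by (metis closed_atLeastAtMost less_eq_real_def)
    obtain z where z: "z \<in> F" "x = z $ 1" using x by (auto simp: E_def)
    have "(\<lambda>n. \<rho> ^ n * 2) \<longlonglongrightarrow> 0 * 2"
      using \<rho> by (intro tendsto_intros LIMSEQ_realpow_zero) auto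
    then have "\<forall>\<^sub>F n in sequentially. \<rho> ^ n * 2 < \<delta>" using \<delta> by (intro order_tendstoD) auto
    then obtain n where n: "\<rho> ^ n * 2 < \<delta>" by (auto simp: eventually_sequentially)
    obtain w y where w: "length w = n" "y \<in> F" "z = word_map S w y"
      using attractor_word[OF F_eq z(1)] by blast
    \<comment> \<open>The three adjacent cells cover the \<delta>-neighbourhood of \<open>x\<close>
      on the axis, so \<open>U\<close> contains the image of the square under a word long enough to
      contract below \<delta>. This makes \<open>U\<close> charged, although each of its three parts
      is assumed null.\<close>
    define U where "U = (\<lambda>x::real^2. x $ 1) -` Q (m - 1) \<union> (\<lambda>x. x $ 1) -` Q m \<union> (\<lambda>x. x $ 1) -` Q (m + 1)"
    have "word_map S w ` unit_square \<subseteq> U"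
    proof safe
      fix v assume v: "v \<in> unit_square"
      have "\<bar>word_map S w v $ 1 - x\<bar> \<le> \<delta>"
        using component_le_dist[of "word_map S w v" 1 z] word_contr[OF v, of y w] w z n F_subset by auto
      moreover have "\<delta> * of_int m \<le> x" "x \<le> \<delta> * of_int m + \<delta>"
      proof -
        have "of_int m \<le> x / \<delta>" "x / \<delta> \<le> of_int m + 1" unfolding m_def by linarith+
        then show "\<delta> * of_int m \<le> x" "x \<le> \<delta> * of_int m + \<delta>" using \<delta> by (simp_all add: field_simps)
      qed
      ultimately show "word_map S w v \<in> U" unfolding U_def Q_def by (auto simp: algebra_simps)
    qed
    moreover have "closed U" unfolding U_def Q_def by (intro closed_Un cl closed_atLeastAtMost)
    ultimately have "0 < measure \<mu> U"
      using nonlinear_measure_pos[OF \<mu> p S_continuous maps compact_imp_closed[OF F_compact] F_subset] by blast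
    moreover have "measure \<mu> U \<le> 0"
    proof -
      have b: "(\<lambda>x. x $ 1) -` Q j \<in> sets \<mu>" for j
        unfolding sets Q_def by (intro borel_closed cl closed_atLeastAtMost)
      have "measure \<mu> U \<le> measure \<mu> ((\<lambda>x. x $ 1) -` Q (m - 1) \<union> (\<lambda>x. x $ 1) -` Q m) + measure \<mu> ((\<lambda>x. x $ 1) -` Q (m + 1))"
        unfolding U_def using b by (intro measure_Un_le sets.Un) auto
      also have "measure \<mu> ((\<lambda>x. x $ 1) -` Q (m - 1) \<union> (\<lambda>x. x $ 1) -` Q m) \<le>
          measure \<mu> ((\<lambda>x. x $ 1) -` Q (m - 1)) + measure \<mu> ((\<lambda>x. x $ 1) -` Q m)"
        using b by (intro measure_Un_le) auto
      finally show ?thesis using zero[of "m - 1"] zero[of m] zero[of "m + 1"] by simp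
    qed
    ultimately show False by simp
  qed
  have up: "moment_sum \<nu> 0 \<delta> \<le> 4 * packing_number E \<delta>" and lo: "packing_number E (3 * \<delta>) \<le> moment_sum \<nu> 0 \<delta>"
    if \<delta>: "\<delta> > 0" for \<delta>
  proof -
    have eq: "moment_sum \<nu> 0 \<delta> = real (card (positive_cells \<nu> \<delta>))"
      using moment_sum_0[OF \<delta>] by (simp add: positive_cells_def)
    note 1 = positive_cells_le_packing[OF E_subset \<delta> \<nu>_null]
    show "moment_sum \<nu> 0 \<delta> \<le> 4 * packing_number E \<delta>" unfolding eq using 1 by linarith
    show "packing_number E (3 * \<delta>) \<le> moment_sum \<nu> 0 \<delta>" unfolding eq
      using packing_le_positive_cells[OF E_subset \<delta> conjunct1[OF 1] \<nu>_pos[OF _ \<delta>]] by simp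
  qed
  have ev01: "\<forall>\<^sub>F r in at_right 0. 0 < r \<and> r < (1/3::real)"
    by (auto simp: eventually_at_right_field intro: exI[of _ "1/3"])
  have lim: "((\<lambda>\<delta>. ln (moment_sum \<nu> 0 \<delta>) / (- ln \<delta>)) \<longlongrightarrow> \<beta>) (at_right 0)"
  proof (rule order_tendstoI)
    fix y assume "\<beta> < y"
    then show "\<forall>\<^sub>F x in at_right 0. ln (moment_sum \<nu> 0 x) / - ln x < y"
    proof (rule eventually_log_ratio_less[rotated])
      fix e :: real assume "0 < e"
      then obtain C where C: "C \<ge> 1" "\<And>r. 0 < r \<Longrightarrow> r \<le> 1 \<Longrightarrow> real (packing_number E r) \<le> C * r powr - (\<beta> + e)"
        using \<beta>[of e 1] by auto
      have "\<forall>\<^sub>F r in at_right 0. 0 < moment_sum \<nu> 0 r \<and> moment_sum \<nu> 0 r \<le> (4 * C) * r powr - (\<beta> + e)"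
        using ev01
      proof eventually_elim
        case (elim r)
        then show ?case using up[of r] C(2)[of r] lo[of r] packing_E_ge_1[of "3 * r"] by auto
      qed
      then show "\<exists>C>0. \<forall>\<^sub>F r in at_right 0. 0 < moment_sum \<nu> 0 r \<and> moment_sum \<nu> 0 r \<le> C * r powr - (\<beta> + e)"
        using C(1) by (intro exI[of _ "4 * C"]) auto
    qed
  next
    fix y assume "y < \<beta>"
    then show "\<forall>\<^sub>F x in at_right 0. y < ln (moment_sum \<nu> 0 x) / - ln x"
    proof (rule eventually_log_ratio_greater[rotated])
      fix e :: real assume "0 < e"
      then obtain C where C: "C \<ge> 1" "\<And>r. 0 < r \<Longrightarrow> r \<le> 1 \<Longrightarrow> r powr - (\<beta> - e) / C \<le> real (packing_number E r)"
        using \<beta>[of e 1] by auto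
      have "\<forall>\<^sub>F r in at_right 0. (3 powr - (\<beta> - e) / C) * r powr - (\<beta> - e) \<le> moment_sum \<nu> 0 r"
        using ev01
      proof eventually_elim
        case (elim r)
        then have "(3 * r) powr - (\<beta> - e) / C \<le> moment_sum \<nu> 0 r"
          using C(2)[of "3 * r"] lo[of r] by auto
        then show ?case using elim by (simp add: powr_mult)
      qed
      then show "\<exists>C>0. \<forall>\<^sub>F r in at_right 0. C * r powr - (\<beta> - e) \<le> moment_sum \<nu> 0 r"
        using C(1) by (intro exI[of _ "3 powr - (\<beta> - e) / C"]) auto
    qed
  qed
  have "proj_spectrum \<mu> 0 = \<beta>"
    unfolding proj_spectrum_def Lq_spectrum_def \<nu>_def[symmetric]
    using tendsto_Lim[OF _ lim] by simp
  then show thesis using \<beta>[OF assms(3,4)] that by blast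
qed

end

section \<open>Pressure\<close>


text \<open>Exponents of either sign occur, hence the absolute value. A nonnegative \<open>t\<close>
  uses the upper bound for \<open>x\<close>, a negative one the upper bound for
  \<open>y\<close>.\<close>

lemma powr_comparable:
  assumes "0 < x" "0 < y" "x \<le> k * y" "y \<le> k * x" "1 \<le> (k::real)"
  shows "x powr t \<le> k powr \<bar>t\<bar> * y powr t"
proof (cases "0 \<le> t")
  case True
  then have "x powr t \<le> (k * y) powr t" using assms by (intro powr_mono2) auto
  then show ?thesis using True assms by (simp add: powr_mult)
next
  case False
  then have "(k * x) powr t \<le> y powr t" using assms by (intro powr_mono2') auto
  then have "k powr t * x powr t \<le> y powr t" using assms by (simp add: powr_mult)
  then have "k powr - t * (k powr t * x powr t) \<le> k powr - t * y powr t" by (intro mult_left_mono) auto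
  then show ?thesis using False assms by (simp add: mult.assoc[symmetric] powr_add[symmetric])
qed

section \<open>Sums over words\<close>

lemma finite_words: "finite {w::'i::finite list. length w = k}"
  using finite_lists_length_eq[of "UNIV :: 'i set" k] by simp

lemma sum_words_add:
  fixes \<phi> :: "'i::finite list \<Rightarrow> real"
  shows "(\<Sum>w | length w = m + n. \<phi> w) = (\<Sum>u | length u = m. \<Sum>v | length v = n. \<phi> (u @ v))"
proof -
  have "bij_betw (\<lambda>(u, v). u @ v) ({u. length u = m} \<times> {v. length v = n}) {w::'i list. length w = m + n}"
    by (rule bij_betw_byWitness[where f' = "\<lambda>w. (take m w, drop m w)"]) auto
  from sum.reindex_bij_betw[OF this, of \<phi>] show ?thesis
    by (simp add: sum.cartesian_product split_def)
qed

lemma sum_comparable: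
  fixes f g :: "'b \<Rightarrow> real"
  assumes "\<And>x. x \<in> X \<Longrightarrow> f x \<le> c * g x"
  shows "sum f X \<le> c * sum g X"
  using assms by (simp add: sum_distrib_left sum_mono)

text \<open>The lower slope bound gives continuity, the upper one strict decrease and a change of
  sign; the intermediate value theorem does the rest.\<close>

lemma unique_zero_bi_lipschitz:
  fixes L :: "real \<Rightarrow> real"
  assumes "c < 0" "\<And>s t. s < t \<Longrightarrow> C * (t - s) \<le> L t - L s \<and> L t - L s \<le> c * (t - s)"
  shows "\<exists>!s. L s = 0"
proof -
  have anti: "L t < L s" if "s < t" for s t
    using assms(2)[OF that] mult_neg_pos[OF assms(1), of "t - s"] that by linarith
  have "C \<le> c" using assms(2)[of 0 1] by simp
  have "\<bar>L t - L s\<bar> \<le> \<bar>C\<bar> * \<bar>t - s\<bar>" for s t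
  proof (cases s t rule: linorder_cases)
    case less
    then show ?thesis using assms(2)[OF less] anti[OF less] \<open>C \<le> c\<close> assms(1) by (simp add: abs_of_neg)
  next
    case greater
    then show ?thesis using assms(2)[OF greater] anti[OF greater] \<open>C \<le> c\<close> assms(1) by (simp add: abs_of_neg)
  qed simp
  then have "\<bar>C\<bar>-lipschitz_on UNIV L"
    by (intro lipschitz_onI) (auto simp: dist_real_def abs_minus_commute)
  then have cont: "continuous_on X L" for X
    using lipschitz_on_continuous_on continuous_on_subset by blast
  \<comment> \<open>Over a length \<open>s\<close>, a descent of slope at least \<open>- c\<close>
    in modulus covers \<open>\<bar>L 0\<bar>\<close>, so the sign has changed between
    \<open>- s\<close> and \<open>s\<close>.\<close>
  define s where "s = \<bar>L 0\<bar> / (- c) + 1"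
  have s: "0 < s" using assms(1) by (simp add: s_def divide_nonneg_neg add_nonneg_pos)
  have cs: "c * s \<le> - \<bar>L 0\<bar>" using assms(1) by (simp add: s_def field_simps)
  have 1: "L s \<le> 0" using assms(2)[OF s] cs by (simp add: abs_if split: if_splits)
  have 2: "0 \<le> L (- s)" using assms(2)[of "- s" 0] s cs by (simp add: abs_if split: if_splits)
  have "\<exists>x\<ge>- s. x \<le> s \<and> L x = 0"
    using 1 2 s cont by (intro IVT2') auto
  then obtain x where "L x = 0" by blast
  moreover have "x = y" if "L x = 0" "L y = 0" for x y
    using that anti by (metis less_irrefl linorder_neqE)
  ultimately show ?thesis by blast
qed

context dominated_system
begin

context
  fixes \<beta> :: real
begin

text \<open>The function \<open>psi\<close> at \<open>q = 0\<close> with the singular values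
  replaced by the comparable diagonal entries, which are multiplicative up to constants whereas
  singular values are awkward to compose.\<close>

definition weight :: "real \<Rightarrow> 'i list \<Rightarrow> real" where
  "weight s w = A w powr \<beta> * B w powr (s - \<beta>)"

definition Z :: "real \<Rightarrow> nat \<Rightarrow> real" where
  "Z s n = (\<Sum>w | length w = n. weight s w)"

definition weight_distortion :: "real \<Rightarrow> real" where
  "weight_distortion s = K powr (\<bar>\<beta>\<bar> + \<bar>s - \<beta>\<bar>)"

lemma weight_pos: "0 < weight s w"
  unfolding weight_def using A_pos[of w] B_pos[of w] by simp

lemma weight_distortion_ge_1: "1 \<le> weight_distortion s"
  unfolding weight_distortion_def using K_ge_1 by (intro ge_one_powr_ge_zero) auto

lemma Z_pos: "0 < Z s n"
  unfolding Z_def using weight_pos finite_words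
  by (intro sum_pos) (auto intro: exI[of _ "replicate n undefined"])

lemma weight_append:
  "weight s (u @ v) \<le> weight_distortion s * (weight s u * weight s v)"
  "weight s u * weight s v \<le> weight_distortion s * weight s (u @ v)"
proof -
  have pos: "0 < A u * A v" "0 < B u * B v" using A_pos B_pos by auto
  have 1: "A (u @ v) powr \<beta> \<le> K powr \<bar>\<beta>\<bar> * (A u * A v) powr \<beta>"
    "(A u * A v) powr \<beta> \<le> K powr \<bar>\<beta>\<bar> * A (u @ v) powr \<beta>"
    using A_append_le A_append_ge A_pos pos K_ge_1 by (auto intro!: powr_comparable)
  have 2: "B (u @ v) powr (s - \<beta>) \<le> K powr \<bar>s - \<beta>\<bar> * (B u * B v) powr (s - \<beta>)"
    "(B u * B v) powr (s - \<beta>) \<le> K powr \<bar>s - \<beta>\<bar> * B (u @ v) powr (s - \<beta>)"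
    using B_append_le B_append_ge B_pos pos K_ge_1 by (auto intro!: powr_comparable)
  have eq: "weight s u * weight s v = (A u * A v) powr \<beta> * (B u * B v) powr (s - \<beta>)"
    using A_pos B_pos by (simp add: weight_def powr_mult less_imp_le)
  have "weight s (u @ v) \<le> (K powr \<bar>\<beta>\<bar> * (A u * A v) powr \<beta>) * (K powr \<bar>s - \<beta>\<bar> * (B u * B v) powr (s - \<beta>))"
    unfolding weight_def using 1 2 by (intro mult_mono) auto
  also have "\<dots> = weight_distortion s * (weight s u * weight s v)"
    unfolding eq weight_distortion_def by (simp add: powr_add mult_ac)
  finally show "weight s (u @ v) \<le> weight_distortion s * (weight s u * weight s v)" .
  have "weight s u * weight s v \<le> (K powr \<bar>\<beta>\<bar> * A (u @ v) powr \<beta>) * (K powr \<bar>s - \<beta>\<bar> * B (u @ v) powr (s - \<beta>))"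
    unfolding eq using 1 2 by (intro mult_mono) auto
  also have "\<dots> = weight_distortion s * weight s (u @ v)"
    unfolding weight_def weight_distortion_def by (simp add: powr_add mult_ac)
  finally show "weight s u * weight s v \<le> weight_distortion s * weight s (u @ v)" .
qed

lemma Z_add: "Z s (m + n) \<le> weight_distortion s * (Z s m * Z s n)" "Z s m * Z s n \<le> weight_distortion s * Z s (m + n)"
proof -
  have prod: "Z s m * Z s n = (\<Sum>u | length u = m. \<Sum>v | length v = n. weight s u * weight s v)"
    unfolding Z_def by (simp add: sum_product)
  have sum: "Z s (m + n) = (\<Sum>u | length u = m. \<Sum>v | length v = n. weight s (u @ v))"
    unfolding Z_def by (rule sum_words_add)
  show "Z s (m + n) \<le> weight_distortion s * (Z s m * Z s n)" "Z s m * Z s n \<le> weight_distortion s * Z s (m + n)"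
    unfolding prod sum using weight_append by (auto intro!: sum_comparable)
qed

text \<open>By \<open>Z_add\<close> the logarithms are almost additive with an error independent of
  the lengths. The second conclusion is the one that matters later: where the limit is 0, the sums
  themselves are bounded in both directions.\<close>

lemma log_Z_limit:
  obtains L where "\<And>s. (\<lambda>n. ln (Z s n) / n) \<longlonglongrightarrow> L s"
    "\<And>s n. n \<ge> 1 \<Longrightarrow> \<bar>ln (Z s n) - L s * real n\<bar> \<le> ln (weight_distortion s)"
proof -
  have "\<exists>L. (\<lambda>n. ln (Z s n) / real n) \<longlonglongrightarrow> L \<and> (\<forall>n\<ge>1. \<bar>ln (Z s n) - L * real n\<bar> \<le> ln (weight_distortion s))" for s
  proof (rule almost_additive_limit)
    fix m n :: nat
    note pos = Z_pos[of s m] Z_pos[of s n] Z_pos[of s "m + n"] weight_distortion_ge_1[of s]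
    have "ln (Z s (m + n)) \<le> ln (weight_distortion s * (Z s m * Z s n))"
      using pos Z_add[of s m n] by (subst ln_le_cancel_iff) auto
    moreover have "ln (Z s m * Z s n) \<le> ln (weight_distortion s * Z s (m + n))"
      using pos Z_add[of s m n] by (subst ln_le_cancel_iff) auto
    ultimately show "\<bar>ln (Z s (m + n)) - ln (Z s m) - ln (Z s n)\<bar> \<le> ln (weight_distortion s)"
      using pos by (simp add: ln_mult_pos)
  qed
  then show thesis using that by metis
qed

text \<open>Raising the parameter from \<open>s\<close> to \<open>t\<close> multiplies each weight
  by \<open>B w powr (t - s)\<close>, and for words of length \<open>n\<close> the value
  \<open>B w\<close> lies between \<open>d ^ n\<close> and
  \<open>2 * K * \<rho> ^ n\<close>.\<close>

lemma Z_shift: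
  assumes "s < t"
  shows "Z t n \<le> (2 * K * \<rho> ^ n) powr (t - s) * Z s n" "(d ^ n) powr (t - s) * Z s n \<le> Z t n"
proof -
  have eq: "weight t w = B w powr (t - s) * weight s w" for w
    using B_pos[of w] by (simp add: weight_def powr_add[symmetric] mult.left_commute)
  have "weight t w \<le> (2 * K * \<rho> ^ n) powr (t - s) * weight s w" if "length w = n" for w
    unfolding eq using B_le[of w] that assms B_pos[of w] weight_pos[of s w]
    by (intro mult_right_mono powr_mono2) auto
  then show "Z t n \<le> (2 * K * \<rho> ^ n) powr (t - s) * Z s n"
    unfolding Z_def by (intro sum_comparable) auto
  have "(d ^ n) powr (t - s) * weight s w \<le> weight t w" if "length w = n" for w
    unfolding eq using B_ge[of w] that assms d(1) weight_pos[of s w]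
    by (intro mult_right_mono powr_mono2) auto
  then show "(d ^ n) powr (t - s) * Z s n \<le> Z t n"
    unfolding Z_def sum_distrib_left by (intro sum_mono) auto
qed

text \<open>After taking logarithms and dividing by \<open>n\<close> the constant
  \<open>2 * K\<close> disappears. Both slopes are negative, as
  \<open>unique_zero_bi_lipschitz\<close> requires.\<close>

lemma log_Z_limit_bounds:
  assumes L: "\<And>s. (\<lambda>n. ln (Z s n) / n) \<longlonglongrightarrow> L s" and st: "s < t"
  shows "ln d * (t - s) \<le> L t - L s" "L t - L s \<le> ln \<rho> * (t - s)"
proof -
  have lim: "(\<lambda>n. ln (Z t n) / real n - ln (Z s n) / real n) \<longlonglongrightarrow> L t - L s"
    by (intro tendsto_diff L)
  have lim2: "(\<lambda>n. (t - s) * (ln (2 * K) / real n + ln \<rho>)) \<longlonglongrightarrow> (t - s) * (0 + ln \<rho>)"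
    by (intro tendsto_intros lim_const_over_n)
  have "ln (Z t n) / real n - ln (Z s n) / real n \<le> (t - s) * (ln (2 * K) / real n + ln \<rho>)" if "n \<ge> 1" for n
  proof -
    have "ln (Z t n) \<le> ln ((2 * K * \<rho> ^ n) powr (t - s) * Z s n)"
      using Z_shift(1)[OF st, of n] Z_pos[of t n] Z_pos[of s n] K_ge_1 \<rho> by (subst ln_le_cancel_iff) auto
    also have "\<dots> = (t - s) * (ln (2 * K) + real n * ln \<rho>) + ln (Z s n)"
    proof -
      have "0 < (2 * K * \<rho> ^ n) powr (t - s)" using K_ge_1 \<rho> by auto
      moreover have "ln (2 * K * \<rho> ^ n) = ln (2 * K) + real n * ln \<rho>"
        using K_ge_1 \<rho> by (simp add: ln_mult_pos ln_realpow)
      ultimately show ?thesis using Z_pos[of s n] K_ge_1 \<rho> by (simp add: ln_mult_pos ln_powr)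
    qed
    finally have "(ln (Z t n) - ln (Z s n)) / real n \<le> (t - s) * (ln (2 * K) + real n * ln \<rho>) / real n"
      by (intro divide_right_mono) auto
    moreover have "(t - s) * (ln (2 * K) + real n * ln \<rho>) / real n = (t - s) * (ln (2 * K) / real n + ln \<rho>)"
      using that by (simp add: field_simps)
    ultimately show ?thesis by (simp add: diff_divide_distrib)
  qed
  then show "L t - L s \<le> ln \<rho> * (t - s)"
    using LIMSEQ_le[OF lim lim2] by (auto simp: mult.commute)
  have "(t - s) * ln d \<le> ln (Z t n) / real n - ln (Z s n) / real n" if "n \<ge> 1" for n
  proof -
    have "ln ((d ^ n) powr (t - s) * Z s n) \<le> ln (Z t n)"
      using Z_shift(2)[OF st, of n] Z_pos[of t n] Z_pos[of s n] d by (subst ln_le_cancel_iff) auto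
    moreover have "ln ((d ^ n) powr (t - s) * Z s n) = (t - s) * (real n * ln d) + ln (Z s n)"
      using Z_pos[of s n] d by (simp add: ln_mult_pos ln_powr ln_realpow)
    ultimately show ?thesis using that by (simp add: field_simps)
  qed
  then show "ln d * (t - s) \<le> L t - L s"
    using LIMSEQ_le_const[OF lim] by (auto simp: mult.commute)
qed

text \<open>Each summand agrees with its \<open>weight\<close> up to a fixed power of
  \<open>K + 2\<close>, and the root of order \<open>n\<close> sends such factors to 1.\<close>

lemma weighted_sv_limit:
  assumes L: "\<And>s. (\<lambda>n. ln (Z s n) / n) \<longlonglongrightarrow> L s"
  shows "(\<lambda>n. (\<Sum>w | length w = n. sv1 (word_jacobian S w a) powr \<beta> *
      sv2 (word_jacobian S w a) powr (s - \<beta>)) powr (1 / real n)) \<longlonglongrightarrow> exp (L s)"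
proof -
  define \<omega> where "\<omega> w = sv1 (word_jacobian S w a) powr \<beta> * sv2 (word_jacobian S w a) powr (s - \<beta>)" for w
  define c where "c = (K + 2) powr (\<bar>\<beta>\<bar> + \<bar>s - \<beta>\<bar>)"
  have K: "1 \<le> K + 2" using K_ge_1 by simp
  have c: "1 \<le> c" unfolding c_def using K by (intro ge_one_powr_ge_zero) auto
  have comp: "\<omega> w \<le> c * weight s w" "weight s w \<le> c * \<omega> w" for w
  proof -
    let ?a = "sv1 (word_jacobian S w a)" and ?b = "sv2 (word_jacobian S w a)"
    have b1: "B w \<le> (K + 2) * ?b" using sv_word(3)[of w] K by (simp add: field_simps)
    have a1: "A w \<le> (K + 2) * ?a"
      using sv_word(1)[of w] A_pos[of w] mult_right_mono[of 2 "K + 2" ?a] K_ge_1 by linarith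
    have b2: "?b \<le> (K + 2) * B w"
      using sv_word(4)[of w] B_pos[of w] mult_right_mono[of 2 "K + 2" "B w"] K_ge_1 by linarith
    have pos: "0 < ?a" "0 < ?b" using sv_word(1,3)[of w] A_pos[of w] B_pos[of w] K
      by (smt (verit) divide_pos_pos)+
    have 1: "?a powr \<beta> \<le> (K + 2) powr \<bar>\<beta>\<bar> * A w powr \<beta>" "A w powr \<beta> \<le> (K + 2) powr \<bar>\<beta>\<bar> * ?a powr \<beta>"
      using pos A_pos[of w] a1 sv_word(2)[of w] K by (auto intro!: powr_comparable)
    have 2: "?b powr (s - \<beta>) \<le> (K + 2) powr \<bar>s - \<beta>\<bar> * B w powr (s - \<beta>)"
      "B w powr (s - \<beta>) \<le> (K + 2) powr \<bar>s - \<beta>\<bar> * ?b powr (s - \<beta>)"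
      using pos B_pos[of w] b1 b2 K by (auto intro!: powr_comparable)
    have "\<omega> w \<le> ((K + 2) powr \<bar>\<beta>\<bar> * A w powr \<beta>) * ((K + 2) powr \<bar>s - \<beta>\<bar> * B w powr (s - \<beta>))"
      unfolding \<omega>_def using 1 2 by (intro mult_mono) auto
    then show "\<omega> w \<le> c * weight s w" by (simp add: c_def weight_def powr_add mult_ac)
    have "weight s w \<le> ((K + 2) powr \<bar>\<beta>\<bar> * ?a powr \<beta>) * ((K + 2) powr \<bar>s - \<beta>\<bar> * ?b powr (s - \<beta>))"
      unfolding weight_def using 1 2 by (intro mult_mono) auto
    then show "weight s w \<le> c * \<omega> w" by (simp add: c_def \<omega>_def powr_add mult_ac)
  qed
  define X where "X n = (\<Sum>w | length w = n. \<omega> w)" for n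
  have X: "X n \<le> c * Z s n" "Z s n \<le> c * X n" for n
    unfolding X_def Z_def by (intro sum_comparable comp)+
  have Xpos: "0 < X n" for n using X(2)[of n] Z_pos[of s n] c by (smt (verit) zero_less_mult_pos)
  have bd: "\<bar>ln (X n) - ln (Z s n)\<bar> \<le> ln c" for n
  proof -
    have "ln (X n) \<le> ln (c * Z s n)" "ln (Z s n) \<le> ln (c * X n)"
      using X[of n] Xpos[of n] Z_pos[of s n] c by (auto simp del: ln_mult)
    then show ?thesis using Xpos[of n] Z_pos[of s n] c by (simp add: ln_mult_pos)
  qed
  have "(\<lambda>n. (ln (X n) - ln (Z s n)) / real n) \<longlonglongrightarrow> 0"
  proof (rule Lim_null_comparison)
    show "\<forall>\<^sub>F n in sequentially. norm ((ln (X n) - ln (Z s n)) / real n) \<le> ln c / real n"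
      using bd by (auto simp: abs_divide divide_right_mono)
  qed (rule lim_const_over_n)
  from tendsto_add[OF this L[of s]]
  have "(\<lambda>n. ln (X n) / real n) \<longlonglongrightarrow> L s" by (simp add: add_divide_distrib[symmetric])
  then have "(\<lambda>n. exp (ln (X n) / real n)) \<longlonglongrightarrow> exp (L s)" by (rule tendsto_exp)
  moreover have "exp (ln (X n) / real n) = X n powr (1 / real n)" for n
    using Xpos[of n] by (simp add: powr_def)
  ultimately show ?thesis by (simp add: X_def \<omega>_def)
qed

end

text \<open>At \<open>q = 0\<close> the probabilities contribute a factor 1, so the pressure is
  \<open>exp (L s)\<close> and equals 1 exactly at the unique zero of \<open>L\<close>. This is
  where the definite description in \<open>moment_scaling\<close> acquires its value, and there the
  logarithms of the sums are bounded.\<close>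

lemma moment_scaling_weights:
  fixes p :: "'i \<Rightarrow> real" and \<mu> :: "(real^2) measure"
  assumes p: "\<And>i. 0 < p i"
  defines "\<beta> \<equiv> proj_spectrum \<mu> 0" and "\<gamma> \<equiv> moment_scaling S p \<mu> a 0"
  obtains C where "C \<ge> 1" "\<And>n. Z \<beta> \<gamma> n \<le> C" "\<And>n. 1 / C \<le> Z \<beta> \<gamma> n"
proof -
  obtain L where L: "\<And>s. (\<lambda>n. ln (Z \<beta> s n) / n) \<longlonglongrightarrow> L s"
    "\<And>s n. n \<ge> 1 \<Longrightarrow> \<bar>ln (Z \<beta> s n) - L s * real n\<bar> \<le> ln (weight_distortion \<beta> s)"
    by (rule log_Z_limit[of \<beta>]) (rule that)
  have "word_weight p w \<noteq> 0" for w
    using p unfolding word_weight_def by (induction w) (auto simp: less_imp_neq[symmetric])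
  then have psi: "psi S p \<mu> a s 0 w = sv1 (word_jacobian S w a) powr \<beta> * sv2 (word_jacobian S w a) powr (s - \<beta>)" for s w
    by (simp add: psi_def \<beta>_def)
  have pr: "pressure S p \<mu> a s 0 = exp (L s)" for s
    unfolding pressure_def psi by (rule limI) (rule weighted_sv_limit[OF L(1)])
  have "\<exists>!s. L s = 0"
    using \<rho> log_Z_limit_bounds[of \<beta> L, OF L(1)]
    by (intro unique_zero_bi_lipschitz[of "ln \<rho>" "ln d"]) auto
  then have "L \<gamma> = 0"
    unfolding \<gamma>_def moment_scaling_def pr using theI'[of "\<lambda>s. L s = 0"] by simp
  then have bd: "\<bar>ln (Z \<beta> \<gamma> n)\<bar> \<le> ln (weight_distortion \<beta> \<gamma>)" for n
  \<comment> \<open>The limit controls positive lengths only. Length 0 matters as well, since a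
    stopping word may already have full length and leave an empty remainder.\<close>
  proof (cases "n = 0")
    case True
    have "Z \<beta> \<gamma> n = 1" by (simp add: True Z_def weight_def)
    then show ?thesis using weight_distortion_ge_1[of \<beta> \<gamma>] by simp
  next
    case False
    then show ?thesis using L(2)[of n \<gamma>] \<open>L \<gamma> = 0\<close> by simp
  qed
  show thesis
  proof (rule that[of "weight_distortion \<beta> \<gamma>"])
    fix n
    have pos: "0 < Z \<beta> \<gamma> n" "0 < weight_distortion \<beta> \<gamma>" using Z_pos weight_distortion_ge_1[of \<beta> \<gamma>] by auto
    have "ln (Z \<beta> \<gamma> n) \<le> ln (weight_distortion \<beta> \<gamma>)" using bd[of n] by linarith
    then show "Z \<beta> \<gamma> n \<le> weight_distortion \<beta> \<gamma>" using pos by simp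
    have "ln (1 / weight_distortion \<beta> \<gamma>) = - ln (weight_distortion \<beta> \<gamma>)" using pos by (simp add: ln_div)
    then have "ln (1 / weight_distortion \<beta> \<gamma>) \<le> ln (Z \<beta> \<gamma> n)" using bd[of n] by linarith
    then show "1 / weight_distortion \<beta> \<gamma> \<le> Z \<beta> \<gamma> n" using pos by (subst (asm) ln_le_cancel_iff) auto
  qed (rule weight_distortion_ge_1)
qed

text \<open>Past a stopping word \<open>u\<close>, the sum over continuations of a fixed length is
  comparable to \<open>weight \<beta> \<gamma> u\<close> times some
  \<open>Z \<beta> \<gamma> m\<close>, hence to \<open>weight \<beta> \<gamma> u\<close> alone.
  Summing over \<open>u\<close> compares the stopping sum with a full level sum
  \<open>Z \<beta> \<gamma> n\<close>.\<close>

lemma stopping_weights: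
  fixes p :: "'i \<Rightarrow> real" and \<mu> :: "(real^2) measure"
  assumes p: "\<And>i. 0 < p i"
  defines "\<beta> \<equiv> proj_spectrum \<mu> 0" and "\<gamma> \<equiv> moment_scaling S p \<mu> a 0"
  obtains C where "C \<ge> 1" "\<And>\<delta>. 0 < \<delta> \<Longrightarrow> (\<Sum>w\<in>stopping B \<delta>. weight \<beta> \<gamma> w) \<le> C"
    "\<And>\<delta>. 0 < \<delta> \<Longrightarrow> 1 / C \<le> (\<Sum>w\<in>stopping B \<delta>. weight \<beta> \<gamma> w)"
proof -
  obtain C where C: "C \<ge> 1" "\<And>n. Z \<beta> \<gamma> n \<le> C" "\<And>n. 1 / C \<le> Z \<beta> \<gamma> n"
    by (rule moment_scaling_weights[of p \<mu>, OF p, folded \<beta>_def \<gamma>_def]) (rule that)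
  define k where "k = weight_distortion \<beta> \<gamma>"
  have k: "1 \<le> k" by (simp add: k_def weight_distortion_ge_1)
  have k0: "0 < k" using k by simp
  have main: "(\<Sum>w\<in>stopping B \<delta>. weight \<beta> \<gamma> w) \<le> k * C * C \<and> 1 / (k * C * C) \<le> (\<Sum>w\<in>stopping B \<delta>. weight \<beta> \<gamma> w)"
    if \<delta>: "0 < \<delta>" for \<delta>
  proof -
    obtain n where n: "\<And>w. n \<le> length w \<Longrightarrow> A w \<le> \<delta>" using A_small[OF \<delta>] by blast
    have nB: "B w \<le> \<delta>" if "length w = n" for w using n[of w] that B_le_A[of w] by linarith
    let ?\<Sigma> = "\<Sum>w\<in>stopping B \<delta>. weight \<beta> \<gamma> w"
    have Zn: "Z \<beta> \<gamma> n = (\<Sum>u\<in>stopping B \<delta>. \<Sum>v | length v = n - length u. weight \<beta> \<gamma> (u @ v))"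
      unfolding Z_def by (rule sum_over_stopping[OF nB])
    have up: "(\<Sum>v | length v = m. weight \<beta> \<gamma> (u @ v)) \<le> (k * C) * weight \<beta> \<gamma> u" for u m
    proof -
      have "(\<Sum>v | length v = m. weight \<beta> \<gamma> (u @ v)) \<le> (k * weight \<beta> \<gamma> u) * Z \<beta> \<gamma> m"
        unfolding Z_def k_def using weight_append(1)[of \<beta> \<gamma> u]
        by (intro sum_comparable) (simp add: mult.assoc)
      also have "\<dots> \<le> (k * weight \<beta> \<gamma> u) * C"
        using C(2) k0 weight_pos[of \<beta> \<gamma> u] by (intro mult_left_mono) auto
      finally show ?thesis by (simp add: mult_ac)
    qed
    have lo: "weight \<beta> \<gamma> u \<le> (k * C) * (\<Sum>v | length v = m. weight \<beta> \<gamma> (u @ v))" for u m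
    proof -
      have "weight \<beta> \<gamma> u * 1 \<le> weight \<beta> \<gamma> u * (C * Z \<beta> \<gamma> m)"
        using C(1) C(3)[of m] weight_pos[of \<beta> \<gamma> u]
        by (intro mult_left_mono) (auto simp: field_simps)
      also have "weight \<beta> \<gamma> u * (C * Z \<beta> \<gamma> m) = C * (weight \<beta> \<gamma> u * Z \<beta> \<gamma> m)" by simp
      also have "weight \<beta> \<gamma> u * Z \<beta> \<gamma> m \<le> k * (\<Sum>v | length v = m. weight \<beta> \<gamma> (u @ v))"
        unfolding Z_def k_def sum_distrib_left using weight_append(2)[of \<beta> \<gamma> u]
        by (intro sum_mono) simp
      finally show ?thesis using C(1) by (simp add: mult_ac)
    qed
    have "?\<Sigma> \<le> (k * C) * Z \<beta> \<gamma> n" unfolding Zn by (intro sum_comparable lo)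
    also have "\<dots> \<le> (k * C) * C" using C k0 by (intro mult_left_mono) auto
    finally have 1: "?\<Sigma> \<le> k * C * C" .
    have "1 / C \<le> Z \<beta> \<gamma> n" by (rule C)
    also have "\<dots> \<le> (k * C) * ?\<Sigma>" unfolding Zn by (intro sum_comparable up)
    finally have 2: "1 / (k * C * C) \<le> ?\<Sigma>" using C(1) k0 by (simp add: field_simps)
    from 1 2 show ?thesis by blast
  qed
  have "1 * 1 * 1 \<le> k * C * C" using k C(1) by (intro mult_mono) auto
  with main show thesis by (intro that[of "k * C * C"]) auto
qed

end

section \<open>Counting\<close>


text \<open>The values at the end points are at least \<eta> apart, so a multiple of \<eta> lies
  between them. Either end value may be the larger one, as no monotonicity is assumed.\<close>

lemma ivt_grid:
  fixes \<phi> :: "real \<Rightarrow> real"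
  assumes "p \<le> q" "continuous_on {p..q} \<phi>" "0 < \<eta>" "\<eta> \<le> \<bar>\<phi> q - \<phi> p\<bar>"
  obtains x m where "x \<in> {p..q}" "\<phi> x = \<eta> * of_int m"
proof -
  define lo where "lo = min (\<phi> p) (\<phi> q)"
  define m where "m = \<lceil>lo / \<eta>\<rceil>"
  have "lo / \<eta> \<le> of_int m" "of_int m \<le> lo / \<eta> + 1" unfolding m_def by linarith+
  then have "lo \<le> \<eta> * of_int m" "\<eta> * of_int m \<le> lo + \<eta>" using assms(3) by (simp_all add: field_simps)
  then have "\<phi> p \<le> \<eta> * of_int m \<and> \<eta> * of_int m \<le> \<phi> q \<or> \<phi> q \<le> \<eta> * of_int m \<and> \<eta> * of_int m \<le> \<phi> p"
    using assms(4) unfolding lo_def by linarith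
  then show thesis
    using IVT'[of \<phi> p "\<eta> * of_int m" q] IVT2'[of \<phi> q "\<eta> * of_int m" p] assms(1,2) that by auto
qed

section \<open>Minimal covers and lattice counts\<close>

lemma covering_number_le:
  assumes "finite \<U>" "X \<subseteq> \<Union>\<U>" "\<And>U. U \<in> \<U> \<Longrightarrow> bounded U \<and> diameter U \<le> \<delta>"
  shows "covering_number \<delta> X \<le> card \<U>"
  unfolding covering_number_def using assms by (intro Least_le) blast

lemma covering_number_attained:
  assumes "finite \<U>" "X \<subseteq> \<Union>\<U>" "\<And>U. U \<in> \<U> \<Longrightarrow> bounded U \<and> diameter U \<le> \<delta>"
  obtains \<V> where "finite \<V>" "card \<V> = covering_number \<delta> X" "X \<subseteq> \<Union>\<V>"
    "\<And>V. V \<in> \<V> \<Longrightarrow> bounded V \<and> diameter V \<le> \<delta>"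
proof -
  have "\<exists>\<V>. finite \<V> \<and> card \<V> = covering_number \<delta> X \<and> X \<subseteq> \<Union>\<V> \<and> (\<forall>V\<in>\<V>. bounded V \<and> diameter V \<le> \<delta>)"
    unfolding covering_number_def by (rule LeastI[of _ "card \<U>"]) (use assms in blast)
  then show thesis using that by blast
qed

lemma card_ints_near:
  fixes P \<eta> N :: real
  assumes "0 \<le> N"
  shows "finite {m::int. \<bar>of_int m - P\<bar> \<le> N}" "real (card {m::int. \<bar>of_int m - P\<bar> \<le> N}) \<le> 2 * N + 1"
proof -
  have eq: "{m::int. \<bar>of_int m - P\<bar> \<le> N} = {\<lceil>P - N\<rceil>..\<lfloor>P + N\<rfloor>}"
    by (auto simp: ceiling_le_iff le_floor_iff abs_le_iff)
  show "finite {m::int. \<bar>of_int m - P\<bar> \<le> N}" unfolding eq by simp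
  show "real (card {m::int. \<bar>of_int m - P\<bar> \<le> N}) \<le> 2 * N + 1"
    unfolding eq using assms by simp linarith
qed

context dominated_system
begin

lemma d_div_K: "0 < d / K" "d / K \<le> 1"
  using d(1) d_less_1 K_ge_1 by auto

section \<open>Stopping words at a fixed scale\<close>

context
  fixes \<delta> :: real
  assumes \<delta>: "0 < \<delta>" "\<delta> \<le> 1"
begin

lemma stopping_finite: "finite (stopping B \<delta>)"
proof -
  obtain n where n: "\<And>w. n \<le> length w \<Longrightarrow> A w \<le> \<delta>" using A_small[OF \<delta>(1)] by blast
  show ?thesis using n B_le_A by (intro finite_stopping[of n]) (meson order_refl order_trans)
qed

lemma F_stopping:
  assumes "z \<in> F"
  obtains w y where "w \<in> stopping B \<delta>" "y \<in> F" "z = word_map S w y"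
proof -
  obtain n where n: "\<And>w. n \<le> length w \<Longrightarrow> A w \<le> \<delta>" using A_small[OF \<delta>(1)] by blast
  have nB: "B w \<le> \<delta>" if "length w = n" for w using n[of w] that B_le_A[of w] by linarith
  show thesis
    by (rule attractor_stopping[where B = B and \<delta> = \<delta>, OF F_eq assms nB]) (assumption, rule that)
qed

context
  fixes w assumes w: "w \<in> stopping B \<delta>"
begin

lemma B_stop: "d / K * \<delta> \<le> B w" "B w \<le> \<delta>"
proof -
  show "d / K * \<delta> \<le> B w"
    by (rule stopping_lower[OF w _ _ _ _ B_snoc]) (use \<delta> d_div_K in auto)
  show "B w \<le> \<delta>" using w by (simp add: stopping_def)
qed

lemma A_stop: "d / K * \<delta> \<le> A w" "A w \<le> 2 * K"
proof -
  show "d / K * \<delta> \<le> A w" using B_stop(1) B_le_A by (rule order_trans)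
  have "2 * K * \<rho> ^ length w \<le> 2 * K * 1"
    using K_ge_1 \<rho> by (intro mult_left_mono) (auto simp: power_le_one)
  then show "A w \<le> 2 * K" using A_le[of w] by linarith
qed

text \<open>Strips are at least about as long as they are high, since \<open>B w \<le> A w\<close>;
  hence the ratio stays bounded. This fixes the range of radii for which the packing estimate is
  requested.\<close>

lemma ratio_stop: "0 < \<delta> / A w" "\<delta> / A w \<le> K / d"
proof -
  show "0 < \<delta> / A w" using A_pos \<delta> by simp
  have "d * \<delta> \<le> K * A w" using A_stop(1) K_ge_1 by (simp add: field_simps)
  then show "\<delta> / A w \<le> K / d" using A_pos[of w] d(1) by (simp add: field_simps)
qed

lemma B_stop_powr:
  "B w powr t \<le> (K / d) powr \<bar>t\<bar> * \<delta> powr t" "\<delta> powr t \<le> (K / d) powr \<bar>t\<bar> * B w powr t"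
proof -
  have k: "1 \<le> K / d" using d_div_K d(1) K_ge_1 by (simp add: field_simps)
  have 1: "\<delta> \<le> K / d * B w" using B_stop(1) K_ge_1 d(1) by (simp add: field_simps)
  have 2: "B w \<le> K / d * \<delta>" using B_stop(2) k \<delta> mult_right_mono[OF k, of \<delta>] by simp
  show "B w powr t \<le> (K / d) powr \<bar>t\<bar> * \<delta> powr t" "\<delta> powr t \<le> (K / d) powr \<bar>t\<bar> * B w powr t"
    by (intro powr_comparable B_pos \<delta> 1 2 k)+
qed

text \<open>The left side factors as
  \<open>A w powr \<epsilon> * \<delta> powr (s - \<beta>)\<close> times
  \<open>A w powr \<beta> * \<delta> powr - (s + \<epsilon>)\<close>. The first factor is bounded
  because \<open>A w \<le> 2 * K\<close>, and in the second \<delta> may be replaced by the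
  comparable \<open>B w\<close>, which produces the weight.\<close>

lemma ratio_powr_le:
  assumes "0 < \<epsilon>"
  shows "(\<delta> / A w) powr - (\<beta> + \<epsilon>) \<le>
    ((2 * K) powr \<epsilon> * (K / d) powr \<bar>s - \<beta>\<bar> * \<delta> powr - (s + \<epsilon>)) * weight \<beta> s w"
proof -
  have "(\<delta> / A w) powr - (\<beta> + \<epsilon>) = A w powr (\<beta> + \<epsilon>) * \<delta> powr - (\<beta> + \<epsilon>)"
  proof -
    have "(\<delta> / A w) powr - (\<beta> + \<epsilon>) = \<delta> powr - (\<beta> + \<epsilon>) / A w powr - (\<beta> + \<epsilon>)"
      by (rule powr_divide)
    moreover have "A w powr - (\<beta> + \<epsilon>) = 1 / A w powr (\<beta> + \<epsilon>)" by (rule powr_minus_divide)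
    ultimately show ?thesis by simp
  qed
  also have "\<dots> = A w powr \<epsilon> * \<delta> powr (s - \<beta>) * (A w powr \<beta> * \<delta> powr - (s + \<epsilon>))"
    using \<delta> A_pos[of w] by (simp add: powr_add[symmetric] mult_ac)
  also have "\<dots> \<le> (2 * K) powr \<epsilon> * ((K / d) powr \<bar>s - \<beta>\<bar> * B w powr (s - \<beta>)) * (A w powr \<beta> * \<delta> powr - (s + \<epsilon>))"
    using A_stop(2) A_pos[of w] assms K_ge_1 B_stop_powr
    by (intro mult_right_mono mult_mono powr_mono2) auto
  finally show ?thesis by (simp add: weight_def mult_ac)
qed

text \<open>The same factorisation read backwards, with the loss \<epsilon> of opposite sign. The
  factor \<open>t\<close> leaves room for the enlarged packing radius of the lower bound.\<close>

lemma ratio_powr_ge: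
  assumes "0 < \<epsilon>" "0 < t"
  shows "weight \<beta> s w \<le>
    ((2 * K) powr \<epsilon> * (K / d) powr \<bar>s - \<beta>\<bar> * t powr (\<beta> - \<epsilon>) * \<delta> powr (s - \<epsilon>)) * (t * \<delta> / A w) powr - (\<beta> - \<epsilon>)"
proof -
  have "A w powr \<epsilon> * B w powr (s - \<beta>) \<le> (2 * K) powr \<epsilon> * ((K / d) powr \<bar>s - \<beta>\<bar> * \<delta> powr (s - \<beta>))"
    using A_stop(2) A_pos[of w] assms K_ge_1 B_stop_powr by (intro mult_mono powr_mono2) auto
  then have f1: "A w powr (\<beta> - \<epsilon>) * (A w powr \<epsilon> * B w powr (s - \<beta>)) \<le>
      A w powr (\<beta> - \<epsilon>) * ((2 * K) powr \<epsilon> * ((K / d) powr \<bar>s - \<beta>\<bar> * \<delta> powr (s - \<beta>)))"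
    by (intro mult_left_mono) auto
  have w1: "weight \<beta> s w = A w powr (\<beta> - \<epsilon>) * (A w powr \<epsilon> * B w powr (s - \<beta>))"
    using A_pos[of w] by (simp add: weight_def mult.assoc[symmetric] powr_add[symmetric])
  have dl: "\<delta> powr (s - \<beta>) = \<delta> powr (s - \<epsilon>) * \<delta> powr - (\<beta> - \<epsilon>)"
    by (simp add: powr_add[symmetric])
  have tq: "(t * \<delta> / A w) powr - (\<beta> - \<epsilon>) = t powr - (\<beta> - \<epsilon>) * \<delta> powr - (\<beta> - \<epsilon>) * A w powr (\<beta> - \<epsilon>)"
  proof -
    have "(t * \<delta> / A w) powr - (\<beta> - \<epsilon>) = (t * \<delta>) powr - (\<beta> - \<epsilon>) / A w powr - (\<beta> - \<epsilon>)"
      by (rule powr_divide)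
    moreover have "A w powr - (\<beta> - \<epsilon>) = 1 / A w powr (\<beta> - \<epsilon>)" by (rule powr_minus_divide)
    ultimately show ?thesis using \<delta> assms by (simp add: powr_mult)
  qed
  have lr: "((2 * K) powr \<epsilon> * (K / d) powr \<bar>s - \<beta>\<bar> * t powr (\<beta> - \<epsilon>) * \<delta> powr (s - \<epsilon>)) *
      (t powr - (\<beta> - \<epsilon>) * \<delta> powr - (\<beta> - \<epsilon>) * A w powr (\<beta> - \<epsilon>)) =
      A w powr (\<beta> - \<epsilon>) * ((2 * K) powr \<epsilon> * ((K / d) powr \<bar>s - \<beta>\<bar> * (\<delta> powr (s - \<epsilon>) * \<delta> powr - (\<beta> - \<epsilon>))))"
    (is "?l = ?r")
  proof -
    have tt: "t powr (\<beta> - \<epsilon>) * t powr - (\<beta> - \<epsilon>) = 1"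
      using assms by (simp add: powr_add[symmetric])
    have "?l = (t powr (\<beta> - \<epsilon>) * t powr - (\<beta> - \<epsilon>)) * ?r" by (simp only: mult_ac)
    then show ?thesis by (simp only: tt mult_1_left)
  qed
  show ?thesis unfolding w1 tq lr dl[symmetric] by (rule f1)
qed

end

text \<open>Vertical columns of \<open>F\<close> with half-width \<open>\<delta> / A w\<close> are
  mapped by \<open>word_map S w\<close>. Horizontally the image extends at most
  \<open>2 * K * \<delta>\<close>. Vertically the shear is also governed by \<open>A w\<close>, so
  it adds \<open>2 * K * \<delta>\<close> to the height \<open>K * \<delta>\<close> coming from
  \<open>B w\<close>. The total is \<open>5 * K * \<delta>\<close>.\<close>

lemma cover_F:
  "\<exists>\<U>. finite \<U> \<and> card \<U> \<le> (\<Sum>w\<in>stopping B \<delta>. packing_number E (\<delta> / A w)) \<and> F \<subseteq> \<Union>\<U> \<and>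
     (\<forall>U\<in>\<U>. bounded U \<and> diameter U \<le> 5 * K * \<delta>)"
proof -
  have "\<forall>w\<in>stopping B \<delta>. \<exists>X. finite X \<and> card X = packing_number E (\<delta> / A w) \<and>
      (\<forall>e\<in>E. \<exists>x\<in>X. \<bar>e - x\<bar> \<le> \<delta> / A w)"
    using packing_obtain[OF E_subset ratio_stop(1)] by metis
  from bchoice[OF this] obtain X where X: "\<And>w. w \<in> stopping B \<delta> \<Longrightarrow> finite (X w)"
    "\<And>w. w \<in> stopping B \<delta> \<Longrightarrow> card (X w) = packing_number E (\<delta> / A w)"
    "\<And>w e. w \<in> stopping B \<delta> \<Longrightarrow> e \<in> E \<Longrightarrow> \<exists>x\<in>X w. \<bar>e - x\<bar> \<le> \<delta> / A w" by blast
  define U where "U = (\<lambda>(w, x). word_map S w ` {z \<in> F. \<bar>z $ 1 - x\<bar> \<le> \<delta> / A w})"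
  define \<U> where "\<U> = U ` (SIGMA w:stopping B \<delta>. X w)"
  have fin: "finite (SIGMA w:stopping B \<delta>. X w)" using stopping_finite X(1) by auto
  have "card \<U> \<le> card (SIGMA w:stopping B \<delta>. X w)" unfolding \<U>_def using fin by (rule card_image_le)
  also have "\<dots> = (\<Sum>w\<in>stopping B \<delta>. packing_number E (\<delta> / A w))"
    using stopping_finite X by (subst card_SigmaI) auto
  finally have card: "card \<U> \<le> (\<Sum>w\<in>stopping B \<delta>. packing_number E (\<delta> / A w))" .
  have cover: "F \<subseteq> \<Union>\<U>"
  proof
    fix z assume "z \<in> F"
    then obtain w y where w: "w \<in> stopping B \<delta>" "y \<in> F" "z = word_map S w y" by (rule F_stopping)
    then obtain x where "x \<in> X w" "\<bar>y $ 1 - x\<bar> \<le> \<delta> / A w" using X(3)[OF w(1), of "y $ 1"] by (auto simp: E_def)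
    then show "z \<in> \<Union>\<U>" unfolding \<U>_def U_def using w by force
  qed
  have small: "bounded V \<and> diameter V \<le> 5 * K * \<delta>" if V: "V \<in> \<U>" for V
  proof -
    obtain w x where wx: "w \<in> stopping B \<delta>" "x \<in> X w" "V = U (w, x)" using V unfolding \<U>_def by auto
    have "V \<subseteq> F" unfolding wx(3) U_def using word_map_attractor[OF F_eq] by auto
    then have "bounded V" using F_compact bounded_subset compact_imp_bounded by blast
    moreover have "diameter V \<le> 5 * K * \<delta>"
    proof (rule diameter_le)
      fix u v assume "u \<in> V" "v \<in> V"
      then obtain y z where yz: "u = word_map S w y" "v = word_map S w z" "y \<in> unit_square" "z \<in> unit_square"
        "\<bar>y $ 1 - x\<bar> \<le> \<delta> / A w" "\<bar>z $ 1 - x\<bar> \<le> \<delta> / A w"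
        unfolding wx(3) U_def using F_subset by auto
      have "\<bar>y $ 1 - z $ 1\<bar> \<le> 2 * (\<delta> / A w)" using yz(5,6) by linarith
      then have "A w * \<bar>y $ 1 - z $ 1\<bar> \<le> A w * (2 * (\<delta> / A w))" using A_pos[of w] by (intro mult_left_mono) auto
      then have a: "A w * \<bar>y $ 1 - z $ 1\<bar> \<le> 2 * \<delta>" using A_pos[of w] by simp
      have "B w * \<bar>y $ 2 - z $ 2\<bar> \<le> \<delta> * 1"
        using B_stop(2)[OF wx(1)] B_pos[of w] yz(3,4) \<delta> by (intro mult_mono) (auto simp: mem_unit_square)
      then have b: "A w * \<bar>y $ 1 - z $ 1\<bar> + B w * \<bar>y $ 2 - z $ 2\<bar> \<le> 3 * \<delta>" using a by linarith
      have K0: "0 \<le> K" using K_ge_1 by simp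
      have "\<bar>u $ 1 - v $ 1\<bar> \<le> K * (2 * \<delta>)"
        using word_fst_le[OF yz(4,3), of w] mult_left_mono[OF a K0] unfolding yz(1,2) mult.assoc by linarith
      moreover have "\<bar>u $ 2 - v $ 2\<bar> \<le> K * (3 * \<delta>)"
        using word_snd_le[OF yz(4,3), of w] mult_left_mono[OF b K0] unfolding yz(1,2) by linarith
      ultimately show "norm (u - v) \<le> 5 * K * \<delta>"
        using dist_le_components[of u v] by (simp add: dist_norm)
    qed (use \<delta> K_ge_1 in auto)
    ultimately show ?thesis by blast
  qed
  show ?thesis using fin card cover small by (intro exI[of _ \<U>]) (auto simp: \<U>_def)
qed

text \<open>The triangular form allows the two coordinates to be adjusted one after the other:
  \<open>x\<close> is moved until the first image coordinate is on the lattice, and then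
  \<open>y\<close>, which leaves that coordinate fixed, until the second is. The column is so narrow
  that the image stays within \<open>2 * K * \<delta>\<close> of that of \<open>z\<close>.\<close>

lemma grid_point:
  assumes w: "w \<in> stopping B \<delta>" and z: "z \<in> unit_square"
  defines "\<eta> \<equiv> d / (8 * K\<^sup>2) * \<delta>"
  shows "\<exists>m n. \<exists>y\<in>box 0 1. word_map S w y = vector [\<eta> * of_int m, \<eta> * of_int n] \<and>
    \<bar>\<eta> * of_int m - word_map S w z $ 1\<bar> \<le> 2 * K * \<delta> \<and> \<bar>\<eta> * of_int n - word_map S w z $ 2\<bar> \<le> 2 * K * \<delta>"
proof -
  have \<eta>: "0 < \<eta>" unfolding \<eta>_def using d(1) K_ge_1 \<delta> by simp
  \<comment> \<open>The cap at 1 matters when \<open>A w < \<delta>\<close>; then the full width of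
    the square is used, and \<open>A w * h\<close> is still at least
    \<open>d / K * \<delta>\<close>.\<close>
  define h where "h = min 1 (\<delta> / A w)"
  have h: "0 < h" "h \<le> 1" using ratio_stop(1)[OF w] by (auto simp: h_def)
  have Ah: "A w * h \<le> \<delta>" "d / K * \<delta> \<le> A w * h"
  proof -
    have "A w * h \<le> A w * (\<delta> / A w)" using A_pos[of w] by (intro mult_left_mono) (auto simp: h_def)
    then show "A w * h \<le> \<delta>" using A_pos[of w] by simp
    have "d / K * \<delta> \<le> 1 * \<delta>" using d_div_K \<delta> by (intro mult_right_mono) auto
    moreover have "A w * h = min (A w) \<delta>" using A_pos[of w] by (auto simp: h_def min_def field_simps)
    ultimately show "d / K * \<delta> \<le> A w * h" using A_stop(1)[OF w] by simp
  qed
  \<comment> \<open>The interval \<open>[p, q]\<close> of length \<open>h / 8\<close> lies on the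
    side of \<open>z $ 1\<close> where there is room, strictly inside \<open>(0, 1)\<close> even if
    \<open>z\<close> is on the boundary.\<close>
  define p where "p = (if z $ 1 \<le> 1 / 2 then z $ 1 + h / 8 else z $ 1 - h / 4)"
  define q where "q = p + h / 8"
  have pq: "0 < p" "q < 1" "p \<le> q" "\<And>x. x \<in> {p..q} \<Longrightarrow> \<bar>x - z $ 1\<bar> \<le> h"
    using h z by (auto simp: p_def q_def mem_unit_square abs_le_iff split: if_splits)
  define e where "e x y = (vector [x, y] :: real^2)" for x y :: real
  have e_in: "e x y \<in> unit_square" if "x \<in> {0..1}" "y \<in> {0..1}" for x y
    using that by (auto simp: e_def mem_unit_square)
  have e_cont: "continuous_on X (\<lambda>x. e (f x) (g x))" if "continuous_on X f" "continuous_on X g"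
    for X :: "real set" and f g
  proof -
    have "(\<lambda>x. e (f x) (g x)) = (\<lambda>x. \<chi> i. if i = 1 then f x else g x)"
      by (auto simp: fun_eq_iff e_def vec_eq_iff forall_2)
    moreover have "continuous_on X (\<lambda>x. \<chi> i::2. if i = 1 then f x else g x)"
    proof (rule continuous_on_vec_lambda)
      show "continuous_on X (\<lambda>x. if i = 1 then f x else g x)" for i :: 2
        using that by (cases "i = 1") auto
    qed
    ultimately show ?thesis by (simp only:)
  qed
  have \<eta>1: "\<eta> \<le> \<bar>word_map S w (e q (1/2)) $ 1 - word_map S w (e p (1/2)) $ 1\<bar>"
  proof -
    \<comment> \<open>This is the origin of \<eta>: the least value of \<open>A w * h\<close>, times
      \<open>1 / 8\<close> for the length of \<open>[p, q]\<close>, times \<open>1 / K\<close> for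
      the distortion.\<close>
    have "\<eta> = (d / K * \<delta>) / (8 * K)" by (simp add: \<eta>_def power2_eq_square)
    also have "\<dots> \<le> (A w * h) / (8 * K)" using Ah(2) K_ge_1 by (intro divide_right_mono) auto
    also have "\<dots> = A w / K * \<bar>q - p\<bar>" using h by (simp add: q_def)
    also have "\<dots> \<le> \<bar>word_map S w (e q (1/2)) $ 1 - word_map S w (e p (1/2)) $ 1\<bar>"
      using word_fst_ge[of "e p (1/2)" "e q (1/2)" w] e_in pq by (simp add: e_def)
    finally show ?thesis .
  qed
  have c1: "continuous_on {p..q} (\<lambda>x. word_map S w (e x (1/2)) $ 1)"
    using pq by (intro continuous_on_component continuous_on_compose2[OF word_continuous e_cont] continuous_intros)
      (auto intro!: e_in)
  obtain x m where x: "x \<in> {p..q}" "word_map S w (e x (1/2)) $ 1 = \<eta> * of_int m"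
    using ivt_grid[OF pq(3) c1 \<eta> \<eta>1] by blast
  have x01: "0 < x" "x < 1" using x pq by auto
  \<comment> \<open>The segment is vertical, as \<open>word_snd_ge\<close> demands, and the heights
    between \<open>1/4\<close> and \<open>3/4\<close> keep the point in the open square.\<close>
  have \<eta>2: "\<eta> \<le> \<bar>word_map S w (e x (3/4)) $ 2 - word_map S w (e x (1/4)) $ 2\<bar>"
  proof -
    have "\<eta> = (d / K * \<delta>) / K * (1 / 8)" by (simp add: \<eta>_def power2_eq_square)
    also have "\<dots> \<le> B w / K * (1 / 2)"
      using B_stop[OF w] K_ge_1 B_pos[of w] by (intro mult_mono divide_right_mono) auto
    also have "\<dots> \<le> \<bar>word_map S w (e x (3/4)) $ 2 - word_map S w (e x (1/4)) $ 2\<bar>"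
      using word_snd_ge[of "e x (1/4)" "e x (3/4)" w] e_in x01 by (simp add: e_def)
    finally show ?thesis .
  qed
  have c2: "continuous_on {1/4..3/4} (\<lambda>y. word_map S w (e x y) $ 2)"
    using x01 by (intro continuous_on_component continuous_on_compose2[OF word_continuous e_cont] continuous_intros)
      (auto intro!: e_in)
  obtain y n where y: "y \<in> {1/4..3/4}" "word_map S w (e x y) $ 2 = \<eta> * of_int n"
    using ivt_grid[OF _ c2 \<eta> \<eta>2] by auto
  have box: "e x y \<in> box 0 1" using x01 y by (auto simp: e_def mem_unit_box)
  then have sq: "e x y \<in> unit_square" using box_subset_cbox by blast
  have m1: "word_map S w (e x y) $ 1 = \<eta> * of_int m"
    using word_fst_cong[OF sq, of "e x (1/2)" w] x e_in x01 by (simp add: e_def)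
  have eq: "word_map S w (e x y) = vector [\<eta> * of_int m, \<eta> * of_int n]"
    using m1 y(2) by (simp add: vec_eq_iff forall_2)
  have "A w * \<bar>x - z $ 1\<bar> \<le> A w * h" using pq(4)[OF x(1)] A_pos[of w] by (intro mult_left_mono) auto
  then have a: "A w * \<bar>x - z $ 1\<bar> \<le> \<delta>" using Ah(1) by linarith
  have "B w * \<bar>y - z $ 2\<bar> \<le> \<delta> * 1"
    using B_stop(2)[OF w] B_pos[of w] y z \<delta> by (intro mult_mono) (auto simp: mem_unit_square)
  then have b: "A w * \<bar>x - z $ 1\<bar> + B w * \<bar>y - z $ 2\<bar> \<le> 2 * \<delta>" using a by linarith
  have "\<bar>\<eta> * of_int m - word_map S w z $ 1\<bar> \<le> K * (A w * \<bar>x - z $ 1\<bar>)"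
    using word_fst_le[OF z sq, of w] m1 by (simp add: e_def mult.assoc)
  also have "\<dots> \<le> K * (2 * \<delta>)" using a K_ge_1 \<delta> by (intro mult_left_mono) auto
  finally have 1: "\<bar>\<eta> * of_int m - word_map S w z $ 1\<bar> \<le> 2 * K * \<delta>" by simp
  have "\<bar>\<eta> * of_int n - word_map S w z $ 2\<bar> \<le> K * (A w * \<bar>x - z $ 1\<bar> + B w * \<bar>y - z $ 2\<bar>)"
    using word_snd_le[OF z sq, of w] y(2) by (simp add: e_def)
  also have "\<dots> \<le> K * (2 * \<delta>)" using b K_ge_1 by (intro mult_left_mono) auto
  finally have 2: "\<bar>\<eta> * of_int n - word_map S w z $ 2\<bar> \<le> 2 * K * \<delta>" by simp
  show ?thesis using box eq 1 2 by blast
qed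

end

text \<open>The common prefix \<open>t\<close> is cancelled by injectivity of
  \<open>word_map S t\<close>. What remains are images of the open square under \<open>S i\<close>
  and \<open>S j\<close> with different first letters, which are disjoint.\<close>

lemma rosc_disjoint:
  assumes "rosc S" "u \<in> stopping B \<delta>" "v \<in> stopping B \<delta>" "x \<in> box 0 1" "y \<in> box 0 1"
    "word_map S u x = word_map S v y"
  shows "u = v"
proof (rule ccontr)
  assume "u \<noteq> v"
  then obtain t i j u' v' where t: "i \<noteq> j" "u = t @ i # u'" "v = t @ j # v'"
    using stopping_decomp[OF assms(2,3)] by metis
  have box: "word_map S w' z \<in> box 0 1" if "z \<in> box 0 1" for w' z
    using word_map_in[of S "box 0 1" z w'] assms(1) that by (auto simp: rosc_def)
  have sub: "box 0 1 \<subseteq> unit_square" by (rule box_subset_cbox)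
  have "S i (word_map S u' x) \<in> S i ` box 0 1" "S j (word_map S v' y) \<in> S j ` box 0 1"
    using box assms(4,5) by auto
  moreover have "S i (word_map S u' x) = S j (word_map S v' y)"
  proof (rule inj_onD[OF word_inj[of t]])
    show "word_map S t (S i (word_map S u' x)) = word_map S t (S j (word_map S v' y))"
      using assms(6) t by simp
    show "S i (word_map S u' x) \<in> unit_square" "S j (word_map S v' y) \<in> unit_square"
      using word_in[of x "i # u'"] word_in[of y "j # v'"] assms(4,5) sub by auto
  qed
  moreover have "S i ` box 0 1 \<inter> S j ` box 0 1 = {}" using assms(1) t(1) by (simp add: rosc_def)
  ultimately show False by (metis disjoint_iff)
qed

text \<open>Pairs of a stopping word \<open>w\<close> and a separated point \<open>x\<close> whose
  image lies in a fixed \<open>U\<close> are sent injectively to lattice points near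
  \<open>U\<close>. The lattice point determines \<open>w\<close>, because it lies in the interior
  of only one strip; for given \<open>w\<close> the images of different \<open>x\<close> are too far
  apart to share \<open>U\<close>.\<close>

lemma covering_lower:
  assumes rosc: "rosc S" and \<delta>: "0 < \<delta>" "\<delta> \<le> 1" and \<U>: "finite \<U>" "F \<subseteq> \<Union>\<U>"
    "\<And>U. U \<in> \<U> \<Longrightarrow> bounded U \<and> diameter U \<le> \<delta>"
  shows "(\<Sum>w\<in>stopping B \<delta>. packing_number E (2 * K * \<delta> / A w)) \<le> (2 * (24 * K ^ 3 / d) + 1)\<^sup>2 * card \<U>"
proof -
  define \<eta> where "\<eta> = d / (8 * K\<^sup>2) * \<delta>"
  have \<eta>: "0 < \<eta>" unfolding \<eta>_def using d(1) K_ge_1 \<delta> by simp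
  \<comment> \<open>\<open>N\<close> is \<open>3 * K * \<delta>\<close> in units of \<eta>: a
    lattice point is within \<open>2 * K * \<delta>\<close> of its image point, and that point is
    within \<open>\<delta> \<le> K * \<delta>\<close> of the reference point in
    \<open>U\<close>.\<close>
  define N where "N = 24 * K ^ 3 / d"
  have N: "0 \<le> N" unfolding N_def using d(1) K_ge_1 by simp
  have N\<eta>: "3 * K * \<delta> = N * \<eta>" unfolding N_def \<eta>_def
    using d(1) K_ge_1 by (simp add: power3_eq_cube power2_eq_square)
  have rpos: "0 < 2 * K * \<delta> / A w" for w using K_ge_1 \<delta> A_pos[of w] by simp
  have "\<forall>w\<in>stopping B \<delta>. \<exists>X. finite X \<and> card X = packing_number E (2 * K * \<delta> / A w) \<and>
      X \<subseteq> E \<and> separated (2 * K * \<delta> / A w) X"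
    using packing_exists_max[OF E_subset rpos] by blast
  from bchoice[OF this] obtain X where X: "\<And>w. w \<in> stopping B \<delta> \<Longrightarrow> finite (X w)"
    "\<And>w. w \<in> stopping B \<delta> \<Longrightarrow> card (X w) = packing_number E (2 * K * \<delta> / A w)"
    "\<And>w. w \<in> stopping B \<delta> \<Longrightarrow> X w \<subseteq> E"
    "\<And>w. w \<in> stopping B \<delta> \<Longrightarrow> separated (2 * K * \<delta> / A w) (X w)" by blast
  have "\<forall>x\<in>E. \<exists>z. z \<in> F \<and> z $ 1 = x" by (auto simp: E_def)
  from bchoice[OF this] obtain \<zeta> where \<zeta>: "\<And>x. x \<in> E \<Longrightarrow> \<zeta> x \<in> F" "\<And>x. x \<in> E \<Longrightarrow> \<zeta> x $ 1 = x" by blast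
  define I where "I = (SIGMA w:stopping B \<delta>. X w)"
  define \<Phi> where "\<Phi> = (\<lambda>(w, x). word_map S w (\<zeta> x))"
  have finI: "finite I" unfolding I_def using stopping_finite[OF \<delta>] X(1) by auto
  have cardI: "card I = (\<Sum>w\<in>stopping B \<delta>. packing_number E (2 * K * \<delta> / A w))"
    unfolding I_def using stopping_finite[OF \<delta>] X by (subst card_SigmaI) auto
  have \<zeta>sq: "\<zeta> x \<in> unit_square" if "w \<in> stopping B \<delta>" "x \<in> X w" for w x
    using \<zeta>(1) X(3) that F_subset by blast
  have "\<forall>q\<in>I. \<exists>c. \<exists>y\<in>box 0 1. word_map S (fst q) y = vector [\<eta> * of_int (fst c), \<eta> * of_int (snd c)] \<and>
      \<bar>\<eta> * of_int (fst c) - \<Phi> q $ 1\<bar> \<le> 2 * K * \<delta> \<and> \<bar>\<eta> * of_int (snd c) - \<Phi> q $ 2\<bar> \<le> 2 * K * \<delta>"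
  proof
    fix q assume "q \<in> I"
    then obtain w x where q: "q = (w, x)" "w \<in> stopping B \<delta>" "x \<in> X w" unfolding I_def by auto
    obtain m n where mn: "\<exists>y\<in>box 0 1. word_map S w y = vector [\<eta> * of_int m, \<eta> * of_int n] \<and>
      \<bar>\<eta> * of_int m - word_map S w (\<zeta> x) $ 1\<bar> \<le> 2 * K * \<delta> \<and> \<bar>\<eta> * of_int n - word_map S w (\<zeta> x) $ 2\<bar> \<le> 2 * K * \<delta>"
      using grid_point[OF \<delta> q(2) \<zeta>sq[OF q(2,3)], folded \<eta>_def] by blast
    then show "\<exists>c. \<exists>y\<in>box 0 1. word_map S (fst q) y = vector [\<eta> * of_int (fst c), \<eta> * of_int (snd c)] \<and>
      \<bar>\<eta> * of_int (fst c) - \<Phi> q $ 1\<bar> \<le> 2 * K * \<delta> \<and> \<bar>\<eta> * of_int (snd c) - \<Phi> q $ 2\<bar> \<le> 2 * K * \<delta>"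
      by (intro exI[of _ "(m, n)"]) (simp add: q(1) \<Phi>_def)
  qed
  from bchoice[OF this] obtain c where c:
    "\<And>q. q \<in> I \<Longrightarrow> \<exists>y\<in>box 0 1. word_map S (fst q) y = vector [\<eta> * of_int (fst (c q)), \<eta> * of_int (snd (c q))]"
    "\<And>q. q \<in> I \<Longrightarrow> \<bar>\<eta> * of_int (fst (c q)) - \<Phi> q $ 1\<bar> \<le> 2 * K * \<delta>"
    "\<And>q. q \<in> I \<Longrightarrow> \<bar>\<eta> * of_int (snd (c q)) - \<Phi> q $ 2\<bar> \<le> 2 * K * \<delta>" by blast
  have few: "real (card {q \<in> I. \<Phi> q \<in> U}) \<le> (2 * N + 1)\<^sup>2" if U: "U \<in> \<U>" for U
  proof (cases "{q \<in> I. \<Phi> q \<in> U} = {}")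
    case True
    then show ?thesis by (simp only:) simp
  next
    case False
    then obtain q0 where q0: "q0 \<in> I" "\<Phi> q0 \<in> U" by blast
    have diam: "dist u v \<le> \<delta>" if "u \<in> U" "v \<in> U" for u v
      using diameter_bounded_bound[of U u v] \<U>(3)[OF U] that by (meson order_trans)
    define R where "R i = {m::int. \<bar>of_int m - \<Phi> q0 $ i / \<eta>\<bar> \<le> N}" for i
    have near: "\<bar>real_of_int m - \<Phi> q0 $ i / \<eta>\<bar> \<le> N"
      if "\<bar>\<eta> * of_int m - \<Phi> q $ i\<bar> \<le> 2 * K * \<delta>" "\<Phi> q \<in> U" for m q i
    proof -
      have "\<bar>\<Phi> q $ i - \<Phi> q0 $ i\<bar> \<le> \<delta>" using component_le_dist diam[OF that(2) q0(2)] by (rule order_trans)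
      moreover have "\<delta> \<le> K * \<delta>" using K_ge_1 \<delta> by simp
      ultimately have "\<bar>\<eta> * of_int m - \<Phi> q0 $ i\<bar> \<le> N * \<eta>" using that(1) N\<eta> by linarith
      moreover have "\<bar>real_of_int m - \<Phi> q0 $ i / \<eta>\<bar> = \<bar>\<eta> * of_int m - \<Phi> q0 $ i\<bar> / \<eta>"
      proof -
        have "of_int m - \<Phi> q0 $ i / \<eta> = (\<eta> * of_int m - \<Phi> q0 $ i) / \<eta>" using \<eta> by (simp add: field_simps)
        then show ?thesis using \<eta> by (simp add: abs_divide)
      qed
      ultimately show ?thesis using \<eta> by (simp add: divide_le_eq)
    qed
    have "c ` {q \<in> I. \<Phi> q \<in> U} \<subseteq> R 1 \<times> R 2"
    proof
      fix x assume "x \<in> c ` {q \<in> I. \<Phi> q \<in> U}"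
      then obtain q where q: "q \<in> I" "\<Phi> q \<in> U" "x = c q" by blast
      show "x \<in> R 1 \<times> R 2"
        using near[OF c(2)[OF q(1)] q(2)] near[OF c(3)[OF q(1)] q(2)] unfolding R_def q(3)
        by (simp add: mem_Times_iff)
    qed
    moreover have "inj_on c {q \<in> I. \<Phi> q \<in> U}"
    proof (rule inj_onI)
      fix q q' assume qq: "q \<in> {q \<in> I. \<Phi> q \<in> U}" "q' \<in> {q \<in> I. \<Phi> q \<in> U}" "c q = c q'"
      obtain w x w' x' where q: "q = (w, x)" "q' = (w', x')" by (metis surj_pair)
      have w: "w \<in> stopping B \<delta>" "w' \<in> stopping B \<delta>" "x \<in> X w" "x' \<in> X w'" using qq q by (auto simp: I_def)
      have "w = w'"
      proof -
        obtain y where y: "y \<in> box 0 1" "word_map S w y = vector [\<eta> * of_int (fst (c q)), \<eta> * of_int (snd (c q))]"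
          using c(1)[of q] qq(1) q by auto
        obtain y' where y': "y' \<in> box 0 1" "word_map S w' y' = vector [\<eta> * of_int (fst (c q')), \<eta> * of_int (snd (c q'))]"
          using c(1)[of q'] qq(2) q by auto
        show ?thesis using rosc_disjoint[OF rosc w(1,2) y(1) y'(1)] y(2) y'(2) qq(3) by simp
      qed
      moreover have "x = x'"
      proof (rule ccontr)
        assume "x \<noteq> x'"
        then have sep: "2 * K * \<delta> / A w < \<bar>x - x'\<bar>"
          using X(4)[OF w(1)] w(3,4) \<open>w = w'\<close> by (auto simp: separated_def dist_real_def)
        \<comment> \<open>The packing radius contains the factor \<open>2 * K\<close> so that, after
          the loss of \<open>1 / K\<close> in \<open>word_fst_ge\<close>, the images are still more
          than \<open>2 * \<delta>\<close> apart.\<close>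
        have "2 * \<delta> = A w / K * (2 * K * \<delta> / A w)" using A_pos[of w] K_ge_1 by simp
        also have "\<dots> < A w / K * \<bar>x - x'\<bar>" using sep A_pos[of w] K_ge_1 by (intro mult_strict_left_mono) auto
        also have "\<dots> \<le> \<bar>\<Phi> q $ 1 - \<Phi> q' $ 1\<bar>"
          using word_fst_ge[OF \<zeta>sq[OF w(2,4)] \<zeta>sq[OF w(1,3)], of w] \<zeta>(2) X(3)[OF w(1)] X(3)[OF w(2)] w(3,4) \<open>w = w'\<close>
          by (simp add: \<Phi>_def q subset_iff)
        also have "\<dots> \<le> dist (\<Phi> q) (\<Phi> q')" by (rule component_le_dist)
        also have "\<dots> \<le> \<delta>" using diam qq by auto
        finally show False using \<delta> by simp
      qed
      ultimately show "q = q'" by (simp add: q)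
    qed
    ultimately have "card {q \<in> I. \<Phi> q \<in> U} \<le> card (R 1 \<times> R 2)"
      using card_ints_near(1)[OF N] by (intro card_inj_on_le[of c]) (auto simp: R_def)
    then have "real (card {q \<in> I. \<Phi> q \<in> U}) \<le> real (card (R 1)) * real (card (R 2))"
      by (simp add: card_cartesian_product of_nat_mult[symmetric] del: of_nat_mult)
    also have "\<dots> \<le> (2 * N + 1) * (2 * N + 1)"
      unfolding R_def using card_ints_near(2)[OF N] N by (intro mult_mono) auto
    finally show ?thesis by (simp add: power2_eq_square)
  qed
  have "I \<subseteq> (\<Union>U\<in>\<U>. {q \<in> I. \<Phi> q \<in> U})"
  proof
    fix q assume q: "q \<in> I"
    then obtain w x where wx: "q = (w, x)" "w \<in> stopping B \<delta>" "x \<in> X w" unfolding I_def by auto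
    then have "\<Phi> q \<in> F"
      unfolding \<Phi>_def using word_map_attractor[OF F_eq \<zeta>(1)] X(3)[OF wx(2)] by auto
    then show "q \<in> (\<Union>U\<in>\<U>. {q \<in> I. \<Phi> q \<in> U})" using q \<U>(2) by blast
  qed
  then have "card I \<le> card (\<Union>U\<in>\<U>. {q \<in> I. \<Phi> q \<in> U})"
    using finI \<U>(1) by (intro card_mono) auto
  also have "\<dots> \<le> (\<Sum>U\<in>\<U>. card {q \<in> I. \<Phi> q \<in> U})" using \<U>(1) by (rule card_UN_le)
  finally have "real (card I) \<le> real (\<Sum>U\<in>\<U>. card {q \<in> I. \<Phi> q \<in> U})" by (simp only: of_nat_le_iff)
  also have "\<dots> = (\<Sum>U\<in>\<U>. real (card {q \<in> I. \<Phi> q \<in> U}))" by (rule of_nat_sum)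
  also have "\<dots> \<le> (\<Sum>U\<in>\<U>. (2 * N + 1)\<^sup>2)" by (intro sum_mono few)
  finally show ?thesis unfolding cardI N_def by (simp add: mult.commute)
qed

end

section \<open>Box dimension\<close>


context dominated_system
begin

text \<open>The packing estimate turns the sum of the packing numbers at
  \<open>\<delta> / A w\<close> into a power of \<delta> times the stopping sum of the weights,
  which is bounded on both sides at \<gamma>. Constants may depend on \<epsilon>.\<close>

lemma covering_estimates:
  fixes p :: "'i \<Rightarrow> real" and \<mu> :: "(real^2) measure"
  assumes \<mu>: "nonlinear_measure S p F \<mu>" and p: "\<And>i. 0 < p i" and \<epsilon>: "0 < \<epsilon>"
  defines "\<gamma> \<equiv> moment_scaling S p \<mu> a 0"
  shows "\<exists>C>0. \<forall>\<^sub>F r in at_right 0. 0 < real (covering_number r F) \<and>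
      real (covering_number r F) \<le> C * r powr - (\<gamma> + \<epsilon>)"
    and "rosc S \<Longrightarrow> \<exists>C>0. \<forall>\<^sub>F r in at_right 0. C * r powr - (\<gamma> - \<epsilon>) \<le> real (covering_number r F)"
proof -
  define \<beta> where "\<beta> = proj_spectrum \<mu> 0"
  have K: "0 < K" using K_ge_1 by simp
  have Kd: "1 \<le> K / d" using d_div_K d(1) K by (simp add: field_simps)
  obtain D where D: "D \<ge> 1" "\<And>\<delta>. 0 < \<delta> \<Longrightarrow> (\<Sum>w\<in>stopping B \<delta>. weight \<beta> \<gamma> w) \<le> D"
    "\<And>\<delta>. 0 < \<delta> \<Longrightarrow> 1 / D \<le> (\<Sum>w\<in>stopping B \<delta>. weight \<beta> \<gamma> w)"
    by (rule stopping_weights[of p \<mu>, OF p, folded \<beta>_def \<gamma>_def]) (rule that)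
  \<comment> \<open>The largest radius that occurs: the lower bound packs \<open>E\<close> at
    \<open>2 * K * \<delta> / A w\<close>, and \<open>\<delta> / A w \<le> K / d\<close>.\<close>
  have R: "1 \<le> 2 * K * (K / d)" using mult_mono[of 1 "2 * K" 1 "K / d"] Kd K_ge_1 by simp
  obtain C where C: "C \<ge> 1"
    "\<And>r. 0 < r \<Longrightarrow> r \<le> 2 * K * (K / d) \<Longrightarrow> r powr - (\<beta> - \<epsilon>) / C \<le> packing_number E r"
    "\<And>r. 0 < r \<Longrightarrow> r \<le> 2 * K * (K / d) \<Longrightarrow> packing_number E r \<le> C * r powr - (\<beta> + \<epsilon>)"
    by (rule proj_measure_power_law[OF \<mu> p \<epsilon> R, folded \<beta>_def]) (rule that)
  define c where "c = (2 * K) powr \<epsilon> * (K / d) powr \<bar>\<gamma> - \<beta>\<bar>"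
  have c: "0 < c" unfolding c_def using K d(1) by simp
  have Rle: "K / d \<le> 2 * K * (K / d)" using mult_right_mono[of 1 "2 * K" "K / d"] K_ge_1 Kd by simp
  have ev: "\<forall>\<^sub>F r in at_right 0. 0 < r \<and> r \<le> (1::real)"
    by (auto simp: eventually_at_right_field intro: exI[of _ 1])
  have cover: "\<exists>\<U>. finite \<U> \<and> real (card \<U>) \<le> (C * c * D) * \<delta> powr - (\<gamma> + \<epsilon>) \<and> F \<subseteq> \<Union>\<U> \<and>
     (\<forall>U\<in>\<U>. bounded U \<and> diameter U \<le> 5 * K * \<delta>)" if \<delta>: "0 < \<delta>" "\<delta> \<le> 1" for \<delta>
  proof -
    obtain \<U> where \<U>: "finite \<U>" "card \<U> \<le> (\<Sum>w\<in>stopping B \<delta>. packing_number E (\<delta> / A w))" "F \<subseteq> \<Union>\<U>"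
      "\<forall>U\<in>\<U>. bounded U \<and> diameter U \<le> 5 * K * \<delta>" using cover_F[OF \<delta>] by blast
    have "real (card \<U>) \<le> real (\<Sum>w\<in>stopping B \<delta>. packing_number E (\<delta> / A w))"
      using \<U>(2) by (simp only: of_nat_le_iff)
    also have "\<dots> = (\<Sum>w\<in>stopping B \<delta>. real (packing_number E (\<delta> / A w)))" by (rule of_nat_sum)
    also have "\<dots> \<le> (C * (c * \<delta> powr - (\<gamma> + \<epsilon>))) * (\<Sum>w\<in>stopping B \<delta>. weight \<beta> \<gamma> w)"
    proof (rule sum_comparable)
      fix w assume w: "w \<in> stopping B \<delta>"
      have "real (packing_number E (\<delta> / A w)) \<le> C * (\<delta> / A w) powr - (\<beta> + \<epsilon>)"
        using ratio_stop[OF \<delta> w] Rle by (intro C(3)) auto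
      also have "\<dots> \<le> C * ((c * \<delta> powr - (\<gamma> + \<epsilon>)) * weight \<beta> \<gamma> w)"
        using ratio_powr_le[OF \<delta> w \<epsilon>, of \<beta> \<gamma>, folded c_def] C(1) by (intro mult_left_mono) auto
      finally show "real (packing_number E (\<delta> / A w)) \<le> (C * (c * \<delta> powr - (\<gamma> + \<epsilon>))) * weight \<beta> \<gamma> w"
        by (simp only: mult.assoc)
    qed
    also have "\<dots> \<le> (C * (c * \<delta> powr - (\<gamma> + \<epsilon>))) * D"
      using D(2)[OF \<delta>(1)] C(1) c by (intro mult_left_mono) auto
    finally have "real (card \<U>) \<le> (C * c * D) * \<delta> powr - (\<gamma> + \<epsilon>)" by (simp only: mult_ac)
    then show ?thesis using \<U> by blast
  qed
  \<comment> \<open>The cover of \<open>cover_F\<close> is built at scale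
    \<open>r / (5 * K)\<close>, so that its pieces have diameter at most \<open>r\<close>.\<close>
  have scale: "0 < r / (5 * K)" "r / (5 * K) \<le> 1" "5 * K * (r / (5 * K)) = r" if "0 < r" "r \<le> 1" for r
    using that K_ge_1 by (auto simp: field_simps)
  have pos: "0 < real (covering_number r F)" if r: "0 < r" "r \<le> 1" for r
  proof -
    obtain \<U> where \<U>: "finite \<U>" "F \<subseteq> \<Union>\<U>" "\<forall>U\<in>\<U>. bounded U \<and> diameter U \<le> r"
      using cover[OF scale(1,2)[OF r]] unfolding scale(3)[OF r] by blast
    obtain \<V> where "finite \<V>" "card \<V> = covering_number r F" "F \<subseteq> \<Union>\<V>"
      by (rule covering_number_attained[OF \<U>(1,2)]) (use \<U>(3) in auto)
    then show ?thesis using F_nonempty by (metis Sup_empty card_gt_0_iff of_nat_0_less_iff subset_empty)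
  qed
  show "\<exists>C>0. \<forall>\<^sub>F r in at_right 0. 0 < real (covering_number r F) \<and>
      real (covering_number r F) \<le> C * r powr - (\<gamma> + \<epsilon>)"
  proof (intro exI[of _ "C * c * D / (5 * K) powr - (\<gamma> + \<epsilon>)"] conjI)
    show "0 < C * c * D / (5 * K) powr - (\<gamma> + \<epsilon>)" using C(1) c D(1) K by simp
    show "\<forall>\<^sub>F r in at_right 0. 0 < real (covering_number r F) \<and>
        real (covering_number r F) \<le> C * c * D / (5 * K) powr - (\<gamma> + \<epsilon>) * r powr - (\<gamma> + \<epsilon>)"
      using ev
    proof eventually_elim
      case (elim r)
      then have r: "0 < r" "r \<le> 1" by auto
      obtain \<U> where \<U>: "finite \<U>" "real (card \<U>) \<le> (C * c * D) * (r / (5 * K)) powr - (\<gamma> + \<epsilon>)" "F \<subseteq> \<Union>\<U>"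
        "\<forall>U\<in>\<U>. bounded U \<and> diameter U \<le> r"
        using cover[OF scale(1,2)[OF r]] unfolding scale(3)[OF r] by blast
      have "real (covering_number r F) \<le> real (card \<U>)"
        using covering_number_le[OF \<U>(1,3)] \<U>(4) by simp
      also have "\<dots> \<le> (C * c * D) * (r / (5 * K)) powr - (\<gamma> + \<epsilon>)" by (rule \<U>(2))
      also have "(r / (5 * K)) powr - (\<gamma> + \<epsilon>) = r powr - (\<gamma> + \<epsilon>) / (5 * K) powr - (\<gamma> + \<epsilon>)"
        by (rule powr_divide)
      finally show ?case using pos[OF r] by simp
    qed
  qed
  show "\<exists>C>0. \<forall>\<^sub>F r in at_right 0. C * r powr - (\<gamma> - \<epsilon>) \<le> real (covering_number r F)"
    if rosc: "rosc S"
  proof -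
    define N where "N = (2 * (24 * K ^ 3 / d) + 1)\<^sup>2"
    define t where "t = 2 * K"
    define c' where "c' = c * t powr (\<beta> - \<epsilon>)"
    have t: "0 < t" using K by (simp add: t_def)
    have c': "0 < c'" using c t by (simp add: c'_def)
    have N: "0 < N" unfolding N_def using K d(1) by (intro zero_less_power add_nonneg_pos) auto
    have main: "1 / (D * c' * C * N) * \<delta> powr - (\<gamma> - \<epsilon>) \<le> real (covering_number \<delta> F)"
      if \<delta>: "0 < \<delta>" "\<delta> \<le> 1" for \<delta>
    proof -
      obtain \<U> where \<U>: "finite \<U>" "F \<subseteq> \<Union>\<U>" "\<forall>U\<in>\<U>. bounded U \<and> diameter U \<le> \<delta>"
        using cover[OF scale(1,2)[OF \<delta>]] unfolding scale(3)[OF \<delta>] by blast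
      obtain \<V> where \<V>: "finite \<V>" "card \<V> = covering_number \<delta> F" "F \<subseteq> \<Union>\<V>"
        "\<And>V. V \<in> \<V> \<Longrightarrow> bounded V \<and> diameter V \<le> \<delta>"
        by (rule covering_number_attained[OF \<U>(1,2)]) (use \<U>(3) in auto)
      have "1 / D \<le> (\<Sum>w\<in>stopping B \<delta>. weight \<beta> \<gamma> w)" by (rule D(3)[OF \<delta>(1)])
      also have "\<dots> \<le> (c' * \<delta> powr (\<gamma> - \<epsilon>) * C) * (\<Sum>w\<in>stopping B \<delta>. real (packing_number E (t * \<delta> / A w)))"
      proof (rule sum_comparable)
        fix w assume w: "w \<in> stopping B \<delta>"
        have eq: "t * \<delta> / A w = t * (\<delta> / A w)" by simp
        have "weight \<beta> \<gamma> w \<le> (c' * \<delta> powr (\<gamma> - \<epsilon>)) * (t * \<delta> / A w) powr - (\<beta> - \<epsilon>)"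
          using ratio_powr_ge[OF \<delta> w \<epsilon> t, of \<beta> \<gamma>, folded c_def, folded c'_def] .
        also have "\<dots> \<le> (c' * \<delta> powr (\<gamma> - \<epsilon>)) * (C * real (packing_number E (t * \<delta> / A w)))"
        proof (rule mult_left_mono)
          have "t * (\<delta> / A w) \<le> t * (K / d)"
            using ratio_stop(2)[OF \<delta> w] t by (intro mult_left_mono) auto
          then have "t * \<delta> / A w \<le> 2 * K * (K / d)" by (simp add: t_def)
          moreover have "0 < t * \<delta> / A w" unfolding eq using t ratio_stop(1)[OF \<delta> w] by (rule mult_pos_pos)
          ultimately show "(t * \<delta> / A w) powr - (\<beta> - \<epsilon>) \<le> C * real (packing_number E (t * \<delta> / A w))"
            using C(2)[of "t * \<delta> / A w"] C(1) by (simp add: divide_le_eq mult.commute)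
        qed (use c' in simp)
        finally show "weight \<beta> \<gamma> w \<le> (c' * \<delta> powr (\<gamma> - \<epsilon>) * C) * real (packing_number E (t * \<delta> / A w))"
          by (simp only: mult.assoc)
      qed
      also have "(\<Sum>w\<in>stopping B \<delta>. real (packing_number E (t * \<delta> / A w))) \<le> N * real (card \<V>)"
        using covering_lower[OF rosc \<delta> \<V>(1,3,4)] by (simp add: t_def N_def)
      finally have "1 / D \<le> (c' * \<delta> powr (\<gamma> - \<epsilon>) * C) * (N * real (card \<V>))"
        using c' C(1) by (simp add: mult_left_mono)
      then have "1 \<le> (D * c' * C * N) * \<delta> powr (\<gamma> - \<epsilon>) * real (card \<V>)"
        using D(1) by (simp add: divide_le_eq mult_ac)
      then have "1 * \<delta> powr - (\<gamma> - \<epsilon>) \<le> (D * c' * C * N) * \<delta> powr (\<gamma> - \<epsilon>) * real (card \<V>) * \<delta> powr - (\<gamma> - \<epsilon>)"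
        by (intro mult_right_mono) auto
      also have "\<dots> = (D * c' * C * N) * real (card \<V>) * (\<delta> powr (\<gamma> - \<epsilon>) * \<delta> powr - (\<gamma> - \<epsilon>))"
        by (simp only: mult_ac)
      also have "\<delta> powr (\<gamma> - \<epsilon>) * \<delta> powr - (\<gamma> - \<epsilon>) = 1" using \<delta> by (simp add: powr_add[symmetric])
      finally have "\<delta> powr - (\<gamma> - \<epsilon>) \<le> (D * c' * C * N) * real (card \<V>)" by simp
      moreover have "0 < D * c' * C * N" using D(1) c' C(1) N by simp
      ultimately show ?thesis unfolding \<V>(2)[symmetric] by (simp add: divide_le_eq mult.commute)
    qed
    show ?thesis
    proof (intro exI[of _ "1 / (D * c' * C * N)"] conjI)
      show "0 < 1 / (D * c' * C * N)" using D(1) c' C(1) N by simp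
      show "\<forall>\<^sub>F r in at_right 0. 1 / (D * c' * C * N) * r powr - (\<gamma> - \<epsilon>) \<le> real (covering_number r F)"
        using ev by eventually_elim (use main in blast)
    qed
  qed
qed

lemma box_dimension:
  fixes p :: "'i \<Rightarrow> real" and \<mu> :: "(real^2) measure"
  assumes \<mu>: "nonlinear_measure S p F \<mu>" and p: "\<And>i. 0 < p i"
  shows "upper_box_dim F \<le> ereal (moment_scaling S p \<mu> a 0)"
    and "rosc S \<Longrightarrow> has_box_dim F (ereal (moment_scaling S p \<mu> a 0))"
proof -
  define \<gamma> where "\<gamma> = moment_scaling S p \<mu> a 0"
  define N where "N r = real (covering_number r F)" for r
  have up: "\<forall>\<^sub>F r in at_right 0. ln (N r) / (- ln r) < y" if "\<gamma> < y" for y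
    using covering_estimates(1)[OF \<mu> p] that unfolding N_def \<gamma>_def
    by (rule eventually_log_ratio_less)
  show "upper_box_dim F \<le> ereal (moment_scaling S p \<mu> a 0)"
    unfolding upper_box_dim_def \<gamma>_def[symmetric] N_def[symmetric] Limsup_le_iff
  proof (intro allI impI)
    fix y assume y: "ereal \<gamma> < y"
    show "\<forall>\<^sub>F r in at_right 0. ereal (ln (N r) / (- ln r)) < y"
      using y up by (cases y) auto
  qed
  show "has_box_dim F (ereal (moment_scaling S p \<mu> a 0))" if rosc: "rosc S"
  proof -
    have lo: "\<forall>\<^sub>F r in at_right 0. y < ln (N r) / (- ln r)" if "y < \<gamma>" for y
      using covering_estimates(2)[OF \<mu> p _ rosc] that unfolding N_def \<gamma>_def
      by (rule eventually_log_ratio_greater)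
    have "((\<lambda>r. ln (N r) / (- ln r)) \<longlongrightarrow> \<gamma>) (at_right 0)"
      using up lo by (intro order_tendstoI)
    then have lim: "((\<lambda>r. ereal (ln (N r) / (- ln r))) \<longlongrightarrow> ereal \<gamma>) (at_right 0)"
      by (rule tendsto_ereal)
    then show ?thesis
      unfolding has_box_dim_def upper_box_dim_def lower_box_dim_def \<gamma>_def[symmetric] N_def[symmetric]
      using lim_imp_Limsup[OF _ lim] lim_imp_Liminf[OF _ lim] by simp
  qed
qed

end

text \<open>Since there are finitely many letters, the individual constants combine by maximum,
  minimum or sum into uniform ones. The matrix of partial derivatives is read off from linearity of
  the derivative within the square.\<close>

lemma nonlinear_ifs_imp_dominated_system:
  fixes f :: "'i::finite \<Rightarrow> real \<Rightarrow> real" and g :: "'i \<Rightarrow> real^2 \<Rightarrow> real"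
  assumes ifs: "nonlinear_ifs f g" and dom: "dominated f g"
    and F: "attractor (ifs_map f g) F" and a: "a \<in> unit_square"
  shows "\<exists>fx gx gy \<rho> d \<kappa> M H \<alpha>. dominated_system (ifs_map f g) fx gx gy \<rho> d \<kappa> M H \<alpha> F a"
proof -
  define fx where "fx i z = partial_deriv_on {0..1} (f i) 1 (z $ 1)" for i and z :: "real^2"
  define gx where "gx i = partial_deriv_on unit_square (g i) (axis 1 1)" for i
  define gy where "gy i = partial_deriv_on unit_square (g i) (axis 2 1)" for i
  obtain \<alpha> where \<alpha>: "0 < \<alpha>" "\<And>i. C1_holder_on \<alpha> {0..1} (f i)" "\<And>i. C1_holder_on \<alpha> unit_square (g i)"
    using ifs unfolding nonlinear_ifs_def by blast
  have ax: "axis j (1::real) \<in> Basis" for j :: 2 by (simp add: Basis_vec_def axis_eq_axis)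
  have "\<forall>i. \<exists>c. c < 1 \<and> c-lipschitz_on unit_square (ifs_map f g i)"
    using ifs unfolding nonlinear_ifs_def contraction_on_def by blast
  from choice[OF this] obtain c where c: "\<And>i. c i < 1" "\<And>i. (c i)-lipschitz_on unit_square (ifs_map f g i)"
    by blast
  \<comment> \<open>The maximum with \<open>1 / 2\<close> secures positivity without inspecting the
    Lipschitz constants.\<close>
  define \<rho> where "\<rho> = max (1 / 2) (Max (range c))"
  have \<rho>: "0 < \<rho>" "\<rho> < 1" "\<And>i. c i \<le> \<rho>" using c(1) by (auto simp: \<rho>_def max.coboundedI2)
  have "\<forall>i. \<exists>C. \<forall>x\<in>{0..1}. \<forall>y\<in>{0..1}.
      \<bar>partial_deriv_on {0..1} (f i) 1 x - partial_deriv_on {0..1} (f i) 1 y\<bar> \<le> C * dist x y powr \<alpha>"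
    using \<alpha>(2) unfolding C1_holder_on_def by simp
  from choice[OF this] obtain Cf where Cf: "\<And>i x y. x \<in> {0..1} \<Longrightarrow> y \<in> {0..1} \<Longrightarrow>
      \<bar>partial_deriv_on {0..1} (f i) 1 x - partial_deriv_on {0..1} (f i) 1 y\<bar> \<le> Cf i * dist x y powr \<alpha>" by blast
  have "\<forall>i. \<exists>C. \<forall>x\<in>unit_square. \<forall>y\<in>unit_square. \<bar>gx i x - gx i y\<bar> \<le> C * dist x y powr \<alpha>"
    using \<alpha>(3) ax unfolding C1_holder_on_def gx_def by blast
  from choice[OF this] obtain Cx where Cx: "\<And>i x y. x \<in> unit_square \<Longrightarrow> y \<in> unit_square \<Longrightarrow>
      \<bar>gx i x - gx i y\<bar> \<le> Cx i * dist x y powr \<alpha>" by blast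
  have "\<forall>i. \<exists>C. \<forall>x\<in>unit_square. \<forall>y\<in>unit_square. \<bar>gy i x - gy i y\<bar> \<le> C * dist x y powr \<alpha>"
    using \<alpha>(3) ax unfolding C1_holder_on_def gy_def by blast
  from choice[OF this] obtain Cy where Cy: "\<And>i x y. x \<in> unit_square \<Longrightarrow> y \<in> unit_square \<Longrightarrow>
      \<bar>gy i x - gy i y\<bar> \<le> Cy i * dist x y powr \<alpha>" by blast
  define H where "H = (\<Sum>i\<in>UNIV. \<bar>Cf i\<bar> + \<bar>Cx i\<bar> + \<bar>Cy i\<bar>)"
  have Hi: "\<bar>Cf i\<bar> + \<bar>Cx i\<bar> + \<bar>Cy i\<bar> \<le> H" for i unfolding H_def by (rule member_le_sum) auto
  have H: "\<bar>Cf i\<bar> \<le> H" "\<bar>Cx i\<bar> \<le> H" "\<bar>Cy i\<bar> \<le> H" "0 \<le> H" for i using Hi[of i] by linarith+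
  have up: "u \<le> H * t" if "u \<le> k * s" "\<bar>k\<bar> \<le> H" "0 \<le> s" "s \<le> t" for u k s t :: real
  proof -
    have "k * s \<le> H * t" using that H(4) by (intro mult_mono) auto
    then show ?thesis using that(1) by linarith
  qed
  have fx_holder: "\<bar>fx i x - fx i y\<bar> \<le> H * dist x y powr \<alpha>" if "x \<in> unit_square" "y \<in> unit_square" for i x y
  proof (rule up[of _ "Cf i" "dist (x $ 1) (y $ 1) powr \<alpha>"])
    show "\<bar>fx i x - fx i y\<bar> \<le> Cf i * dist (x $ 1) (y $ 1) powr \<alpha>"
      using that unfolding fx_def by (intro Cf) (auto simp: mem_unit_square)
    show "dist (x $ 1) (y $ 1) powr \<alpha> \<le> dist x y powr \<alpha>"
      using \<alpha>(1) component_le_dist[of x 1 y] by (intro powr_mono2) (auto simp: dist_real_def)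
  qed (use H in auto)
  have gx_holder: "\<bar>gx i x - gx i y\<bar> \<le> H * dist x y powr \<alpha>" if "x \<in> unit_square" "y \<in> unit_square" for i x y
    by (rule up[OF Cx[OF that] H(2)]) auto
  have gy_holder: "\<bar>gy i x - gy i y\<bar> \<le> H * dist x y powr \<alpha>" if "x \<in> unit_square" "y \<in> unit_square" for i x y
    by (rule up[OF Cy[OF that] H(3)]) auto
  have bound: "\<bar>h x\<bar> \<le> \<bar>h 0\<bar> + H * 2 powr \<alpha>"
    if "\<And>x y. x \<in> unit_square \<Longrightarrow> y \<in> unit_square \<Longrightarrow> \<bar>h x - h y\<bar> \<le> H * dist x y powr \<alpha>" "x \<in> unit_square"
    for h :: "real^2 \<Rightarrow> real" and x
  proof -
    have 0: "(0::real^2) \<in> unit_square" by (simp add: mem_unit_square)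
    have "H * dist x 0 powr \<alpha> \<le> H * 2 powr \<alpha>"
      using H(4) \<alpha>(1) dist_unit_square[OF that(2) 0] by (intro mult_left_mono powr_mono2) auto
    then show ?thesis using that(1)[OF that(2) 0] by linarith
  qed
  define M where "M = (\<Sum>i\<in>UNIV. \<bar>gx i 0\<bar>) + H * 2 powr \<alpha>"
  have M: "\<bar>gx i z\<bar> \<le> M" if "z \<in> unit_square" for i z
  proof -
    have "\<bar>gx i 0\<bar> \<le> (\<Sum>i\<in>UNIV. \<bar>gx i 0\<bar>)" by (rule member_le_sum) auto
    then show ?thesis using bound[of "gx i", OF gx_holder that] unfolding M_def by linarith
  qed
  obtain d where d: "0 < d"
    "\<And>i. (INF a\<in>unit_square. fx i a) > (SUP a\<in>unit_square. gy i a)"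
    "\<And>i. (INF a\<in>unit_square. gy i a) \<ge> d"
    using dom unfolding dominated_def Let_def fx_def gy_def by blast
  define \<kappa> where "\<kappa> = Min (range (\<lambda>i. (INF a\<in>unit_square. fx i a) - (SUP a\<in>unit_square. gy i a)))"
  have \<kappa>: "0 < \<kappa>" "\<And>i. \<kappa> \<le> (INF a\<in>unit_square. fx i a) - (SUP a\<in>unit_square. gy i a)"
    using d(2) by (auto simp: \<kappa>_def)
  \<comment> \<open>Real infima and suprema bound the values only for bounded images. Boundedness
    comes from the Hoelder estimate against the value at 0.\<close>
  have bdd: "bdd_below (h ` unit_square) \<and> bdd_above (h ` unit_square)"
    if "\<And>x y. x \<in> unit_square \<Longrightarrow> y \<in> unit_square \<Longrightarrow> \<bar>h x - h y\<bar> \<le> H * dist x y powr \<alpha>"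
    for h :: "real^2 \<Rightarrow> real"
  proof
    have b: "- (\<bar>h 0\<bar> + H * 2 powr \<alpha>) \<le> h x" "h x \<le> \<bar>h 0\<bar> + H * 2 powr \<alpha>" if "x \<in> unit_square" for x
      using bound[of h, OF \<open>\<And>x y. x \<in> unit_square \<Longrightarrow> y \<in> unit_square \<Longrightarrow> \<bar>h x - h y\<bar> \<le> H * dist x y powr \<alpha>\<close> that]
      by linarith+
    show "bdd_below (h ` unit_square)" using b(1) by (rule bdd_belowI2)
    show "bdd_above (h ` unit_square)" using b(2) by (rule bdd_aboveI2)
  qed
  have fx_ge: "(INF a\<in>unit_square. fx i a) \<le> fx i z" if "z \<in> unit_square" for i z
    using that bdd[of "fx i", OF fx_holder] by (intro cINF_lower) auto
  have gy_ge: "(INF a\<in>unit_square. gy i a) \<le> gy i z" if "z \<in> unit_square" for i z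
    using that bdd[of "gy i", OF gy_holder] by (intro cINF_lower) auto
  have gy_le: "gy i z \<le> (SUP a\<in>unit_square. gy i a)" if "z \<in> unit_square" for i z
    using that bdd[of "gy i", OF gy_holder] by (intro cSUP_upper) auto
  have deriv: "(ifs_map f g i has_derivative (\<lambda>v. vector [fx i z * v $ 1, gx i z * v $ 1 + gy i z * v $ 2]))
        (at z within unit_square)" if z: "z \<in> unit_square" for i z
  proof -
    have fd: "(f i has_derivative frechet_derivative (f i) (at x within {0..1})) (at x within {0..1})"
      if "x \<in> {0..1}" for x
      using \<alpha>(2)[of i] that unfolding C1_holder_on_def differentiable_on_def frechet_derivative_works by blast
    have z1: "z $ 1 \<in> {0..1}" using z by (simp add: mem_unit_square)
    have lin1: "frechet_derivative (f i) (at (z $ 1) within {0..1}) v = fx i z * v" for v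
    proof -
      have "linear (frechet_derivative (f i) (at (z $ 1) within {0..1}))"
        using fd[OF z1] by (rule has_derivative_linear)
      from linear_scale[OF this, of v 1] show ?thesis by (simp add: fx_def partial_deriv_on_def)
    qed
    have nth: "((\<lambda>x::real^2. x $ 1) has_derivative (\<lambda>v. v $ 1)) (at z within unit_square)"
      by (rule bounded_linear_imp_has_derivative[OF bounded_linear_vec_nth])
    have sub: "(\<lambda>x. x $ 1) ` unit_square \<subseteq> {0..1}" by (auto simp: mem_unit_square)
    have 1: "((\<lambda>x. f i (x $ 1)) has_derivative (\<lambda>v. fx i z * v $ 1)) (at z within unit_square)"
      using has_derivative_in_compose2[OF fd sub z nth] unfolding lin1 .
    have gd: "(g i has_derivative frechet_derivative (g i) (at z within unit_square)) (at z within unit_square)"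
      using \<alpha>(3)[of i] z unfolding C1_holder_on_def differentiable_on_def frechet_derivative_works by blast
    have lin2: "frechet_derivative (g i) (at z within unit_square) v = gx i z * v $ 1 + gy i z * v $ 2" for v
    proof -
      have l: "linear (frechet_derivative (g i) (at z within unit_square))"
        using gd by (rule has_derivative_linear)
      have "v = (v $ 1) *\<^sub>R axis 1 1 + (v $ 2) *\<^sub>R axis 2 1"
        by (simp add: vec_eq_iff forall_2 axis_def)
      then have "frechet_derivative (g i) (at z within unit_square) v =
          frechet_derivative (g i) (at z within unit_square) ((v $ 1) *\<^sub>R axis 1 1 + (v $ 2) *\<^sub>R axis 2 1)" by simp
      also have "\<dots> = gx i z * v $ 1 + gy i z * v $ 2"
        unfolding linear_add[OF l] linear_scale[OF l] by (simp add: gx_def gy_def partial_deriv_on_def)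
      finally show ?thesis .
    qed
    have 2: "(g i has_derivative (\<lambda>v. gx i z * v $ 1 + gy i z * v $ 2)) (at z within unit_square)"
      using gd unfolding lin2[abs_def] by (simp add: lin2)
    show ?thesis
      unfolding has_derivative_componentwise_within[of "ifs_map f g i"]
    proof
      fix b :: "real^2" assume "b \<in> Basis"
      then obtain j where "b = axis j 1" by (auto simp: Basis_vec_def)
      moreover have "j = 1 \<or> j = 2" by (rule exhaust_2)
      ultimately show "((\<lambda>x. ifs_map f g i x \<bullet> b) has_derivative
          (\<lambda>v. vector [fx i z * v $ 1, gx i z * v $ 1 + gy i z * v $ 2] \<bullet> b)) (at z within unit_square)"
        using 1 2 by (auto simp: inner_axis ifs_map_def)
    qed
  qed
  have "dominated_system (ifs_map f g) fx gx gy \<rho> d \<kappa> M H \<alpha> F a"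
  proof
    show "ifs_map f g i ` unit_square \<subseteq> unit_square" for i
      using ifs unfolding nonlinear_ifs_def by blast
    show "dist (ifs_map f g i x) (ifs_map f g i y) \<le> \<rho> * dist x y"
      if "x \<in> unit_square" "y \<in> unit_square" for i x y
      using lipschitz_onD[OF c(2) that, of i] mult_right_mono[OF \<rho>(3)[of i], of "dist x y"] by simp
    show "d \<le> gy i z" if "z \<in> unit_square" for i z
      using d(3)[of i] gy_ge[OF that, of i] by linarith
    show "gy i z + \<kappa> \<le> fx i z" if "z \<in> unit_square" for i z
      using \<kappa>(2)[of i] fx_ge[OF that, of i] gy_le[OF that, of i] by linarith
  qed (use \<rho> d(1) \<kappa>(1) \<alpha>(1) deriv M fx_holder gy_holder F a in auto)
  then show ?thesis by blast
qed

theorem corollary3p10: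
  fixes f :: "'i::finite \<Rightarrow> real \<Rightarrow> real"
    and g :: "'i \<Rightarrow> real^2 \<Rightarrow> real"
    and p :: "'i \<Rightarrow> real"
    and F :: "(real^2) set"
    and \<mu> :: "(real^2) measure"
    and a :: "real^2"
  assumes "nonlinear_ifs f g"
    and "dominated f g"
    and "attractor (ifs_map f g) F"
    and "probability_vector p"
    and "nonlinear_measure (ifs_map f g) p F \<mu>"
    and "a \<in> unit_square"
  shows "upper_box_dim F \<le> ereal (moment_scaling (ifs_map f g) p \<mu> a 0) \<and>
         (rosc (ifs_map f g) \<longrightarrow>
            has_box_dim F (ereal (moment_scaling (ifs_map f g) p \<mu> a 0)))"
proof -
  obtain fx gx gy \<rho> d \<kappa> M H \<alpha> where "dominated_system (ifs_map f g) fx gx gy \<rho> d \<kappa> M H \<alpha> F a"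
    using nonlinear_ifs_imp_dominated_system[OF assms(1-3,6)] by blast
  then interpret dominated_system "ifs_map f g" fx gx gy \<rho> d \<kappa> M H \<alpha> F a .
  have "\<And>i. 0 < p i" using assms(4) by (simp add: probability_vector_def)
  then show ?thesis using box_dimension[OF assms(5)] by blast
qed

end
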